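(* In addition to the standing assumptions listed in the context, assume (H2): there exist constants $\theta_1\in(0,1)$ and $\theta_2$ such that $\min_{u\in\mathcal{U}(x)}c(x,u)\ge\theta_1V_\star(x)-\theta_2$ for all $x\in\mathbb{X}$. Let $\Phi_0\in\mathcal{L}(\mathbb{X})\cap\mathcal{O}(V_\star)$, let $\Phi_{n+1}(x)=\min_{u\in\mathcal{U}(x)}[c(x,u)-\beta+\int\Phi_n(y)P(dy\,|\,x,u)]$ for $n\ge0$, and let $\hat v_n:\mathbb{X}\to\mathbb{U}$ be a measurable selector of the minimizer in this definition of $\Phi_{n+1}$. Then there exists $N_0\in\mathbb{N}$ such that the stationary Markov control $\hat v_n$ is stabilizing for every $n\ge N_0$, that is, $$\limsup_{N\to\infty}\frac1N\,\mathbb{E}^{\hat v_n}_x\Bigl[\sum_{k=0}^{N-1}c_{\hat v_n}(X_k)\Bigr]<\infty\qquad\text{for all }x\in\mathbb{X}.$$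
   Context: Notation. For a Polish space $\mathbb{Y}$, $\mathfrak{B}(\mathbb{Y})$ is its Borel $\sigma$-algebra, $\mathfrak{P}(\mathbb{Y})$ the Borel probability measures, $\mathcal{M}(\mathbb{Y})$ the real-valued Borel functions, $\mathcal{M}_b(\mathbb{Y})$ the bounded ones, $C_b(\mathbb{Y})$ the bounded continuous functions, and $\mathcal{L}(\mathbb{Y})$ the real-valued lower semicontinuous functions bounded from below. For $f\in\mathcal{M}(\mathbb{X})$, $\|g\|_f=\sup_x\frac{|g(x)|}{1+|f(x)|}$ and $\mathcal{O}(f)=\{g\in\mathcal{M}(\mathbb{X}):\|g\|_f<\infty\}$. Model. A Markov decision process $(\mathbb{X},\mathbb{U},\mathcal{U},P,c)$: the state space $\mathbb{X}$ and the action space $\mathbb{U}$ are Polish; $\mathcal{U}:\mathbb{X}\to\mathfrak{B}(\mathbb{U})$ is a strict (nonempty-valued) measurable multifunction; $\mathbb{K}=\{(x,u):x\in\mathbb{X},\,u\in\mathcal{U}(x)\}$ has the relative topology of $\mathbb{X}\times\mathbb{U}$; $P(\cdot\,|\,x,u)$ is a stochastic kernel on $\mathbb{K}\times\mathfrak{B}(\mathbb{X})$; $c:\mathbb{K}\to[1,\infty]$ is the measurable running cost. Admissible strategies $\xi=\{\xi_t\}\in\mathfrak{U}$ are sequences of stochastic kernels on $\mathbb{U}$ given the history $h_t=(x_0,u_0,\dots,u_{t-1},x_t)$ with $\xi_t(\mathcal{U}(x_t)\,|\,h_t)=1$; $\mathbb{P}^\xi_\mu$, $\mathbb{E}^\xi_\mu$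 are the induced law and expectation of $(X_t,U_t)_{t\ge0}$ with $X_0\sim\mu$ (subscript $x$ for the Dirac mass at $x$). $\mathfrak{U}_{\mathrm{sm}}$ is the set of stationary Markov randomized strategies, i.e. stochastic kernels $v(du\,|\,x)$ with $v(\mathcal{U}(x)\,|\,x)=1$ (a measurable selector $v:\mathbb{X}\to\mathbb{U}$ of $\mathcal{U}$ is identified with the kernel of Dirac masses). For $v\in\mathfrak{U}_{\mathrm{sm}}$, $P_v(A\,|\,x)=\int P(A\,|\,x,u)v(du\,|\,x)$ and $c_v(x)=\int c(x,u)v(du\,|\,x)$. Average cost. $\mathcal{E}(\mu,\xi)=\limsup_{N}\frac1N\mathbb{E}^\xi_\mu[\sum_{n=0}^{N-1}c(X_n,U_n)]$, $J(\mu)=\inf_{\xi\in\mathfrak{U}}\mathcal{E}(\mu,\xi)$ ($J(x)$ for the Dirac mass at $x$), $\beta=\inf_{\mu}J(\mu)$. Standing assumptions. Basic: $P$ is strongly continuous, i.e. $(x,u)\mapsto\int f(y)P(dy\,|\,x,u)$ is continuous on $\mathbb{K}$ for every $f\in\mathcal{M}_b(\mathbb{X})$; $\mathcal{U}$ is upper semicontinuous and closed-valued; $c$ is lower semicontinuous. (A0): there are a bounded (Borel) set $\mathcal{B}\subset\mathbb{X}$ with $\inf_{(x,u)\in(\mathcal{B}^c\times\mathbb{U})\cap\mathbb{K}}c(x,u)>\beta$, a measure $\nu\in\mathfrak{P}(\mathbb{X})$ with $\nu(\mathcal{B})=1$ and a constant $\delta>0$ with $P(A\,|\,x,u)\ge\delta\nu(A)\mathbf{1}_{\mathcal{B}}(x)$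 for all $A\in\mathfrak{B}(\mathbb{X})$, $(x,u)\in\mathbb{K}$, and $\sum_{n\ge1}\mathbb{P}^v_x(X_n\in\mathcal{B})>0$ for all $v\in\mathfrak{U}_{\mathrm{sm}}$, $x\in\mathbb{X}$. Here $\delta$ is chosen so that $\inf_{(x,u)\in(\mathcal{B}\times\mathbb{U})\cap\mathbb{K}}P(\mathcal{B}\,|\,x,u)>\delta$. (A1): either (i) $J(x)<\infty$ for some $x$ and $c$ is inf-compact on $\mathbb{K}$ (all sets $\{c\le\kappa\}$, $\kappa\in\mathbb{R}$, are compact); or (ii) $c$ is $\mathcal{K}$-inf-compact (inf-compact on $(K\times\mathbb{U})\cap\mathbb{K}$ for each compact $K\subset\mathbb{X}$) and (C) holds. Condition (C): there is a continuous one-one embedding of $\mathbb{K}$ into a Polish space whose image has compact closure $\mathbb{K}^*$ ($\mathbb{K}$ being identified with its image), where $\mathbb{K}^*$ is taken to be the closure of $\mathbb{K}$ in $\mathbb{X}^*\times\mathbb{U}^*$ with $\mathbb{X}^*,\mathbb{U}^*$ compact dense embeddings of $\mathbb{X},\mathbb{U}$ into suitable Polish spaces, assumed to exist; and there are a compact $\widetilde K\subset\mathbb{K}$ and $\varepsilon_0>0$ with $c\ge\beta+\varepsilon_0$ on $\mathbb{K}\setminus\widetilde K$. (A2): there exists a $c$-stable $v\in\mathfrak{U}_{\mathrm{sm}}$ (defined below). Split chain. Let $\mathcal{X}=(\mathbb{X}\times\{0\})\cup(\mathcal{B}\times\{1\})$. For $\mu\in\mathfrak{P}(\mathbb{X})$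 (and by linearity for finite measures) define $\breve\mu$ on $\mathcal{X}$ by $\breve\mu(A\times\{0\})=(1-\delta)\mu(A\cap\mathcal{B})+\mu(A\cap\mathcal{B}^c)$, $A\in\mathfrak{B}(\mathbb{X})$, and $\breve\mu(A\times\{1\})=\delta\mu(A)$, $A\in\mathfrak{B}(\mathcal{B})$; $\breve P(\cdot\,|\,x,u)$ is obtained from $P(\cdot\,|\,x,u)$ in this way. The split chain $\breve X_n=(X_n,i_n)$ on $\mathcal{X}$ has kernel $Q(\cdot\,|\,(x,i),u)$ equal to $\breve P(\cdot\,|\,x,u)$ if $i=0$, $x\notin\mathcal{B}$; to $\frac{1}{1-\delta}(\breve P(\cdot\,|\,x,u)-\delta\breve\nu)$ if $i=0$, $x\in\mathcal{B}$; and to $\breve\nu$ if $i=1$, $x\in\mathcal{B}$. Its cost is $\breve c((x,0),u)=c(x,u)$ for $x\in\mathcal{B}^c$, $\breve c((x,0),u)=\frac{c(x,u)}{1-\delta}$ for $x\in\mathcal{B}$, and $\breve c((x,1),u)=0$. A $v\in\mathfrak{U}_{\mathrm{sm}}$ controls the split chain by applying $v(\cdot\,|\,x)$ at $(x,i)$; $\breve c_v(x,i)=\int\breve c((x,i),u)v(du\,|\,x)$ and $\breve{\mathbb{E}}^v_{(x,i)}$ is the expectation started at $(x,i)$. Let $\breve\tau=\min\{n\ge1:\breve X_n\in\mathcal{B}\times\{1\}\}$. A $v\in\mathfrak{U}_{\mathrm{sm}}$ is $c$-stable if $x\mapsto\breve{\mathbb{E}}^v_{(x,0)}[\sum_{k=0}^{\breve\tau-1}\breve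 c_v(\breve X_k)]$ is bounded on every bounded subset of $\mathbb{X}$. Definition of $V_\star$. $\breve V^{(0)}_\star(x)=\inf_{v\in\mathfrak{U}_{\mathrm{sm}}}\breve{\mathbb{E}}^v_{(x,0)}\bigl[\sum_{k=0}^{\breve\tau-1}(\breve c_v(\breve X_k)-\beta)\bigr]$, and $V_\star(x)=(1-\delta)\breve V^{(0)}_\star(x)$ for $x\in\mathcal{B}$, $V_\star(x)=\breve V^{(0)}_\star(x)$ for $x\notin\mathcal{B}$. The function $V_\star\in\mathcal{L}(\mathbb{X})$ solves $V_\star(x)=\min_{u\in\mathcal{U}(x)}[c(x,u)-\beta+\int V_\star(y)P(dy\,|\,x,u)]$. *)

theory Defs
  imports "HOL-Probability.Probability"
begin

section \<open>General notions\<close>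

definition lsc_on :: "'a::topological_space set \<Rightarrow> ('a \<Rightarrow> 'b::linorder) \<Rightarrow> bool" where
  "lsc_on S f \<longleftrightarrow> (\<forall>a. openin (top_of_set S) {z \<in> S. a < f z})"

definition lsc_bounded_below :: "('a::topological_space \<Rightarrow> real) set" where
  "lsc_bounded_below = {f. lsc_on UNIV f \<and> bdd_below (range f)}"

definition weighted_norm :: "('a \<Rightarrow> real) \<Rightarrow> ('a \<Rightarrow> real) \<Rightarrow> ereal" where
  "weighted_norm f g = (SUP x. ereal (\<bar>g x\<bar> / (1 + \<bar>f x\<bar>)))"

definition weighted_class :: "('a::topological_space \<Rightarrow> real) \<Rightarrow> ('a \<Rightarrow> real) set" where
  "weighted_class f = {g \<in> borel_measurable borel. weighted_norm f g < \<infinity>}"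

text \<open>Integral of an extended real function; meaningful if the positive or the negative part has
  a finite integral.\<close>

definition ext_integral :: "'a measure \<Rightarrow> ('a \<Rightarrow> ereal) \<Rightarrow> ereal" where
  "ext_integral M f =
     enn2ereal (\<integral>\<^sup>+z. e2ennreal (f z) \<partial>M) - enn2ereal (\<integral>\<^sup>+z. e2ennreal (- f z) \<partial>M)"

text \<open>Law on the path space of the process with state space \<open>S\<close> whose \<open>n\<close>-th coordinate has,
  given the coordinates \<open>\<omega> 0, \<dots>, \<omega> (n - 1)\<close>, the distribution \<open>\<kappa> n \<omega>\<close> (Ionescu-Tulcea).\<close>

definition path_law :: "'s measure \<Rightarrow> (nat \<Rightarrow> (nat \<Rightarrow> 's) \<Rightarrow> 's measure) \<Rightarrow> (nat \<Rightarrow> 's) measure" where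
  "path_law S \<kappa> = projective_family.lim UNIV (Ionescu_Tulcea.CI \<kappa> (\<lambda>_. S)) (\<lambda>_. S)"

section \<open>Markov decision processes\<close>

text \<open>\<open>P\<close> and \<open>c\<close> are total functions, but only their values on the graph of \<open>\<U>\<close> matter.\<close>

locale mdp =
  fixes \<U> :: "'x::polish_space \<Rightarrow> 'u::polish_space set"
    and P :: "'x \<Rightarrow> 'u \<Rightarrow> 'x measure"
    and c :: "'x \<Rightarrow> 'u \<Rightarrow> ennreal"
begin

definition graph :: "('x \<times> 'u) set" where
  "graph = {(x, u). u \<in> \<U> x}"

definition graph_borel :: "('x \<times> 'u) measure" where
  "graph_borel = restrict_space borel graph"

definition is_mdp :: bool where
  "is_mdp \<longleftrightarrow>
     (\<forall>x. \<U> x \<noteq> {}) \<and> (\<forall>x. \<U> x \<in> sets borel) \<and>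
     (\<forall>G. open G \<longrightarrow> {x. \<U> x \<inter> G \<noteq> {}} \<in> sets borel) \<and>
     (\<lambda>(x, u). P x u) \<in> graph_borel \<rightarrow>\<^sub>M prob_algebra borel \<and>
     (\<lambda>(x, u). c x u) \<in> borel_measurable graph_borel \<and>
     (\<forall>(x, u)\<in>graph. 1 \<le> c x u)"

text \<open>A history \<open>(x\<^sub>0, u\<^sub>0, \<dots>, u\<^bsub>n-1\<^esub>, x\<^sub>n)\<close> is represented by the pair of
  \<open>h\<close>, where \<open>h k = (x\<^sub>k, u\<^sub>k)\<close> for \<open>k < n\<close>, and \<open>x\<^sub>n\<close>.\<close>

definition strategies :: "(nat \<Rightarrow> (nat \<Rightarrow> 'x \<times> 'u) \<Rightarrow> 'x \<Rightarrow> 'u measure) set" where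
  "strategies = {\<xi>. \<forall>n.
     (\<lambda>(h, x). \<xi> n h x) \<in> PiM {0..<n} (\<lambda>_. graph_borel) \<Otimes>\<^sub>M borel \<rightarrow>\<^sub>M prob_algebra borel \<and>
     (\<forall>h\<in>space (PiM {0..<n} (\<lambda>_. graph_borel)). \<forall>x. emeasure (\<xi> n h x) (\<U> x) = 1)}"

definition stationary :: "('x \<Rightarrow> 'u measure) set" where
  "stationary = {v \<in> borel \<rightarrow>\<^sub>M prob_algebra borel. \<forall>x. emeasure (v x) (\<U> x) = 1}"

definition of_stationary :: "('x \<Rightarrow> 'u measure) \<Rightarrow> nat \<Rightarrow> (nat \<Rightarrow> 'x \<times> 'u) \<Rightarrow> 'x \<Rightarrow> 'u measure" where
  "of_stationary v = (\<lambda>n h x. v x)"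

definition of_selector :: "('x \<Rightarrow> 'u) \<Rightarrow> 'x \<Rightarrow> 'u measure" where
  "of_selector f = (\<lambda>x. return borel (f x))"

text \<open>Law of a state-action pair with state distribution \<open>\<mu>\<close> and action kernel \<open>\<kappa>\<close>, as a measure
  on the graph, to which it assigns full mass.\<close>

definition state_action :: "'x measure \<Rightarrow> ('x \<Rightarrow> 'u measure) \<Rightarrow> ('x \<times> 'u) measure" where
  "state_action \<mu> \<kappa> = restrict_space (\<mu> \<bind> (\<lambda>x. distr (\<kappa> x) borel (\<lambda>u. (x, u)))) graph"

definition law :: "(nat \<Rightarrow> (nat \<Rightarrow> 'x \<times> 'u) \<Rightarrow> 'x \<Rightarrow> 'u measure) \<Rightarrow> 'x measure \<Rightarrow> (nat \<Rightarrow> 'x \<times> 'u) measure" where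
  "law \<xi> \<mu> = path_law graph_borel (\<lambda>n \<omega>.
     state_action (case n of 0 \<Rightarrow> \<mu> | Suc m \<Rightarrow> P (fst (\<omega> m)) (snd (\<omega> m))) (\<xi> n \<omega>))"

definition average_cost :: "(nat \<Rightarrow> (nat \<Rightarrow> 'x \<times> 'u) \<Rightarrow> 'x \<Rightarrow> 'u measure) \<Rightarrow> 'x measure \<Rightarrow> ennreal" where
  "average_cost \<xi> \<mu> =
     limsup (\<lambda>N. (\<integral>\<^sup>+\<omega>. (\<Sum>n<N. c (fst (\<omega> n)) (snd (\<omega> n))) \<partial>law \<xi> \<mu>) / of_nat N)"

definition J :: "'x measure \<Rightarrow> ennreal" where
  "J \<mu> = (INF \<xi>\<in>strategies. average_cost \<xi> \<mu>)"

definition \<beta> :: ennreal where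
  "\<beta> = (INF \<mu>\<in>space (prob_algebra borel). J \<mu>)"

text \<open>The integral is restricted to \<open>\<U> x\<close> because \<open>c x\<close> is only known to be measurable there.\<close>

definition cost_under :: "('x \<Rightarrow> 'u measure) \<Rightarrow> 'x \<Rightarrow> ennreal" where
  "cost_under v x = (\<integral>\<^sup>+u\<in>\<U> x. c x u \<partial>v x)"

definition stabilizing :: "('x \<Rightarrow> 'u measure) \<Rightarrow> bool" where
  "stabilizing v \<longleftrightarrow> (\<forall>x.
     limsup (\<lambda>N. (\<integral>\<^sup>+\<omega>. (\<Sum>k<N. cost_under v (fst (\<omega> k)))
                    \<partial>law (of_stationary v) (return borel x)) / of_nat N) < \<infinity>)"

definition basic_assumptions :: bool where
  "basic_assumptions \<longleftrightarrow>
     (\<forall>f\<in>borel_measurable borel. bounded (range f) \<longrightarrow>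
        continuous_on graph (\<lambda>(x, u). \<integral>y. (f y :: real) \<partial>P x u)) \<and>
     (\<forall>F. closed F \<longrightarrow> closed {x. \<U> x \<inter> F \<noteq> {}}) \<and>
     (\<forall>x. closed (\<U> x)) \<and>
     lsc_on graph (\<lambda>(x, u). c x u)"

text \<open>The type arguments are the Polish spaces into which \<open>'x\<close> and \<open>'u\<close> are embedded with
  relatively compact images. A theorem assuming this condition for arbitrary types \<open>'xs\<close> and
  \<open>'us\<close> applies as soon as some such Polish spaces exist.\<close>

definition condition_C :: "'xs::polish_space itself \<Rightarrow> 'us::polish_space itself \<Rightarrow> bool" where
  "condition_C TX TU \<longleftrightarrow>
     (\<exists>(\<phi> :: 'x \<Rightarrow> 'xs) (\<psi> :: 'u \<Rightarrow> 'us).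
        embedding_map euclidean euclidean \<phi> \<and> compact (closure (range \<phi>)) \<and>
        embedding_map euclidean euclidean \<psi> \<and> compact (closure (range \<psi>)) \<and>
        continuous_on graph (map_prod \<phi> \<psi>) \<and> inj_on (map_prod \<phi> \<psi>) graph \<and>
        compact (closure (map_prod \<phi> \<psi> ` graph))) \<and>
     (\<exists>L (\<epsilon>::real). compact L \<and> L \<subseteq> graph \<and> \<epsilon> > 0 \<and>
        (\<forall>(x, u)\<in>graph - L. \<beta> + ennreal \<epsilon> \<le> c x u))"

definition assumption_A1 :: "'xs::polish_space itself \<Rightarrow> 'us::polish_space itself \<Rightarrow> bool" where
  "assumption_A1 TX TU \<longleftrightarrow>
     ((\<exists>x. J (return borel x) < \<infinity>) \<and>
      (\<forall>\<kappa>::real. compact {(x, u) \<in> graph. c x u \<le> ennreal \<kappa>})) \<or>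
     ((\<forall>L. compact L \<longrightarrow> (\<forall>\<kappa>::real. compact {(x, u) \<in> graph. x \<in> L \<and> c x u \<le> ennreal \<kappa>})) \<and>
      condition_C TX TU)"

text \<open>Value iteration. The values are extended reals since their finiteness is not built in.\<close>

definition stage_value :: "('x \<Rightarrow> ereal) \<Rightarrow> 'x \<Rightarrow> 'u \<Rightarrow> ereal" where
  "stage_value f x u = enn2ereal (c x u) - enn2ereal \<beta> + ext_integral (P x u) f"

primrec value_iterate :: "('x \<Rightarrow> real) \<Rightarrow> nat \<Rightarrow> 'x \<Rightarrow> ereal" where
  "value_iterate \<Phi>\<^sub>0 0 = (\<lambda>x. ereal (\<Phi>\<^sub>0 x))"
| "value_iterate \<Phi>\<^sub>0 (Suc n) = (\<lambda>x. INF u\<in>\<U> x. stage_value (value_iterate \<Phi>\<^sub>0 n) x u)"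

definition minimizing_selector :: "('x \<Rightarrow> real) \<Rightarrow> nat \<Rightarrow> ('x \<Rightarrow> 'u) \<Rightarrow> bool" where
  "minimizing_selector \<Phi>\<^sub>0 n f \<longleftrightarrow> f \<in> borel \<rightarrow>\<^sub>M borel \<and>
     (\<forall>x. f x \<in> \<U> x \<and> (\<forall>u\<in>\<U> x. stage_value (value_iterate \<Phi>\<^sub>0 n) x (f x)
                                   \<le> stage_value (value_iterate \<Phi>\<^sub>0 n) x u))"

end

section \<open>The split chain\<close>

locale split_mdp = mdp \<U> P c
  for \<U> :: "'x::polish_space \<Rightarrow> 'u::polish_space set" and P c +
  fixes \<B> :: "'x set" and \<nu> :: "'x measure" and \<delta> :: real
begin

definition assumption_A0 :: bool where
  "assumption_A0 \<longleftrightarrow>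
     bounded \<B> \<and> \<B> \<in> sets borel \<and>
     \<beta> < (INF (x, u)\<in>graph \<inter> (- \<B>) \<times> UNIV. c x u) \<and>
     \<nu> \<in> space (prob_algebra borel) \<and> emeasure \<nu> \<B> = 1 \<and>
     \<delta> > 0 \<and>
     (\<forall>(x, u)\<in>graph. \<forall>A\<in>sets borel. emeasure (P x u) A \<ge> ennreal \<delta> * emeasure \<nu> A * indicator \<B> x) \<and>
     (\<forall>v\<in>stationary. \<forall>x. 0 < (\<Sum>n. emeasure (law (of_stationary v) (return borel x))
        {\<omega> \<in> space (law (of_stationary v) (return borel x)). fst (\<omega> (Suc n)) \<in> \<B>})) \<and>
     ennreal \<delta> < (INF (x, u)\<in>graph \<inter> \<B> \<times> UNIV. emeasure (P x u) \<B>)"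

definition split_space :: "('x \<times> nat) set" where
  "split_space = UNIV \<times> {0} \<union> \<B> \<times> {1}"

definition split_borel :: "('x \<times> nat) measure" where
  "split_borel = restrict_space borel split_space"

definition split_measure :: "'x measure \<Rightarrow> ('x \<times> nat) measure" where
  "split_measure \<mu> = measure_of split_space (sets split_borel) (\<lambda>S.
     ennreal (1 - \<delta>) * emeasure \<mu> ({x. (x, 0) \<in> S} \<inter> \<B>) + emeasure \<mu> ({x. (x, 0) \<in> S} \<inter> - \<B>)
     + ennreal \<delta> * emeasure \<mu> {x. (x, 1) \<in> S})"

definition split_kernel :: "'x \<times> nat \<Rightarrow> 'u \<Rightarrow> ('x \<times> nat) measure" where
  "split_kernel = (\<lambda>(x, i) u.
     if i = 0 then
       if x \<in> \<B> then measure_of split_space (sets split_borel) (\<lambda>S.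
         (emeasure (split_measure (P x u)) S - ennreal \<delta> * emeasure (split_measure \<nu>) S) / ennreal (1 - \<delta>))
       else split_measure (P x u)
     else split_measure \<nu>)"

definition split_cost :: "'x \<times> nat \<Rightarrow> 'u \<Rightarrow> ennreal" where
  "split_cost = (\<lambda>(x, i) u.
     if i = 0 then if x \<in> \<B> then c x u / ennreal (1 - \<delta>) else c x u else 0)"

definition split_cost_under :: "('x \<Rightarrow> 'u measure) \<Rightarrow> 'x \<times> nat \<Rightarrow> ennreal" where
  "split_cost_under v z = (\<integral>\<^sup>+u\<in>\<U> (fst z). split_cost z u \<partial>v (fst z))"

text \<open>The restriction to \<open>\<U> x\<close> discards a null set outside which \<open>P x\<close> is known to be measurable.\<close>

definition split_kernel_under :: "('x \<Rightarrow> 'u measure) \<Rightarrow> 'x \<times> nat \<Rightarrow> ('x \<times> nat) measure" where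
  "split_kernel_under v z = restrict_space (v (fst z)) (\<U> (fst z)) \<bind> split_kernel z"

definition split_law :: "('x \<Rightarrow> 'u measure) \<Rightarrow> 'x \<times> nat \<Rightarrow> (nat \<Rightarrow> 'x \<times> nat) measure" where
  "split_law v z = path_law split_borel (\<lambda>n \<omega>.
     case n of 0 \<Rightarrow> return split_borel z | Suc m \<Rightarrow> split_kernel_under v (\<omega> m))"

definition regeneration_time :: "(nat \<Rightarrow> 'x \<times> nat) \<Rightarrow> enat" where
  "regeneration_time \<omega> = (INF n\<in>{n. n \<ge> 1 \<and> \<omega> n \<in> \<B> \<times> {1}}. enat n)"

definition c_stable :: "('x \<Rightarrow> 'u measure) \<Rightarrow> bool" where
  "c_stable v \<longleftrightarrow> (\<forall>S. bounded S \<longrightarrow> (\<exists>C::real. \<forall>x\<in>S.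
     (\<integral>\<^sup>+\<omega>. (\<Sum>k. if enat k < regeneration_time \<omega> then split_cost_under v (\<omega> k) else 0)
        \<partial>split_law v (x, 0)) \<le> ennreal C))"

definition V_split :: "'x \<Rightarrow> ereal" where
  "V_split x = (INF v\<in>stationary. ext_integral (split_law v (x, 0)) (\<lambda>\<omega>.
     \<Sum>k. if enat k < regeneration_time \<omega>
          then enn2ereal (split_cost_under v (\<omega> k)) - enn2ereal \<beta> else 0))"

text \<open>Under the standing assumptions \<open>V_split\<close> is finite, so nothing is lost by the conversion.\<close>

definition V_star :: "'x \<Rightarrow> real" where
  "V_star x = (if x \<in> \<B> then (1 - \<delta>) * real_of_ereal (V_split x) else real_of_ereal (V_split x))"

definition standing_assumptions :: "'xs::polish_space itself \<Rightarrow> 'us::polish_space itself \<Rightarrow> bool" where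
  "standing_assumptions TX TU \<longleftrightarrow>
     is_mdp \<and> basic_assumptions \<and> assumption_A0 \<and> assumption_A1 TX TU \<and>
     (\<exists>v\<in>stationary. c_stable v)"

definition assumption_H2 :: "real \<Rightarrow> real \<Rightarrow> bool" where
  "assumption_H2 \<theta>\<^sub>1 \<theta>\<^sub>2 \<longleftrightarrow> 0 < \<theta>\<^sub>1 \<and> \<theta>\<^sub>1 < 1 \<and>
     (\<forall>x. ereal (\<theta>\<^sub>1 * V_star x - \<theta>\<^sub>2) \<le> (INF u\<in>\<U> x. enn2ereal (c x u)))"

end

end

theory Submission
  imports Defs
begin

text \<open>
  Splitting off the regeneration turns the relative cost until regeneration, up to a bounded error,
  into a nonnegative total cost: \<open>\<beta>\<close> is subtracted only outside \<open>\<B>\<close>, and the expected number of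
  visits to \<open>\<B>\<close> before regeneration is at most \<open>1 / \<delta>\<close>. Value iteration from \<open>0\<close> for this
  nonnegative problem increases to a limit \<open>\<psi>\<close>; compactness of the sublevel sets of the cost lets
  the limit pass through the minimum, and a measurable selector of the minimizers shows that
  \<open>\<psi> - V\<^sub>\<star>\<close> is bounded. Hence \<open>\<psi>\<close> is a measurable solution of the optimality equation up to
  constants.

  By (H2) the cost dominates \<open>\<theta>\<^sub>1 \<psi>\<close> up to a constant, so with \<open>q = 1 - \<theta>\<^sub>1\<close> the iterates satisfy
  \<open>(1 - q\<^sup>n) \<psi> - A\<^sub>n \<le> \<Phi>\<^sub>n \<le> (1 + K q\<^sup>n) \<psi> + A\<^sub>n\<close>. Therefore \<open>\<Phi>\<^sub>n\<^sub>+\<^sub>1 - \<Phi>\<^sub>n\<close> is at most half of the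
  cost plus a constant when \<open>n\<close> is large, and then \<open>\<Phi>\<^sub>n\<close> is a Lyapunov function for the selector
  \<open>v n\<close>. The constants \<open>A\<^sub>n\<close> may depend on \<open>n\<close>.
\<close>

section \<open>Markov path laws\<close>

text \<open>\<open>V_star\<close> is given only as an infimum, over all stationary controls, of
  signed path integrals; its measurability, the existence of minimizers and the optimality equation
  would each need a proof. The substitute \<open>\<psi>\<close> is measurable because it is a
  countable supremum. A bounded discrepancy from \<open>V_star\<close> is harmless, since every
  later estimate carries additive constants anyway. By (A0) the cost is at least
  \<open>\<beta>\<close> outside \<open>\<B>\<close>. Leaving \<open>\<beta>\<close> unsubtracted on
  \<open>\<B>\<close> thus makes every stage cost nonnegative, and monotone convergence applies in
  \<open>ennreal\<close> without questions of integrability. The price is \<open>\<beta>\<close>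
  times the expected number of visits to \<open>\<B>\<close>. The contraction comes from the cost
  itself: the share of the cost not consumed by the equation for \<open>\<psi>\<close> is bounded
  below by (H2), and it removes the fraction \<open>\<theta>\<^sub>1\<close> of the remaining
  multiplicative gap at each iteration. The additive constants may grow with \<open>n\<close>, since
  stability is claimed for each large \<open>n\<close> separately and asks only for a finite
  average, not for a uniform bound.\<close>

context Ionescu_Tulcea
begin

lemma up_to_atLeast0LessThan: "up_to {0..<n} = n"
  by (rule antisym) (use up_to_iff[of "{0..<n}"] up_to[of "{0..<n}"] in auto)

lemma distr_lim_restrict:
  "distr PF.lim (PiM {0..<n} M) (\<lambda>\<omega>. restrict \<omega> {0..<n}) = C 0 n (\<lambda>_. undefined)"
  using distr_C[of n n "\<lambda>_. undefined" 0]
  by (simp add: distr_lim CI_def up_to_atLeast0LessThan space_PiM)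

lemma nn_integral_lim_restrict:
  assumes f[measurable]: "f \<in> borel_measurable (PiM {0..<n} M)"
  shows "(\<integral>\<^sup>+\<omega>. f (restrict \<omega> {0..<n}) \<partial>PF.lim) = (\<integral>\<^sup>+\<omega>. f \<omega> \<partial>C 0 n (\<lambda>_. undefined))"
proof -
  have "(\<lambda>\<omega>. restrict \<omega> {0..<n}) \<in> PF.lim \<rightarrow>\<^sub>M PiM {0..<n} M"
    by (subst measurable_cong_sets[OF PF.sets_lim refl]) (rule measurable_restrict_subset, simp)
  then show ?thesis
    by (simp add: distr_lim_restrict[symmetric] nn_integral_distr)
qed

text \<open>The marginal \<open>C 0 (Suc n)\<close> is \<open>C 0 n\<close> bound with the extension
  kernel \<open>eP n\<close>, so the last coordinate can be integrated out given the earlier ones.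
  All expectations along paths reduce to this step.\<close>

lemma nn_integral_lim_Suc:
  assumes f[measurable]: "f \<in> borel_measurable (PiM {0..<Suc n} M)"
  shows "(\<integral>\<^sup>+\<omega>. f (restrict \<omega> {0..<Suc n}) \<partial>PF.lim) =
    (\<integral>\<^sup>+\<omega>. (\<integral>\<^sup>+y. f (fun_upd (restrict \<omega> {0..<n}) n y) \<partial>P n (restrict \<omega> {0..<n})) \<partial>PF.lim)"
proof -
  have *: "(\<lambda>\<omega>. \<integral>\<^sup>+y. f (fun_upd \<omega> n y) \<partial>P n \<omega>) \<in> borel_measurable (PiM {0..<n} M)"
    by (rule nn_integral_measurable_subprob_algebra2[OF _ P])
      (auto simp: measurable_split_conv intro!: measurable_compose[OF _ f] measurable_fun_upd[where J="{0..<n}"])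
  have "(\<integral>\<^sup>+\<omega>. f (restrict \<omega> {0..<Suc n}) \<partial>PF.lim) = (\<integral>\<^sup>+\<omega>. f \<omega> \<partial>C 0 (Suc n) (\<lambda>_. undefined))"
    by (rule nn_integral_lim_restrict) fact
  also have "\<dots> = (\<integral>\<^sup>+\<omega>. \<integral>\<^sup>+z. f z \<partial>eP n \<omega> \<partial>C 0 n (\<lambda>_. undefined))"
    by (simp, subst nn_integral_bind[OF f])
      (simp_all add: measurable_eP space_PiM measurable_cong_sets[OF sets_C[of "\<lambda>_. undefined" 0 n] refl])
  also have "\<dots> = (\<integral>\<^sup>+\<omega>. \<integral>\<^sup>+y. f (fun_upd \<omega> n y) \<partial>P n \<omega> \<partial>C 0 n (\<lambda>_. undefined))"
    using space_C[of "\<lambda>_. undefined" 0 n]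
    by (intro nn_integral_cong nn_integral_eP f) (auto simp: space_PiM)
  also have "\<dots> = (\<integral>\<^sup>+\<omega>. (\<integral>\<^sup>+y. f (fun_upd (restrict \<omega> {0..<n}) n y) \<partial>P n (restrict \<omega> {0..<n})) \<partial>PF.lim)"
    by (rule nn_integral_lim_restrict[OF *, symmetric])
  finally show ?thesis .
qed

end

text \<open>The time-homogeneous form of the kernels that \<open>path_law\<close> accepts. The split
  chain and the state-action process under a stationary selector both have it.\<close>

definition markov_kernels :: "'s measure \<Rightarrow> ('s \<Rightarrow> 's measure) \<Rightarrow> nat \<Rightarrow> (nat \<Rightarrow> 's) \<Rightarrow> 's measure" where
  "markov_kernels \<mu> K n \<omega> = (case n of 0 \<Rightarrow> \<mu> | Suc m \<Rightarrow> K (\<omega> m))"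

text \<open>The sub-Markov operator of the chain killed on leaving \<open>D\<close>. Only the state
  after the transition is tested, not the starting point.\<close>

definition killed_operator :: "('s \<Rightarrow> 's measure) \<Rightarrow> 's set \<Rightarrow> ('s \<Rightarrow> ennreal) \<Rightarrow> 's \<Rightarrow> ennreal" where
  "killed_operator K D a z = (\<integral>\<^sup>+y. a y * indicator D y \<partial>K z)"

locale markov_law =
  fixes S :: "'s measure" and \<mu> :: "'s measure" and K :: "'s \<Rightarrow> 's measure"
  assumes initial: "\<mu> \<in> space (prob_algebra S)"
    and kernel[measurable]: "K \<in> S \<rightarrow>\<^sub>M prob_algebra S"
begin

abbreviation "mlaw \<equiv> path_law S (markov_kernels \<mu> K)"

lemma markov_kernels_measurable:
  "markov_kernels \<mu> K n \<in> PiM {0..<n} (\<lambda>_. S) \<rightarrow>\<^sub>M prob_algebra S"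
proof (cases n)
  case 0
  then show ?thesis using initial by (simp add: markov_kernels_def[abs_def])
next
  case (Suc m)
  have "(\<lambda>\<omega>. \<omega> m) \<in> PiM {0..<n} (\<lambda>_. S) \<rightarrow>\<^sub>M S"
    by (rule measurable_component_singleton) (simp add: Suc)
  then show ?thesis by (simp add: markov_kernels_def[abs_def] Suc)
qed

sublocale Ionescu_Tulcea "markov_kernels \<mu> K" "\<lambda>_. S"
proof (rule Ionescu_Tulcea.intro)
  show "markov_kernels \<mu> K i \<in> PiM {0..<i} (\<lambda>_. S) \<rightarrow>\<^sub>M subprob_algebra S" for i
    by (rule measurable_prob_algebraD[OF markov_kernels_measurable])
  fix i :: nat and x assume "x \<in> space (PiM {0..<i} (\<lambda>_. S))"
  from measurable_space[OF markov_kernels_measurable this]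
  show "prob_space (markov_kernels \<mu> K i x)" by (simp add: space_prob_algebra)
qed

lemma sets_law[measurable_cong]: "sets mlaw = sets (PiM UNIV (\<lambda>_. S))"
  by (simp add: path_law_def)

lemma space_law: "space mlaw = space (PiM UNIV (\<lambda>_. S))"
  by (simp add: path_law_def)

lemma prob_space_law: "prob_space mlaw"
proof -
  \<comment> \<open>The marginal on no coordinates already has the same total mass as the path
    law.\<close>
  have m: "(\<lambda>\<omega>. restrict \<omega> {0..<0::nat}) \<in> PF.lim \<rightarrow>\<^sub>M PiM {0..<0} (\<lambda>_. S)"
    by (subst measurable_cong_sets[OF PF.sets_lim refl]) (rule measurable_restrict_subset, simp)
  have "prob_space (distr PF.lim (PiM {0..<0} (\<lambda>_. S)) (\<lambda>\<omega>. restrict \<omega> {0..<0}))"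
    unfolding distr_lim_restrict by (rule prob_space_C) (simp add: space_PiM)
  from prob_space_distrD[OF m this] show ?thesis
    unfolding path_law_def .
qed

lemma nn_integral_law_0:
  assumes [measurable]: "a \<in> borel_measurable S"
  shows "(\<integral>\<^sup>+\<omega>. a (\<omega> 0) \<partial>mlaw) = (\<integral>\<^sup>+y. a y \<partial>\<mu>)"
proof -
  interpret prob_space mlaw by (rule prob_space_law)
  show ?thesis
    using nn_integral_lim_Suc[of "\<lambda>\<omega>. a (\<omega> 0)" 0] emeasure_space_1
    by (simp add: path_law_def[symmetric] markov_kernels_def)
qed

text \<open>The Markov property: \<open>g\<close> sees coordinates up to the current time
  \<open>n\<close> only, so it is a constant factor while coordinate \<open>Suc n\<close> is
  integrated.\<close>

lemma nn_integral_law_Suc: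
  assumes g[measurable]: "g \<in> borel_measurable (PiM {0..<Suc n} (\<lambda>_. S))"
    and a[measurable]: "a \<in> borel_measurable S"
  shows "(\<integral>\<^sup>+\<omega>. g (restrict \<omega> {0..<Suc n}) * a (\<omega> (Suc n)) \<partial>mlaw) =
    (\<integral>\<^sup>+\<omega>. g (restrict \<omega> {0..<Suc n}) * (\<integral>\<^sup>+y. a y \<partial>K (\<omega> n)) \<partial>mlaw)"
proof -
  let ?f = "\<lambda>\<omega>. g (restrict \<omega> {0..<Suc n}) * a (\<omega> (Suc n))"
  have "?f \<in> borel_measurable (PiM {0..<Suc (Suc n)} (\<lambda>_. S))"
    by (intro borel_measurable_times_ennreal measurable_compose[OF _ g] measurable_compose[OF _ a]
        measurable_restrict_subset measurable_component_singleton) auto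
  from nn_integral_lim_Suc[OF this]
  have "(\<integral>\<^sup>+\<omega>. ?f \<omega> \<partial>mlaw) =
    (\<integral>\<^sup>+\<omega>. (\<integral>\<^sup>+y. g (restrict \<omega> {0..<Suc n}) * a y \<partial>K (\<omega> n)) \<partial>mlaw)"
    by (simp add: path_law_def[symmetric] markov_kernels_def Int_absorb1 restrict_fupd)
  also have "\<dots> = (\<integral>\<^sup>+\<omega>. g (restrict \<omega> {0..<Suc n}) * (\<integral>\<^sup>+y. a y \<partial>K (\<omega> n)) \<partial>mlaw)"
  proof (rule nn_integral_cong)
    fix \<omega> assume "\<omega> \<in> space mlaw"
    then have "\<omega> n \<in> space S" by (auto simp: space_law space_PiM)
    then have "a \<in> borel_measurable (K (\<omega> n))"
      using measurable_space[OF kernel] a by (auto simp: space_prob_algebra cong: measurable_cong_sets)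
    then show "(\<integral>\<^sup>+y. g (restrict \<omega> {0..<Suc n}) * a y \<partial>K (\<omega> n)) =
      g (restrict \<omega> {0..<Suc n}) * (\<integral>\<^sup>+y. a y \<partial>K (\<omega> n))"
      by (rule nn_integral_cmult)
  qed
  finally show ?thesis .
qed

lemma killed_operator_measurable[measurable]:
  assumes [measurable]: "a \<in> borel_measurable S" "D \<in> sets S"
  shows "killed_operator K D a \<in> borel_measurable S"
  unfolding killed_operator_def[abs_def]
  by (rule nn_integral_measurable_subprob_algebra2[OF _ measurable_prob_algebraD[OF kernel]]) measurable

text \<open>Integrating out the last coordinate replaces \<open>a\<close> by
  \<open>killed_operator K D a\<close>, so the induction must vary \<open>a\<close>. The event
  begins at time 1, in accordance with the regeneration time, which ignores time 0.\<close>

lemma nn_integral_law_killed: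
  assumes "a \<in> borel_measurable S" and D[measurable]: "D \<in> sets S"
  shows "(\<integral>\<^sup>+\<omega>. indicator {\<omega>. \<forall>j\<in>{1..n}. \<omega> j \<in> D} \<omega> * a (\<omega> n) \<partial>mlaw) =
    (\<integral>\<^sup>+y. (killed_operator K D ^^ n) a y \<partial>\<mu>)"
  using assms(1)
proof (induction n arbitrary: a)
  case 0
  then show ?case by (simp add: nn_integral_law_0)
next
  case (Suc n a)
  note [measurable] = Suc.prems
  let ?g = "\<lambda>\<omega>. indicator {\<omega>. \<forall>j\<in>{1..n}. \<omega> j \<in> D} \<omega> :: ennreal"
  have meas: "?g \<in> borel_measurable (PiM {0..<Suc n} (\<lambda>_. S))"
  proof -
    have "?g \<in> borel_measurable (PiM {0..<Suc n} (\<lambda>_. S)) \<longleftrightarrow>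
      (\<lambda>\<omega>. \<Prod>j\<in>{1..n}. indicator D (\<omega> j) :: ennreal) \<in> borel_measurable (PiM {0..<Suc n} (\<lambda>_. S))"
      by (intro measurable_cong) (auto simp: indicator_def prod_zero_iff)
    also have \<dots>
      by (intro borel_measurable_prod_ennreal measurable_compose[OF measurable_component_singleton]) auto
    finally show ?thesis .
  qed
  have r: "?g (restrict \<omega> {0..<Suc n}) = ?g \<omega>" for \<omega>
    by (auto simp: indicator_def)
  have "(\<integral>\<^sup>+\<omega>. indicator {\<omega>. \<forall>j\<in>{1..Suc n}. \<omega> j \<in> D} \<omega> * a (\<omega> (Suc n)) \<partial>mlaw) =
    (\<integral>\<^sup>+\<omega>. ?g (restrict \<omega> {0..<Suc n}) * (a (\<omega> (Suc n)) * indicator D (\<omega> (Suc n))) \<partial>mlaw)"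
    unfolding r by (intro nn_integral_cong) (auto simp: indicator_def atLeastAtMostSuc_conv)
  also have "\<dots> = (\<integral>\<^sup>+\<omega>. ?g \<omega> * killed_operator K D a (\<omega> n) \<partial>mlaw)"
    by (subst nn_integral_law_Suc[OF meas]) (simp_all only: killed_operator_def r, measurable)
  also have "\<dots> = (\<integral>\<^sup>+y. (killed_operator K D ^^ n) (killed_operator K D a) y \<partial>\<mu>)"
    by (rule Suc.IH) measurable
  finally show ?case by (simp add: funpow_swap1)
qed

end

section \<open>Measurable selection\<close>

lemma compact_nest_nonempty:
  fixes A :: "nat \<Rightarrow> 'a::t2_space set"
  assumes A: "\<And>n. compact (A n)" "\<And>n. A n \<noteq> {}" "\<And>n. A (Suc n) \<subseteq> A n"
  shows "(\<Inter>n. A n) \<noteq> {}"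
proof -
  have "A 0 \<inter> (\<Inter>n\<in>UNIV. A n) \<noteq> {}"
  proof (rule compact_imp_fip_image)
    show "closed (A n)" for n using A(1) by (rule compact_imp_closed)
    fix I :: "nat set" assume "finite I"
    then obtain m where m: "\<And>i. i \<in> I \<Longrightarrow> i \<le> m" by (metis finite_nat_set_iff_bounded_le)
    have "A m \<subseteq> A i" if "i \<le> m" for i using lift_Suc_antimono_le[of A i m] A(3) that by blast
    with m A(2)[of m] show "A 0 \<inter> (\<Inter>n\<in>I. A n) \<noteq> {}" by blast
  qed (rule A(1))
  then show ?thesis by blast
qed

lemma infdist_attained:
  fixes C :: "'a::metric_space set"
  assumes "compact C" "C \<noteq> {}"
  obtains u where "u \<in> C" "dist d u = infdist d C"
proof -
  obtain u where u: "u \<in> C" "\<And>w. w \<in> C \<Longrightarrow> dist d u \<le> dist d w"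
    using continuous_attains_inf[OF assms, of "dist d"]
      continuous_on_dist[OF continuous_on_const continuous_on_id, of C d] by auto
  then have "infdist d C = dist d u"
    using assms(2) by (intro antisym infdist_le) (auto simp: infdist_def intro: cINF_greatest)
  with u that show ?thesis by simp
qed

text \<open>Since the distance to a nonempty compact set is attained, it is at most \<open>r\<close>
  exactly when the set hits \<open>cball d r\<close>. Empty values, where \<open>infdist\<close> is
  0 by convention, must be allowed because the lemma is also applied to intersections with a closed
  set.\<close>

lemma measurable_infdist_compact_valued:
  fixes C :: "'s \<Rightarrow> 'a::metric_space set"
  assumes C: "\<And>x. x \<in> space M \<Longrightarrow> compact (C x)"
    and hit: "\<And>F. closed F \<Longrightarrow> {x \<in> space M. C x \<inter> F \<noteq> {}} \<in> sets M"
  shows "(\<lambda>x. infdist d (C x)) \<in> borel_measurable M"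
proof (rule borel_measurableI_le)
  fix r
  have le: "infdist d (C x) \<le> r \<longleftrightarrow> C x \<inter> cball d r \<noteq> {}" if x: "x \<in> space M" "C x \<noteq> {}" for x
  proof
    assume "infdist d (C x) \<le> r"
    with infdist_attained[OF C[OF x(1)] x(2), of d] show "C x \<inter> cball d r \<noteq> {}"
      by (metis IntI empty_iff mem_cball)
  next
    assume "C x \<inter> cball d r \<noteq> {}"
    then show "infdist d (C x) \<le> r" by (auto intro: infdist_le2)
  qed
  have "{x \<in> space M. infdist d (C x) \<le> r} = {x \<in> space M. C x \<inter> cball d r \<noteq> {}} \<union>
    (if 0 \<le> r then space M - {x \<in> space M. C x \<inter> UNIV \<noteq> {}} else {})"
    using le by (auto simp: infdist_def)
  also have "\<dots> \<in> sets M"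
    using hit[of "cball d r"] hit[of UNIV] by auto
  finally show "{x \<in> space M. infdist d (C x) \<le> r} \<in> sets M" .
qed

text \<open>Minimizing successively the distances to the points of a dense sequence shrinks each value of
  the multifunction to a single point, since a point is determined by these distances.\<close>

lemma measurable_selector_compact_valued:
  fixes A :: "'s \<Rightarrow> 'a::polish_space set"
  assumes A: "\<And>x. x \<in> space M \<Longrightarrow> compact (A x)" "\<And>x. x \<in> space M \<Longrightarrow> A x \<noteq> {}"
    and hit: "\<And>F. closed F \<Longrightarrow> {x \<in> space M. A x \<inter> F \<noteq> {}} \<in> sets M"
  obtains s where "s \<in> borel_measurable M" "\<And>x. x \<in> space M \<Longrightarrow> s x \<in> A x"
proof -
  obtain D :: "'a set" where D: "countable D" "\<And>X. open X \<Longrightarrow> X \<noteq> {} \<Longrightarrow> \<exists>d\<in>D. d \<in> X"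
    using countable_dense_exists by blast
  then have "D \<noteq> {}" by (metis empty_iff open_UNIV UNIV_I)
  define d where "d = from_nat_into D"
  have dense: "\<exists>k. dist u (d k) < e" if "e > 0" for u e
    using D(2)[of "ball u e"] that \<open>D \<noteq> {}\<close> D(1) unfolding d_def
    by (auto dest: from_nat_into_surj)
  define B where "B = rec_nat A (\<lambda>k C x. C x \<inter> cball (d k) (infdist (d k) (C x)))"
  have B0: "B 0 = A" and BS: "\<And>k x. B (Suc k) x = B k x \<inter> cball (d k) (infdist (d k) (B k x))"
    by (simp_all add: B_def)
  have B: "compact (B k x) \<and> B k x \<noteq> {}" if x: "x \<in> space M" for k x
  proof (induction k)
    case (Suc k)
    with infdist_attained[of "B k x" "d k"] show ?case
      unfolding BS by (metis IntI compact_Int_closed closed_cball empty_iff mem_cball order_refl)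
  qed (use A x in \<open>simp add: B0\<close>)
  have hitB: "{x \<in> space M. B k x \<inter> F \<noteq> {}} \<in> sets M" if "closed F" for k F
    using that
  proof (induction k arbitrary: F)
    case (Suc k)
    have *: "{x \<in> space M. B k x \<inter> F \<inter> F' \<noteq> {}} \<in> sets M" if "closed F'" for F'
      using Suc.IH[of "F \<inter> F'"] Suc.prems that by (simp add: Int_assoc closed_Int)
    have [measurable]: "(\<lambda>x. infdist (d k) (B k x)) \<in> borel_measurable M"
      "(\<lambda>x. infdist (d k) (B k x \<inter> F)) \<in> borel_measurable M"
      using B Suc.IH * Suc.prems by (auto intro!: measurable_infdist_compact_valued)
    \<comment> \<open>Some nearest point of \<open>B k x\<close> to \<open>d k\<close> lies in
      \<open>F\<close> exactly when restricting to \<open>F\<close> does not increase the distance.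
      This reduces hitting sets at level \<open>Suc k\<close> to a comparison of two measurable
      functions.\<close>
    have "{x \<in> space M. B (Suc k) x \<inter> F \<noteq> {}} = {x \<in> space M. B k x \<inter> F \<noteq> {}} \<inter>
      {x \<in> space M. infdist (d k) (B k x \<inter> F) \<le> infdist (d k) (B k x)}" (is "?L = ?R")
    proof (intro antisym subsetI)
      fix x assume "x \<in> ?L"
      then obtain u where "x \<in> space M" "u \<in> B k x \<inter> F" "dist (d k) u \<le> infdist (d k) (B k x)"
        unfolding BS by fastforce
      then show "x \<in> ?R" using infdist_le2[of u "B k x \<inter> F" "d k"] by auto
    next
      fix x assume x: "x \<in> ?R"
      then have "compact (B k x \<inter> F)" "B k x \<inter> F \<noteq> {}" using B Suc.prems by auto
      then obtain u where "u \<in> B k x \<inter> F" "dist (d k) u = infdist (d k) (B k x \<inter> F)"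
        by (rule infdist_attained)
      with x show "x \<in> ?L" by (auto simp: BS)
    qed
    also have "\<dots> \<in> sets M" using Suc.IH[OF Suc.prems] by measurable
    finally show ?case .
  qed (use hit in \<open>simp add: B0\<close>)
  have uniq: "u = w" if "\<And>k. u \<in> B k x" "\<And>k. w \<in> B k x" for u w x
  proof (rule ccontr)
    have eq: "dist (d k) y = infdist (d k) (B k x)" if "\<And>k. y \<in> B k x" for k y
      using that[of "Suc k"] infdist_le[OF that[of k], of "d k"] by (auto simp: BS)
    assume "u \<noteq> w"
    then obtain k where k: "dist u (d k) < dist u w / 2" using dense[of "dist u w / 2" u] by auto
    have "dist u w \<le> dist u (d k) + dist (d k) w" by (rule dist_triangle)
    also have "\<dots> = 2 * dist u (d k)" using eq[of u k] eq[of w k] that by (simp add: dist_commute)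
    finally show False using k by simp
  qed
  have anti: "B (Suc k) x \<subseteq> B k x" for k x by (auto simp: BS)
  have "(\<Inter>k. B k x) \<noteq> {}" if "x \<in> space M" for x
    using B[OF that] anti by (intro compact_nest_nonempty) auto
  then have "\<exists>u. \<forall>k. u \<in> B k x" if "x \<in> space M" for x
    using that by blast
  then obtain s where s: "\<And>x k. x \<in> space M \<Longrightarrow> s x \<in> B k x" by metis
  have closed_vimage: "{x \<in> space M. s x \<in> F} \<in> sets M" if F: "closed F" for F
  proof -
    \<comment> \<open>If every \<open>B k x\<close> hits \<open>F\<close>, the nested compact sets
      \<open>B k x \<inter> F\<close> have a common point, which can only be
      \<open>s x\<close>.\<close>
    have "{x \<in> space M. s x \<in> F} = (\<Inter>k. {x \<in> space M. B k x \<inter> F \<noteq> {}})" (is "?L = ?R")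
    proof (intro antisym subsetI)
      fix x assume x: "x \<in> ?R"
      then have xM: "x \<in> space M" by auto
      have "(\<Inter>k. B k x \<inter> F) \<noteq> {}"
        using x B[OF xM] anti F by (intro compact_nest_nonempty) auto
      then obtain u where u: "\<And>k. u \<in> B k x" "u \<in> F" by auto
      with uniq[of u x "s x"] s[OF xM] have "u = s x" by blast
      with u xM show "x \<in> ?L" by simp
    qed (use s in auto)
    also have "\<dots> \<in> sets M" using hitB[OF F] by (intro sets.countable_INT) auto
    finally show ?thesis .
  qed
  have "s \<in> borel_measurable M"
  proof (rule borel_measurableI)
    fix S :: "'a set" assume "open S"
    then have "{x \<in> space M. s x \<in> - S} \<in> sets M" by (intro closed_vimage) auto
    then have "space M - {x \<in> space M. s x \<in> - S} \<in> sets M" by auto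
    also have "space M - {x \<in> space M. s x \<in> - S} = s -` S \<inter> space M" by auto
    finally show "s -` S \<inter> space M \<in> sets M" .
  qed
  with s[of _ 0] show ?thesis using that by (simp add: B0)
qed

section \<open>Dynamic programming\<close>

text \<open>The last assumption is the form of inf-compactness that both alternatives of (A1) share;
  \<open>standing_imp_stable_split_mdp\<close> derives it.\<close>

locale inf_compact_mdp = mdp \<U> P c
  for \<U> :: "'x::polish_space \<Rightarrow> 'u::polish_space set" and P c +
  assumes is_mdp: is_mdp
    and basic: basic_assumptions
    and inf_compact: "\<And>L \<kappa>. compact L \<Longrightarrow>
      compact {(x, u) \<in> graph. x \<in> L \<and> c x u \<le> ennreal \<kappa>}"
begin

text \<open>Around an action outside the closed set \<open>\<U> x\<close> there is a closed ball
  missing \<open>\<U> x\<close>, while upper semicontinuity makes the set of states whose values hit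
  that ball closed. A closed graph is Borel, which the extensions of \<open>P\<close> and
  \<open>c\<close> beyond it require.\<close>

lemma closed_graph: "closed graph"
  unfolding closed_sequential_limits
proof (intro allI impI, elim conjE)
  fix z l assume "\<forall>n. z n \<in> graph" and l: "z \<longlonglongrightarrow> l"
  then have z: "z n \<in> graph" for n by blast
  obtain x u where [simp]: "l = (x, u)" by force
  show "l \<in> graph"
  proof (rule ccontr)
    assume "l \<notin> graph"
    then have "open (- \<U> x)" "u \<in> - \<U> x"
      using basic by (auto simp: graph_def basic_assumptions_def)
    then obtain e where e: "e > 0" "cball u e \<subseteq> - \<U> x"
      unfolding open_contains_cball by blast
    let ?E = "{x. \<U> x \<inter> cball u e \<noteq> {}}"
    have "closed ?E" using basic by (auto simp: basic_assumptions_def)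
    have "(\<lambda>n. snd (z n)) \<longlonglongrightarrow> u" and lim: "(\<lambda>n. fst (z n)) \<longlonglongrightarrow> x"
      using tendsto_snd[OF l] tendsto_fst[OF l] by auto
    then have "eventually (\<lambda>n. dist (snd (z n)) u < e) sequentially"
      using e(1) by (simp add: tendsto_iff)
    then have "eventually (\<lambda>n. fst (z n) \<in> ?E) sequentially"
    proof eventually_elim
      case (elim n)
      with z[of n] show ?case by (auto simp: graph_def dist_commute less_imp_le)
    qed
    then have "x \<in> ?E"
      using Lim_in_closed_set[OF \<open>closed ?E\<close> _ _ lim] by simp
    with e show False by auto
  qed
qed

lemma U_nonempty: "\<U> x \<noteq> {}"
  using is_mdp by (simp add: is_mdp_def)

lemma U_measurable[measurable]: "\<U> x \<in> sets borel"
  using is_mdp by (simp add: is_mdp_def)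

lemma cost_ge_1: "u \<in> \<U> x \<Longrightarrow> 1 \<le> c x u"
  using is_mdp by (auto simp: is_mdp_def graph_def)

lemma P_in_prob_algebra: "u \<in> \<U> x \<Longrightarrow> P x u \<in> space (prob_algebra borel)"
  using is_mdp measurable_space[of "\<lambda>(x, u). P x u" graph_borel "prob_algebra borel" "(x, u)"]
  by (auto simp: is_mdp_def graph_def graph_borel_def space_restrict_space)

lemma prob_space_P: "u \<in> \<U> x \<Longrightarrow> prob_space (P x u)"
  and sets_P: "u \<in> \<U> x \<Longrightarrow> sets (P x u) = sets borel"
  using P_in_prob_algebra[of u x] by (simp_all add: space_prob_algebra)

lemma graph_measurable[measurable]: "graph \<in> sets (borel \<Otimes>\<^sub>M borel)"
  unfolding borel_prod using borel_closed[OF closed_graph] .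

lemma graph_borel_eq: "graph_borel = restrict_space (borel \<Otimes>\<^sub>M borel) graph"
  by (simp add: graph_borel_def borel_prod)

text \<open>\<open>P\<close> and \<open>c\<close> are only measurable on the graph, so they are replaced outside of it.\<close>

definition P_total :: "'x \<times> 'u \<Rightarrow> 'x measure" where
  "P_total z = (if z \<in> graph then P (fst z) (snd z) else return borel (fst z))"

definition c_total :: "'x \<times> 'u \<Rightarrow> ennreal" where
  "c_total z = (if z \<in> graph then c (fst z) (snd z) else 1)"

lemma P_total_eq[simp]: "u \<in> \<U> x \<Longrightarrow> P_total (x, u) = P x u"
  and c_total_eq[simp]: "u \<in> \<U> x \<Longrightarrow> c_total (x, u) = c x u"
  by (simp_all add: P_total_def c_total_def graph_def)

lemma P_total_measurable[measurable]: "P_total \<in> borel \<Otimes>\<^sub>M borel \<rightarrow>\<^sub>M prob_algebra borel"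
proof -
  have "{z \<in> space (borel \<Otimes>\<^sub>M borel). z \<in> graph} \<in> sets (borel \<Otimes>\<^sub>M borel)"
    using graph_measurable by (simp add: space_pair_measure del: graph_measurable)
  moreover have "(\<lambda>z. P (fst z) (snd z)) \<in> restrict_space (borel \<Otimes>\<^sub>M borel) {z. z \<in> graph} \<rightarrow>\<^sub>M prob_algebra borel"
    using is_mdp by (simp add: is_mdp_def graph_borel_eq split_beta')
  moreover have "(\<lambda>z. return borel (fst z)) \<in> restrict_space (borel \<Otimes>\<^sub>M borel) {z. z \<notin> graph} \<rightarrow>\<^sub>M prob_algebra borel"
    by (intro measurable_restrict_space1 measurable_compose[OF measurable_fst measurable_return_prob_space])
  ultimately show ?thesis
    unfolding P_total_def[abs_def] by (simp add: measurable_If_restrict_space_iff)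
qed

lemma c_total_measurable[measurable]: "c_total \<in> borel_measurable (borel \<Otimes>\<^sub>M borel)"
proof -
  have "{z \<in> space (borel \<Otimes>\<^sub>M borel). z \<in> graph} \<in> sets (borel \<Otimes>\<^sub>M borel)"
    using graph_measurable by (simp add: space_pair_measure del: graph_measurable)
  moreover have "(\<lambda>z. c (fst z) (snd z)) \<in> borel_measurable (restrict_space (borel \<Otimes>\<^sub>M borel) {z. z \<in> graph})"
    using is_mdp by (simp add: is_mdp_def graph_borel_eq split_beta')
  ultimately show ?thesis
    unfolding c_total_def[abs_def] by (simp add: measurable_If_restrict_space_iff)
qed

text \<open>The nonnegative counterpart of \<open>stage_value\<close>: without the constant
  \<open>\<beta>\<close> it stays in \<open>ennreal\<close>.\<close>

definition stage :: "('x \<Rightarrow> ennreal) \<Rightarrow> 'x \<Rightarrow> 'u \<Rightarrow> ennreal" where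
  "stage f x u = c x u + (\<integral>\<^sup>+y. f y \<partial>P x u)"

lemma stage_mono: "(\<And>y. f y \<le> g y) \<Longrightarrow> stage f x u \<le> stage g x u"
  unfolding stage_def by (intro add_left_mono nn_integral_mono)

lemma stage_SUP:
  assumes f: "\<And>n. f n \<in> borel_measurable borel" and inc: "incseq f" and u: "u \<in> \<U> x"
  shows "stage (\<lambda>y. SUP n. f n y) x u = (SUP n. stage (f n) x u)"
proof -
  have "(\<integral>\<^sup>+y. (SUP n. f n y) \<partial>P x u) = (SUP n. \<integral>\<^sup>+y. f n y \<partial>P x u)"
    using f inc by (intro nn_integral_monotone_convergence_SUP) (simp_all cong: measurable_cong_sets add: sets_P[OF u])
  then show ?thesis by (simp add: stage_def ennreal_SUP_add_right)
qed

text \<open>Although \<open>f\<close> is merely Borel, strong continuity makes the integrals of its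
  truncations at \<open>n\<close> continuous. Adding the lower semicontinuous cost and taking the
  supremum over \<open>n\<close> preserve lower semicontinuity.\<close>

lemma openin_stage_greater:
  assumes f[measurable]: "f \<in> borel_measurable borel" and a: "0 \<le> a"
  shows "openin (top_of_set graph) {z \<in> graph. ennreal a < stage f (fst z) (snd z)}"
proof -
  define g where "g n y = enn2real (min (f y) (of_nat n))" for n :: nat and y
  have g_meas[measurable]: "g n \<in> borel_measurable borel" for n
    unfolding g_def[abs_def] by measurable
  have min_lt: "min (f y) (of_nat n) < top" for n y
    by (simp add: min_less_iff_disj of_nat_less_top)
  have g_eq: "ennreal (g n y) = min (f y) (of_nat n)" for n y
    using min_lt[of y n] by (simp add: g_def)
  have g_nonneg: "0 \<le> g n y" for n y by (simp add: g_def)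
  have g_le: "g n y \<le> real n" for n y
    unfolding g_def by (rule enn2real_leI) (simp_all add: ennreal_of_nat_eq_real_of_nat[symmetric])
  define I where "I n z = (\<integral>y. g n y \<partial>P (fst z) (snd z))" for n z
  have I: "continuous_on graph (I n)" for n
  proof -
    have "bounded (range (g n))"
      unfolding bounded_iff using g_le g_nonneg by (intro exI[of _ "real n"]) auto
    then show ?thesis
      using basic g_meas[of n] by (simp add: basic_assumptions_def I_def[abs_def] split_beta')
  qed
  have I_eq: "ennreal (I n z) = (\<integral>\<^sup>+y. min (f y) (of_nat n) \<partial>P (fst z) (snd z))" if z: "z \<in> graph" for n z
  proof -
    from z have u: "snd z \<in> \<U> (fst z)" by (auto simp: graph_def)
    interpret prob_space "P (fst z) (snd z)" by (rule prob_space_P[OF u])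
    have "integrable (P (fst z) (snd z)) (g n)"
      using g_le g_nonneg g_meas[of n]
      by (intro integrable_const_bound[of _ "real n"])
        (auto cong: measurable_cong_sets simp: sets_P[OF u])
    then show ?thesis
      unfolding I_def by (subst nn_integral_eq_integral[symmetric]) (auto simp: g_nonneg g_eq)
  qed
  have I_nonneg: "0 \<le> I n z" for n z
    unfolding I_def by (simp add: g_nonneg)
  have f_SUP: "f y = (SUP n. min (f y) (of_nat n))" for y
  proof (cases "f y" rule: ennreal_cases)
    case (real r)
    obtain n where "r \<le> real n" using real_arch_simple by blast
    then have "f y \<le> min (f y) (of_nat n)"
      using real by (simp add: ennreal_of_nat_eq_real_of_nat)
    also have "\<dots> \<le> (SUP n. min (f y) (of_nat n))" by (rule SUP_upper) simp
    finally show ?thesis by (rule antisym) (simp add: SUP_least)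
  qed (simp add: ennreal_SUP_of_nat_eq_top)
  have stage_eq: "stage f (fst z) (snd z) = (SUP n. c (fst z) (snd z) + ennreal (I n z))" if z: "z \<in> graph" for z
  proof -
    from z have u: "snd z \<in> \<U> (fst z)" by (auto simp: graph_def)
    have "stage f (fst z) (snd z) = stage (\<lambda>y. SUP n. min (f y) (of_nat n)) (fst z) (snd z)"
      using f_SUP by simp
    also have "\<dots> = (SUP n. stage (\<lambda>y. min (f y) (of_nat n)) (fst z) (snd z))"
      by (rule stage_SUP[OF _ _ u]) (auto simp: incseq_def le_fun_def intro: min.coboundedI2)
    finally show ?thesis by (simp add: stage_def I_eq[OF z])
  qed
  \<comment> \<open>A sum exceeds \<open>a\<close> exactly when some threshold \<open>t\<close> lies
    below the cost and \<open>a - t\<close> below the integral; each such pair of conditions is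
    relatively open.\<close>
  have "{z \<in> graph. ennreal a < stage f (fst z) (snd z)} =
    (\<Union>n. \<Union>t\<in>{0..}. {z \<in> graph. ennreal t < c (fst z) (snd z)} \<inter> (graph \<inter> I n -` {a - t <..}))" (is "?L = ?R")
  proof (intro antisym subsetI)
    fix z assume "z \<in> ?L"
    then have z: "z \<in> graph" and "ennreal a < stage f (fst z) (snd z)" by auto
    then obtain n where n: "ennreal a < c (fst z) (snd z) + ennreal (I n z)"
      by (auto simp: stage_eq less_SUP_iff)
    have "1 \<le> c (fst z) (snd z)" using z cost_ge_1 by (auto simp: graph_def)
    \<comment> \<open>If the cost is a real \<open>r\<close>, the midpoint of
      \<open>a - I n z\<close> and \<open>r\<close> serves, cut off at 0 to keep \<open>t\<close>
      nonnegative; if the cost is infinite, \<open>a + 1\<close> does.\<close>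
    have "\<exists>t\<ge>0. ennreal t < c (fst z) (snd z) \<and> a - t < I n z"
    proof (cases "c (fst z) (snd z)" rule: ennreal_cases)
      case (real r)
      then have "1 \<le> r" using \<open>1 \<le> c (fst z) (snd z)\<close> by simp
      have "a < r + I n z"
        using n real I_nonneg[of n z] a by (simp add: ennreal_plus[symmetric] ennreal_less_iff del: ennreal_plus)
      with \<open>1 \<le> r\<close> I_nonneg[of n z] real show ?thesis
        by (intro exI[of _ "max 0 ((r + (a - I n z)) / 2)"])
          (auto simp: ennreal_less_iff max_def field_simps)
    next
      case top
      then show ?thesis using I_nonneg[of n z] a by (intro exI[of _ "a + 1"]) simp
    qed
    with z show "z \<in> ?R" by auto
  next
    fix z assume "z \<in> ?R"
    then obtain n t where z: "z \<in> graph" and t: "0 \<le> t" "ennreal t < c (fst z) (snd z)" "a - t < I n z"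
      by auto
    have "ennreal a < ennreal (t + I n z)" using t a by (simp add: ennreal_less_iff)
    also have "\<dots> = ennreal t + ennreal (I n z)" using t I_nonneg by simp
    also have "\<dots> \<le> c (fst z) (snd z) + ennreal (I n z)" using t by (intro add_right_mono) simp
    also have "\<dots> \<le> stage f (fst z) (snd z)" unfolding stage_eq[OF z] by (rule SUP_upper) simp
    finally show "z \<in> ?L" using z by simp
  qed
  also have "openin (top_of_set graph) \<dots>"
    using basic by (intro openin_Union openin_Int ballI continuous_openin_preimage_gen[OF I])
      (auto simp: basic_assumptions_def lsc_on_def split_beta' intro!: openin_Int continuous_openin_preimage_gen[OF I])
  finally show ?thesis .
qed

text \<open>As \<open>stage f\<close> dominates the cost, the set lies in a compact sublevel set of
  \<open>c\<close>, from which lower semicontinuity cuts out a closed part. The constraint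
  \<open>F\<close> prepares the hitting sets needed for measurable selection.\<close>

lemma compact_stage_sublevel:
  assumes f: "f \<in> borel_measurable borel" and "0 \<le> \<kappa>" "compact L" "closed F"
  shows "compact {(x, u) \<in> graph. x \<in> L \<and> u \<in> F \<and> stage f x u \<le> ennreal \<kappa>}"
proof -
  obtain T where T: "open T" "{z \<in> graph. ennreal \<kappa> < stage f (fst z) (snd z)} = graph \<inter> T"
    using openin_stage_greater[OF f \<open>0 \<le> \<kappa>\<close>] by (auto simp: openin_open)
  have "c x u \<le> ennreal \<kappa>" if "stage f x u \<le> ennreal \<kappa>" for x u
    by (rule order_trans[OF _ that]) (simp add: stage_def)
  moreover have "(x, u) \<in> T \<longleftrightarrow> \<not> stage f x u \<le> ennreal \<kappa>" if "(x, u) \<in> graph" for x u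
    using that T(2) by (auto simp: not_le set_eq_iff)
  ultimately have "{(x, u) \<in> graph. x \<in> L \<and> u \<in> F \<and> stage f x u \<le> ennreal \<kappa>} =
    {(x, u) \<in> graph. x \<in> L \<and> c x u \<le> ennreal \<kappa>} \<inter> (- T \<inter> (UNIV \<times> F))"
    by auto
  also have "compact \<dots>"
    using T(1) assms by (intro compact_Int_closed inf_compact closed_Int closed_Times) auto
  finally show ?thesis .
qed

lemma compact_stage_sublevel_section:
  assumes "f \<in> borel_measurable borel" "0 \<le> \<kappa>" "closed F"
  shows "compact {u \<in> \<U> x. u \<in> F \<and> stage f x u \<le> ennreal \<kappa>}"
proof -
  have "compact (snd ` {(y, u) \<in> graph. y \<in> {x} \<and> u \<in> F \<and> stage f y u \<le> ennreal \<kappa>})"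
    using assms by (intro compact_continuous_image compact_stage_sublevel continuous_intros) auto
  also have "snd ` {(y, u) \<in> graph. y \<in> {x} \<and> u \<in> F \<and> stage f y u \<le> ennreal \<kappa>} =
    {u \<in> \<U> x. u \<in> F \<and> stage f x u \<le> ennreal \<kappa>}"
  proof (intro antisym subsetI)
    fix u assume "u \<in> {u \<in> \<U> x. u \<in> F \<and> stage f x u \<le> ennreal \<kappa>}"
    then show "u \<in> snd ` {(y, u) \<in> graph. y \<in> {x} \<and> u \<in> F \<and> stage f y u \<le> ennreal \<kappa>}"
      by (intro image_eqI[of _ _ "(x, u)"]) (simp_all add: graph_def)
  qed (auto simp: graph_def)
  finally show ?thesis .
qed

text \<open>A convergent sequence of states together with its limit is compact. Over that compact
  set the sublevel set is compact, hence so is its projection, which therefore contains the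
  limit.\<close>

lemma closed_stage_sublevel_projection:
  assumes f: "f \<in> borel_measurable borel" and \<kappa>: "0 \<le> \<kappa>" and F: "closed F"
  shows "closed {x. \<exists>u\<in>\<U> x \<inter> F. stage f x u \<le> ennreal \<kappa>}"
  unfolding closed_sequential_limits
proof (intro allI impI, elim conjE)
  fix x l assume x: "\<forall>n. x n \<in> {x. \<exists>u\<in>\<U> x \<inter> F. stage f x u \<le> ennreal \<kappa>}" and l: "x \<longlonglongrightarrow> l"
  define L where "L = insert l (range x)"
  have "compact L"
    using compactin_sequence_with_limit[of euclidean x l "range x"] l by (simp add: L_def)
  let ?E = "fst ` {(x, u) \<in> graph. x \<in> L \<and> u \<in> F \<and> stage f x u \<le> ennreal \<kappa>}"
  have "compact ?E"
    using f \<kappa> F \<open>compact L\<close> by (intro compact_continuous_image compact_stage_sublevel continuous_intros)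
  then have "closed ?E" by (rule compact_imp_closed)
  moreover have "x n \<in> ?E" for n
  proof -
    from x obtain u where "u \<in> \<U> (x n)" "u \<in> F" "stage f (x n) u \<le> ennreal \<kappa>" by blast
    then show ?thesis by (intro image_eqI[of _ _ "(x n, u)"]) (simp_all add: graph_def L_def)
  qed
  ultimately have "l \<in> ?E" using l by (auto intro: closed_sequentially)
  then show "l \<in> {x. \<exists>u\<in>\<U> x \<inter> F. stage f x u \<le> ennreal \<kappa>}"
    by (auto simp: graph_def)
qed

text \<open>Used in two ways: with constant \<open>f\<close> and decreasing \<open>\<kappa>\<close>
  it shows that infima are attained, with increasing \<open>f\<close> and constant
  \<open>\<kappa>\<close> it lets a monotone limit pass through the minimum.\<close>

lemma stage_sublevels_nested:
  assumes f: "\<And>n. f n \<in> borel_measurable borel" "incseq f" and \<kappa>: "\<And>n. 0 \<le> \<kappa> n" "decseq \<kappa>"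
    and F: "closed F" and ex: "\<And>n. \<exists>u\<in>\<U> x \<inter> F. stage (f n) x u \<le> ennreal (\<kappa> n)"
  shows "\<exists>u\<in>\<U> x \<inter> F. \<forall>n. stage (f n) x u \<le> ennreal (\<kappa> n)"
proof -
  have "(\<Inter>n. {u \<in> \<U> x. u \<in> F \<and> stage (f n) x u \<le> ennreal (\<kappa> n)}) \<noteq> {}"
  proof (rule compact_nest_nonempty)
    fix n
    show "compact {u \<in> \<U> x. u \<in> F \<and> stage (f n) x u \<le> ennreal (\<kappa> n)}"
      using f \<kappa> F by (intro compact_stage_sublevel_section)
    show "{u \<in> \<U> x. u \<in> F \<and> stage (f n) x u \<le> ennreal (\<kappa> n)} \<noteq> {}" using ex[of n] by auto
    have "stage (f n) x u \<le> stage (f (Suc n)) x u" for u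
      using f(2) by (intro stage_mono) (simp add: incseq_Suc_iff le_fun_def)
    moreover have "ennreal (\<kappa> (Suc n)) \<le> ennreal (\<kappa> n)"
      using \<kappa>(2) by (intro ennreal_leI) (simp add: decseq_Suc_iff)
    ultimately show "{u \<in> \<U> x. u \<in> F \<and> stage (f (Suc n)) x u \<le> ennreal (\<kappa> (Suc n))} \<subseteq>
      {u \<in> \<U> x. u \<in> F \<and> stage (f n) x u \<le> ennreal (\<kappa> n)}"
      by (auto intro: order_trans)
  qed
  then show ?thesis by blast
qed

text \<open>The restriction to \<open>F\<close> serves measurable selection: the minimizers at
  \<open>x\<close> hit \<open>F\<close> exactly when minimizing over \<open>F\<close> alone does not
  increase the value. If no action lies in \<open>F\<close>, the value is
  \<open>top\<close>.\<close>

definition bellman_on :: "'u set \<Rightarrow> ('x \<Rightarrow> ennreal) \<Rightarrow> 'x \<Rightarrow> ennreal" where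
  "bellman_on F f x = (INF u\<in>\<U> x \<inter> F. stage f x u)"

abbreviation bellman :: "('x \<Rightarrow> ennreal) \<Rightarrow> 'x \<Rightarrow> ennreal" where
  "bellman \<equiv> bellman_on UNIV"

lemma bellman_le: "u \<in> \<U> x \<Longrightarrow> bellman f x \<le> stage f x u"
  unfolding bellman_on_def by (intro INF_lower) simp

text \<open>The infimum is attained: the actions whose value is at most
  \<open>\<kappa> + 1 / (n + 1)\<close> form nested nonempty compact sets.\<close>

lemma bellman_on_le_iff:
  assumes f: "f \<in> borel_measurable borel" and \<kappa>: "0 \<le> \<kappa>" and F: "closed F"
  shows "bellman_on F f x \<le> ennreal \<kappa> \<longleftrightarrow> (\<exists>u\<in>\<U> x \<inter> F. stage f x u \<le> ennreal \<kappa>)"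
proof
  assume le: "bellman_on F f x \<le> ennreal \<kappa>"
  have "\<exists>u\<in>\<U> x \<inter> F. stage f x u \<le> ennreal (\<kappa> + inverse (real (Suc n)))" for n
  proof -
    have "bellman_on F f x < ennreal (\<kappa> + inverse (real (Suc n)))"
      using le \<kappa> by (rule_tac le_less_trans) (auto simp: ennreal_less_iff)
    then show ?thesis
      unfolding bellman_on_def INF_less_iff by (blast intro: less_imp_le)
  qed
  moreover have "decseq (\<lambda>n. \<kappa> + inverse (real (Suc n)))"
    by (auto simp: decseq_def intro: le_imp_inverse_le)
  ultimately obtain u where u: "u \<in> \<U> x \<inter> F" "\<And>n. stage f x u \<le> ennreal (\<kappa> + inverse (real (Suc n)))"
    using stage_sublevels_nested[of "\<lambda>_. f" "\<lambda>n. \<kappa> + inverse (real (Suc n))" F x] f \<kappa> F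
    by (auto simp: incseq_def)
  have "(\<lambda>n. ennreal (\<kappa> + inverse (real (Suc n)))) \<longlonglongrightarrow> ennreal (\<kappa> + 0)"
    by (intro tendsto_ennrealI tendsto_add tendsto_const LIMSEQ_inverse_real_of_nat)
  then have "stage f x u \<le> ennreal \<kappa>"
    using u(2) by (intro LIMSEQ_le_const) auto
  with u show "\<exists>u\<in>\<U> x \<inter> F. stage f x u \<le> ennreal \<kappa>" by blast
next
  assume "\<exists>u\<in>\<U> x \<inter> F. stage f x u \<le> ennreal \<kappa>"
  then show "bellman_on F f x \<le> ennreal \<kappa>"
    unfolding bellman_on_def by (blast intro: INF_lower2)
qed

lemma bellman_on_measurable[measurable]:
  assumes f: "f \<in> borel_measurable borel" and F: "closed F"
  shows "bellman_on F f \<in> borel_measurable borel"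
proof (rule borel_measurableI_le)
  fix y :: ennreal
  show "{x \<in> space borel. bellman_on F f x \<le> y} \<in> sets borel"
  proof (cases y rule: ennreal_cases)
    case (real r)
    then show ?thesis
      using closed_stage_sublevel_projection[OF f, of r F] F by (simp add: bellman_on_le_iff[OF f])
  qed simp
qed

text \<open>Compactness gives the nontrivial inequality: if all the minima are at most
  \<open>r\<close>, the nested compact sublevel sets share one action, and at that action monotone
  convergence bounds the limit by \<open>r\<close>.\<close>

lemma bellman_SUP:
  assumes f: "\<And>n. f n \<in> borel_measurable borel" "incseq f"
  shows "bellman (\<lambda>y. SUP n. f n y) x = (SUP n. bellman (f n) x)"
proof (rule antisym)
  show "bellman (\<lambda>y. SUP n. f n y) x \<le> (SUP n. bellman (f n) x)"
  proof (cases "SUP n. bellman (f n) x" rule: ennreal_cases)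
    case (real r)
    have "\<exists>u\<in>\<U> x \<inter> UNIV. stage (f n) x u \<le> ennreal r" for n
    proof -
      have "bellman (f n) x \<le> ennreal r" unfolding real(2)[symmetric] by (rule SUP_upper) simp
      then show ?thesis using bellman_on_le_iff[OF f(1)[of n] real(1) closed_UNIV] by simp
    qed
    then obtain u where u: "u \<in> \<U> x" "\<And>n. stage (f n) x u \<le> ennreal r"
      using stage_sublevels_nested[OF f, of "\<lambda>_. r" UNIV x] real(1) by (auto simp: decseq_def)
    have "bellman (\<lambda>y. SUP n. f n y) x \<le> stage (\<lambda>y. SUP n. f n y) x u" by (rule bellman_le[OF u(1)])
    also have "\<dots> \<le> ennreal r" using u(2) by (simp add: stage_SUP[OF f u(1)] SUP_le_iff)
    finally show ?thesis using real by simp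
  qed (metis top_greatest)
  show "(SUP n. bellman (f n) x) \<le> bellman (\<lambda>y. SUP n. f n y) x"
  proof (rule SUP_least)
    fix n
    have "stage (f n) x u \<le> stage (\<lambda>y. SUP n. f n y) x u" for u
      by (rule stage_mono) (rule SUP_upper, simp)
    then show "bellman (f n) x \<le> bellman (\<lambda>y. SUP n. f n y) x"
      unfolding bellman_on_def by (blast intro: INF_mono)
  qed
qed

text \<open>The minimizers form nonempty compact sets, and whether they hit a closed set is decided
  by comparing two measurable functions. Finiteness is needed because only sublevels at real heights
  are compact.\<close>

lemma bellman_selector:
  assumes f: "f \<in> borel_measurable borel" and fin: "\<And>x. bellman f x < top"
  obtains s where "s \<in> borel \<rightarrow>\<^sub>M borel" "\<And>x. s x \<in> \<U> x" "\<And>x. stage f x (s x) = bellman f x"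
proof -
  have eq: "bellman f x = ennreal (enn2real (bellman f x))" for x
    using fin[of x] by (rule ennreal_enn2real[symmetric])
  define A where "A x = {u \<in> \<U> x. u \<in> UNIV \<and> stage f x u \<le> bellman f x}" for x
  have A_compact: "compact (A x)" for x
    unfolding A_def by (subst eq) (rule compact_stage_sublevel_section[OF f], simp_all)
  have A_hit: "A x \<inter> F \<noteq> {} \<longleftrightarrow> bellman_on F f x \<le> bellman f x" if "closed F" for x F
    using bellman_on_le_iff[OF f enn2real_nonneg that, of x "bellman f x"] eq[of x]
    by (auto simp: A_def)
  have A_nonempty: "A x \<noteq> {}" for x using A_hit[of UNIV x] by auto
  have hit: "{x \<in> space borel. A x \<inter> F \<noteq> {}} \<in> sets borel" if F: "closed F" for F
  proof -
    note [measurable] = bellman_on_measurable[OF f F] bellman_on_measurable[OF f closed_UNIV]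
    show ?thesis unfolding A_hit[OF F] by measurable
  qed
  obtain s where s: "s \<in> borel \<rightarrow>\<^sub>M borel" "\<And>x. x \<in> space borel \<Longrightarrow> s x \<in> A x"
    by (rule measurable_selector_compact_valued[OF A_compact A_nonempty hit], assumption) (erule that)
  then show ?thesis
    by (intro that[of s]) (auto simp: A_def intro!: antisym bellman_le)
qed

end

section \<open>The split chain\<close>

locale inf_compact_split_mdp =
  split_mdp \<U> P c \<B> \<nu> \<delta> + inf_compact_mdp \<U> P c
  for \<U> :: "'x::polish_space \<Rightarrow> 'u::polish_space set" and P c \<B> \<nu> \<delta> +
  assumes A0: assumption_A0
begin

lemma B_measurable[measurable]: "\<B> \<in> sets borel"
  using A0 by (simp add: assumption_A0_def)

lemma \<beta>_finite: "\<beta> < top"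
  using A0 unfolding assumption_A0_def by (auto intro: less_le_trans)

lemma cost_ge_\<beta>: "x \<notin> \<B> \<Longrightarrow> u \<in> \<U> x \<Longrightarrow> \<beta> \<le> c x u"
proof -
  assume "x \<notin> \<B>" "u \<in> \<U> x"
  then have "(INF (x, u)\<in>graph \<inter> (- \<B>) \<times> UNIV. c x u) \<le> c x u"
    by (intro INF_lower2[of "(x, u)"]) (auto simp: graph_def)
  moreover have "\<beta> < (INF (x, u)\<in>graph \<inter> (- \<B>) \<times> UNIV. c x u)"
    using A0 by (simp add: assumption_A0_def)
  ultimately show ?thesis by simp
qed

lemma \<nu>_in_prob_algebra[measurable]: "\<nu> \<in> space (prob_algebra borel)"
  using A0 by (simp add: assumption_A0_def)

lemma sets_\<nu>: "sets \<nu> = sets borel" and prob_space_\<nu>: "prob_space \<nu>"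
  using \<nu>_in_prob_algebra by (simp_all add: space_prob_algebra)

lemma \<nu>_B: "emeasure \<nu> \<B> = 1"
  using A0 by (simp add: assumption_A0_def)

lemma AE_\<nu>_B: "AE x in \<nu>. x \<in> \<B>"
  using \<nu>_B prob_space.AE_prob_1[OF prob_space_\<nu>, of \<B>] by (simp add: measure_def)

lemma \<delta>_pos: "0 < \<delta>"
  using A0 by (simp add: assumption_A0_def)

text \<open>Because \<open>\<nu>\<close> charges \<open>\<B>\<close>, the last infimum in (A0) runs
  over a nonempty set and is at most 1.\<close>

lemma \<delta>_less_1: "\<delta> < 1"
proof -
  have "\<B> \<noteq> {}" using \<nu>_B by auto
  then obtain x where x: "x \<in> \<B>" by blast
  obtain u where u: "u \<in> \<U> x" using U_nonempty[of x] by blast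
  have "ennreal \<delta> < (INF (x, u)\<in>graph \<inter> \<B> \<times> UNIV. emeasure (P x u) \<B>)"
    using A0 by (simp add: assumption_A0_def)
  also have "\<dots> \<le> emeasure (P x u) \<B>"
    using x u by (intro INF_lower2[of "(x, u)"]) (auto simp: graph_def)
  also have "\<dots> \<le> 1"
    using prob_space_P[OF u] by (simp add: prob_space.emeasure_le_1)
  finally show ?thesis by (simp add: ennreal_less_one_iff)
qed

lemma minorization:
  "x \<in> \<B> \<Longrightarrow> u \<in> \<U> x \<Longrightarrow> A \<in> sets borel \<Longrightarrow> ennreal \<delta> * emeasure \<nu> A \<le> emeasure (P x u) A"
  using A0 by (fastforce simp: assumption_A0_def graph_def)

definition \<sigma> :: real where "\<sigma> = 1 - \<delta>"

lemma \<sigma>: "0 < \<sigma>" "\<sigma> < 1" "\<delta> + \<sigma> = 1" "\<sigma> + \<delta> = 1"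
  using \<delta>_pos \<delta>_less_1 by (auto simp: \<sigma>_def)

lemma \<sigma>_\<delta>_ennreal: "ennreal \<sigma> * a + ennreal \<delta> * a = a"
  using \<sigma> \<delta>_pos by (simp add: distrib_right[symmetric] ennreal_plus[symmetric] del: ennreal_plus)

section \<open>Splitting of measures and the residual kernel\<close>

lemma space_split_borel: "space split_borel = split_space"
  by (simp add: split_borel_def space_restrict_space)

lemma split_space_sets: "split_space \<in> sets borel"
  unfolding split_space_def borel_prod[symmetric]
  by (intro sets.Un pair_measureI) auto

lemma split_borel_measurable_iff:
  "f \<in> M \<rightarrow>\<^sub>M split_borel \<longleftrightarrow> f \<in> space M \<rightarrow> split_space \<and> f \<in> M \<rightarrow>\<^sub>M borel \<Otimes>\<^sub>M borel"
  unfolding split_borel_def borel_prod by (auto simp: measurable_restrict_space2_iff)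

lemma measurable_fst_split[measurable]: "fst \<in> split_borel \<rightarrow>\<^sub>M borel"
  and measurable_snd_split[measurable]: "snd \<in> split_borel \<rightarrow>\<^sub>M borel"
  unfolding split_borel_def borel_prod[symmetric] by (intro measurable_restrict_space1; simp)+

text \<open>The splitting of the Dirac mass at \<open>x\<close>, realized by a coin with bias
  \<open>\<delta>\<close>. Every split measure is a mixture of these, so measurability and
  integration formulas come from the Giry monad.\<close>

definition split_point :: "'x \<Rightarrow> ('x \<times> nat) measure" where
  "split_point x = distr (measure_pmf (bernoulli_pmf \<delta>)) split_borel
     (\<lambda>b. if b \<and> x \<in> \<B> then (x, 1) else (x, 0))"

lemma split_choice_measurable:
  "(\<lambda>(x, b). if b \<and> x \<in> \<B> then (x, 1) else (x, 0)) \<in> borel \<Otimes>\<^sub>M count_space UNIV \<rightarrow>\<^sub>M split_borel"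
proof -
  have "(\<lambda>(x, b). if b \<and> x \<in> \<B> then (x, 1) else (x, 0)) \<in>
    borel \<Otimes>\<^sub>M count_space UNIV \<rightarrow>\<^sub>M borel \<Otimes>\<^sub>M (borel :: nat measure)"
    by measurable
  then show ?thesis
    unfolding split_borel_measurable_iff by (auto simp: split_space_def)
qed

lemma split_point_measurable[measurable]: "split_point \<in> borel \<rightarrow>\<^sub>M prob_algebra split_borel"
  unfolding split_point_def[abs_def]
proof (rule measurable_distr_prob_space2[OF _ split_choice_measurable])
  have "measure_pmf (bernoulli_pmf \<delta>) \<in> space (prob_algebra (count_space UNIV))"
    by (simp add: space_prob_algebra measure_pmf.prob_space_axioms)
  then show "(\<lambda>x. measure_pmf (bernoulli_pmf \<delta>)) \<in> borel \<rightarrow>\<^sub>M prob_algebra (count_space UNIV)"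
    by simp
qed

lemma nn_integral_split_point:
  assumes [measurable]: "F \<in> borel_measurable split_borel"
  shows "(\<integral>\<^sup>+z. F z \<partial>split_point x) =
    (if x \<in> \<B> then ennreal \<sigma> * F (x, 0) + ennreal \<delta> * F (x, 1) else F (x, 0))"
proof -
  have "(\<lambda>b. if b \<and> x \<in> \<B> then (x, 1) else (x, 0)) \<in> measure_pmf (bernoulli_pmf \<delta>) \<rightarrow>\<^sub>M split_borel"
    by (auto simp: space_split_borel split_space_def)
  then have "(\<integral>\<^sup>+z. F z \<partial>split_point x) =
    (\<integral>\<^sup>+b. F (if b \<and> x \<in> \<B> then (x, 1) else (x, 0)) \<partial>bernoulli_pmf \<delta>)"
    unfolding split_point_def by (rule nn_integral_distr) measurable
  also have "\<dots> = F (if x \<in> \<B> then (x, 1) else (x, 0)) * ennreal \<delta> + F (x, 0) * ennreal \<sigma>"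
    using \<delta>_pos \<delta>_less_1 by (subst nn_integral_bernoulli_pmf) (auto simp: \<sigma>_def)
  finally show ?thesis
    using \<sigma>_\<delta>_ennreal[of "F (x, 0)"] by (simp add: ac_simps)
qed

lemma split_section_measurable[measurable]:
  assumes "S \<in> sets split_borel"
  shows "{x. (x, i) \<in> S} \<in> sets borel"
proof -
  have S: "S \<in> sets (borel \<Otimes>\<^sub>M borel)"
    unfolding borel_prod using assms split_space_sets
    by (auto simp: split_borel_def sets_restrict_space)
  have "(\<lambda>x. (x, i)) -` S \<inter> space borel \<in> sets borel"
    by (rule measurable_sets[OF _ S]) simp
  then show ?thesis by (simp add: vimage_def)
qed

lemma split_borel_level_1: "S \<in> sets split_borel \<Longrightarrow> (x, 1) \<in> S \<Longrightarrow> x \<in> \<B>"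
  using sets.sets_into_space[of S split_borel] by (auto simp: space_split_borel split_space_def)

text \<open>A \<open>measure_of\<close> expression carries information only once its set function is
  known to be a measure. The mixture of the \<open>split_point x\<close> is a measure and takes the
  prescribed values on all measurable sets.\<close>

lemma split_measure_eq_bind:
  assumes \<mu>: "\<mu> \<in> space (prob_algebra borel)"
  shows "split_measure \<mu> = \<mu> \<bind> split_point"
proof -
  have sets: "sets (\<mu> \<bind> split_point) = sets split_borel"
    by (rule sets_bind'[OF \<mu> split_point_measurable])
  then have space: "space (\<mu> \<bind> split_point) = split_space"
    by (simp add: sets_eq_imp_space_eq space_split_borel)
  have \<mu>_sets[measurable_cong]: "sets \<mu> = sets borel" using \<mu> by (simp add: space_prob_algebra)
  have eq: "emeasure (\<mu> \<bind> split_point) S = ennreal (1 - \<delta>) * emeasure \<mu> ({x. (x, 0) \<in> S} \<inter> \<B>) +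
    emeasure \<mu> ({x. (x, 0) \<in> S} \<inter> - \<B>) + ennreal \<delta> * emeasure \<mu> {x. (x, 1) \<in> S}"
    if S[measurable]: "S \<in> sets split_borel" for S
  proof -
    have "emeasure (\<mu> \<bind> split_point) S = (\<integral>\<^sup>+x. emeasure (split_point x) S \<partial>\<mu>)"
      by (rule emeasure_bind_prob_algebra[OF \<mu> split_point_measurable S])
    also have "\<dots> = (\<integral>\<^sup>+x. (ennreal \<sigma> * indicator ({x. (x, 0) \<in> S} \<inter> \<B>) x +
      indicator ({x. (x, 0) \<in> S} \<inter> - \<B>) x) + ennreal \<delta> * indicator {x. (x, 1) \<in> S} x \<partial>\<mu>)"
    proof (rule nn_integral_cong)
      fix x
      have "sets (split_point x) = sets split_borel" by (simp add: split_point_def)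
      then have "emeasure (split_point x) S = (\<integral>\<^sup>+z. indicator S z \<partial>split_point x)"
        by simp
      also have "\<dots> = (ennreal \<sigma> * indicator ({x. (x, 0) \<in> S} \<inter> \<B>) x +
        indicator ({x. (x, 0) \<in> S} \<inter> - \<B>) x) + ennreal \<delta> * indicator {x. (x, 1) \<in> S} x"
        using split_borel_level_1[OF S]
        by (subst nn_integral_split_point) (auto simp: indicator_def)
      finally show "emeasure (split_point x) S = \<dots>" .
    qed
    also have "\<dots> = ennreal \<sigma> * emeasure \<mu> ({x. (x, 0) \<in> S} \<inter> \<B>) +
      emeasure \<mu> ({x. (x, 0) \<in> S} \<inter> - \<B>) + ennreal \<delta> * emeasure \<mu> {x. (x, 1) \<in> S}"
      by (simp add: nn_integral_add nn_integral_cmult)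
    finally show ?thesis by (simp add: \<sigma>_def)
  qed
  have "split_measure \<mu> = measure_of (space (\<mu> \<bind> split_point)) (sets (\<mu> \<bind> split_point))
    (emeasure (\<mu> \<bind> split_point))"
    unfolding split_measure_def sets space
    using sets.sigma_sets_eq[of split_borel] sets.space_closed[of split_borel]
    by (intro measure_of_eq) (auto simp: eq space_split_borel)
  then show ?thesis by (simp add: measure_of_of_measure)
qed

lemma split_measure_measurable[measurable]: "split_measure \<in> prob_algebra borel \<rightarrow>\<^sub>M prob_algebra split_borel"
proof (subst measurable_cong[OF split_measure_eq_bind])
  show "(\<lambda>\<mu>. \<mu> \<bind> split_point) \<in> prob_algebra borel \<rightarrow>\<^sub>M prob_algebra split_borel"
    by measurable
qed

lemma split_measure_in_prob_algebra:
  "\<mu> \<in> space (prob_algebra borel) \<Longrightarrow> split_measure \<mu> \<in> space (prob_algebra split_borel)"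
  by (rule measurable_space[OF split_measure_measurable])

lemma nn_integral_split_measure:
  assumes \<mu>: "\<mu> \<in> space (prob_algebra borel)" and F[measurable]: "F \<in> borel_measurable split_borel"
  shows "(\<integral>\<^sup>+z. F z \<partial>split_measure \<mu>) =
    (\<integral>\<^sup>+x. (if x \<in> \<B> then ennreal \<sigma> * F (x, 0) + ennreal \<delta> * F (x, 1) else F (x, 0)) \<partial>\<mu>)"
proof -
  have "split_point \<in> \<mu> \<rightarrow>\<^sub>M subprob_algebra split_borel"
    using \<mu> split_point_measurable
    by (auto simp: space_prob_algebra cong: measurable_cong_sets intro!: measurable_prob_algebraD)
  then show ?thesis
    by (simp add: split_measure_eq_bind[OF \<mu>] nn_integral_bind[OF F] nn_integral_split_point[OF F])
qed

text \<open>Built from \<open>diff_measure\<close>, so that it is a measure by construction;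
  \<open>split_kernel_residual\<close> identifies it with the set function used in
  \<open>split_kernel\<close>.\<close>

definition residual_kernel :: "'x \<Rightarrow> 'u \<Rightarrow> ('x \<times> nat) measure" where
  "residual_kernel x u = scale_measure (1 / ennreal \<sigma>)
     (diff_measure (split_measure (P x u)) (scale_measure (ennreal \<delta>) (split_measure \<nu>)))"

lemma ennreal_divide_eq: "a / b = (1 / b) * (a::ennreal)"
  by (simp add: divide_ennreal_def mult.commute)

context
  fixes x u assumes x: "x \<in> \<B>" and u: "u \<in> \<U> x"
begin

text \<open>Splitting is linear: both sides integrate the same function \<open>h\<close>, once
  against \<open>\<delta>\<close> times \<open>\<nu>\<close> and once against \<open>P x u\<close>,
  so the minorization of the unsplit kernel carries over.\<close>

lemma split_minorization:
  assumes S: "S \<in> sets split_borel"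
  shows "ennreal \<delta> * emeasure (split_measure \<nu>) S \<le> emeasure (split_measure (P x u)) S"
proof -
  have le: "scale_measure (ennreal \<delta>) \<nu> \<le> P x u"
    using minorization[OF x u] by (subst le_measure) (simp_all add: sets_\<nu> sets_P[OF u])
  note [measurable] = S
  define h where "h y = (\<integral>\<^sup>+z. indicator S z \<partial>split_point y)" for y
  have h[measurable]: "h \<in> borel_measurable borel"
    unfolding h_def[abs_def]
    by (rule nn_integral_measurable_subprob_algebra2[OF _ measurable_prob_algebraD[OF split_point_measurable]])
      measurable
  have eq: "emeasure (split_measure \<mu>) S = (\<integral>\<^sup>+y. h y \<partial>\<mu>)" if \<mu>: "\<mu> \<in> space (prob_algebra borel)" for \<mu>
    using nn_integral_split_measure[OF \<mu>, of "indicator S"] split_measure_in_prob_algebra[OF \<mu>]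
    by (simp add: h_def nn_integral_split_point space_prob_algebra)
  have "ennreal \<delta> * emeasure (split_measure \<nu>) S = (\<integral>\<^sup>+y. h y \<partial>scale_measure (ennreal \<delta>) \<nu>)"
    by (simp add: eq[OF \<nu>_in_prob_algebra] nn_integral_scale_measure cong: measurable_cong_sets add: sets_\<nu>)
  also have "\<dots> \<le> (\<integral>\<^sup>+y. h y \<partial>P x u)"
    by (rule nn_integral_mono_measure[OF _ le]) (simp add: sets_\<nu> sets_P[OF u])
  finally show ?thesis using eq[OF P_in_prob_algebra[OF u]] by simp
qed

lemma sets_residual_kernel: "sets (residual_kernel x u) = sets split_borel"
  using split_measure_in_prob_algebra[OF P_in_prob_algebra[OF u]]
  by (simp add: residual_kernel_def space_prob_algebra)

lemma emeasure_residual_kernel: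
  assumes S: "S \<in> sets split_borel"
  shows "emeasure (residual_kernel x u) S =
    (emeasure (split_measure (P x u)) S - ennreal \<delta> * emeasure (split_measure \<nu>) S) / ennreal \<sigma>"
proof -
  have P: "sets (split_measure (P x u)) = sets split_borel" "prob_space (split_measure (P x u))"
    and N: "sets (split_measure \<nu>) = sets split_borel" "prob_space (split_measure \<nu>)"
    using split_measure_in_prob_algebra[OF P_in_prob_algebra[OF u]]
      split_measure_in_prob_algebra[OF \<nu>_in_prob_algebra]
    by (simp_all add: space_prob_algebra)
  have fin: "finite_measure (scale_measure (ennreal \<delta>) (split_measure \<nu>))"
    by (rule finite_measureI) (simp add: prob_space.emeasure_space_1[OF N(2)] space_scale_measure)
  show ?thesis
    unfolding residual_kernel_def emeasure_scale_measure
    by (subst emeasure_diff_measure[OF prob_space.finite_measure[OF P(2)] fin])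
      (simp_all add: P N S split_minorization ennreal_divide_eq[of "_ - _"])
qed

lemma split_kernel_residual: "split_kernel (x, 0) u = residual_kernel x u"
proof -
  have space: "space (residual_kernel x u) = split_space"
    using sets_residual_kernel by (simp add: sets_eq_imp_space_eq space_split_borel)
  have "split_kernel (x, 0) u = measure_of (space (residual_kernel x u)) (sets (residual_kernel x u))
    (emeasure (residual_kernel x u))"
    unfolding split_kernel_def space sets_residual_kernel
    using sets.sigma_sets_eq[of split_borel] sets.space_closed[of split_borel] x
    by (simp, intro measure_of_eq) (auto simp: emeasure_residual_kernel space_split_borel \<sigma>_def)
  then show ?thesis by (simp add: measure_of_of_measure)
qed

lemma residual_kernel_in_prob_algebra: "residual_kernel x u \<in> space (prob_algebra split_borel)"
proof -
  have "emeasure (split_measure \<mu>) split_space = 1" if "\<mu> \<in> space (prob_algebra borel)" for \<mu>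
    using split_measure_in_prob_algebra[OF that] prob_space.emeasure_space_1
    unfolding space_prob_algebra space_split_borel[symmetric]
    by (metis (mono_tags, lifting) mem_Collect_eq sets_eq_imp_space_eq)
  then have P: "emeasure (split_measure (P x u)) split_space = 1"
    and N: "emeasure (split_measure \<nu>) split_space = 1"
    using P_in_prob_algebra[OF u] \<nu>_in_prob_algebra by auto
  have "emeasure (residual_kernel x u) split_space = (1 - ennreal \<delta>) / ennreal \<sigma>"
    using sets.top[of split_borel] by (simp add: emeasure_residual_kernel space_split_borel P N)
  also have "1 - ennreal \<delta> = ennreal \<sigma>"
    using \<delta>_pos by (simp add: \<sigma>_def ennreal_minus ennreal_1[symmetric] del: ennreal_1)
  also have "ennreal \<sigma> / ennreal \<sigma> = 1" using \<sigma> by (simp add: divide_ennreal)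
  finally show ?thesis
    using sets_residual_kernel sets_eq_imp_space_eq[OF sets_residual_kernel]
    by (auto simp: space_prob_algebra space_split_borel intro!: prob_spaceI)
qed

text \<open>Nummelin's decomposition in a subtraction-free form, valid also for infinite integrals.
  The split transition law is a coin-flip mixture of \<open>split_measure \<nu>\<close> and the
  residual kernel, and integrals against a mixture need no finiteness.\<close>

lemma nn_integral_residual_kernel:
  assumes F[measurable]: "F \<in> borel_measurable split_borel"
  shows "ennreal \<sigma> * (\<integral>\<^sup>+z. F z \<partial>residual_kernel x u) + ennreal \<delta> * (\<integral>\<^sup>+z. F z \<partial>split_measure \<nu>) =
    (\<integral>\<^sup>+z. F z \<partial>split_measure (P x u))"
proof -
  let ?K = "\<lambda>b. if b then split_measure \<nu> else residual_kernel x u"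
  have "?K b \<in> space (prob_algebra split_borel)" for b
    using residual_kernel_in_prob_algebra split_measure_in_prob_algebra[OF \<nu>_in_prob_algebra] by simp
  then have K: "?K \<in> count_space UNIV \<rightarrow>\<^sub>M prob_algebra split_borel" by auto
  then have K': "?K \<in> measure_pmf (bernoulli_pmf \<delta>) \<rightarrow>\<^sub>M subprob_algebra split_borel"
    using measurable_space[OF measurable_prob_algebraD[OF K]] by (simp add: Pi_iff)
  have b: "measure_pmf (bernoulli_pmf \<delta>) \<in> space (prob_algebra (count_space UNIV))"
    by (simp add: space_prob_algebra measure_pmf.prob_space_axioms)
  have sP: "sets (split_measure (P x u)) = sets split_borel"
    using split_measure_in_prob_algebra[OF P_in_prob_algebra[OF u]] by (simp add: space_prob_algebra)
  have "split_measure (P x u) = measure_pmf (bernoulli_pmf \<delta>) \<bind> ?K"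
  proof (rule measure_eqI)
    show "sets (split_measure (P x u)) = sets (measure_pmf (bernoulli_pmf \<delta>) \<bind> ?K)"
      using sets_bind'[OF b K] sP by simp
    fix S assume "S \<in> sets (split_measure (P x u))"
    then have S: "S \<in> sets split_borel" using sP by simp
    have "emeasure (measure_pmf (bernoulli_pmf \<delta>) \<bind> ?K) S =
      emeasure (split_measure \<nu>) S * ennreal \<delta> + emeasure (residual_kernel x u) S * ennreal \<sigma>"
      using \<delta>_pos \<delta>_less_1
      by (subst emeasure_bind_prob_algebra[OF b K S]) (subst nn_integral_bernoulli_pmf, auto simp: \<sigma>_def)
    also have "emeasure (residual_kernel x u) S * ennreal \<sigma> =
      emeasure (split_measure (P x u)) S - ennreal \<delta> * emeasure (split_measure \<nu>) S"
      unfolding emeasure_residual_kernel[OF S] using \<sigma>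
      by (simp add: divide_ennreal_def mult.assoc ennreal_inverse_mult) (simp add: inverse_ennreal ennreal_mult[symmetric] mult.commute)
    also have "emeasure (split_measure \<nu>) S * ennreal \<delta> + \<dots> = emeasure (split_measure (P x u)) S"
      using split_minorization[OF S] by (simp add: mult.commute add_diff_inverse_ennreal)
    finally show "emeasure (split_measure (P x u)) S = emeasure (measure_pmf (bernoulli_pmf \<delta>) \<bind> ?K) S" ..
  qed
  then have "(\<integral>\<^sup>+z. F z \<partial>split_measure (P x u)) = (\<integral>\<^sup>+b. \<integral>\<^sup>+z. F z \<partial>?K b \<partial>bernoulli_pmf \<delta>)"
    by (simp add: nn_integral_bind[OF F K'])
  also have "\<dots> = (\<integral>\<^sup>+z. F z \<partial>split_measure \<nu>) * ennreal \<delta> + (\<integral>\<^sup>+z. F z \<partial>residual_kernel x u) * ennreal \<sigma>"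
    using \<delta>_pos \<delta>_less_1 by (subst nn_integral_bernoulli_pmf) (auto simp: \<sigma>_def)
  finally show ?thesis by (simp add: ac_simps)
qed

end

end

section \<open>The split chain under a stationary control\<close>

context inf_compact_split_mdp
begin

lemma ennreal_divide_1: "a / 1 = (a :: ennreal)"
  by (simp add: divide_ennreal_def)

lemma split_kernel_simps:
  "x \<notin> \<B> \<Longrightarrow> split_kernel (x, 0) u = split_measure (P x u)"
  "split_kernel (x, Suc i) u = split_measure \<nu>"
  by (simp_all add: split_kernel_def)

text \<open>Plays the role of \<open>P_total\<close> for the split kernel. The Dirac mass off the
  graph is never seen by a stationary control, which puts full mass on
  \<open>\<U> x\<close>.\<close>

definition Q_total :: "'x \<times> nat \<Rightarrow> 'u \<Rightarrow> ('x \<times> nat) measure" where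
  "Q_total z u = (if (fst z, u) \<in> graph then split_kernel z u else return split_borel z)"

lemma Q_total_eq[simp]: "u \<in> \<U> (fst z) \<Longrightarrow> Q_total z u = split_kernel z u"
  by (simp add: Q_total_def graph_def)

lemma split_kernel_in_prob_algebra:
  assumes u: "u \<in> \<U> (fst z)"
  shows "split_kernel z u \<in> space (prob_algebra split_borel)"
proof (cases z)
  case (Pair x i)
  show ?thesis
  proof (cases "i = 0 \<and> x \<in> \<B>")
    case True
    with u Pair show ?thesis
      using residual_kernel_in_prob_algebra[of x u] split_kernel_residual[of x u] by simp
  next
    case False
    then show ?thesis
      using u Pair split_measure_in_prob_algebra[OF P_in_prob_algebra, of u x]
        split_measure_in_prob_algebra[OF \<nu>_in_prob_algebra]
      by (auto simp: split_kernel_def)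
  qed
qed

text \<open>It suffices to test on measurable sets \<open>S\<close>: in every case, the residual one
  included, the mass of \<open>S\<close> is an explicit expression in the masses given by the split
  measures of \<open>P_total\<close> and \<open>\<nu>\<close>.\<close>

lemma Q_total_measurable[measurable]:
  "(\<lambda>(z, u). Q_total z u) \<in> split_borel \<Otimes>\<^sub>M borel \<rightarrow>\<^sub>M prob_algebra split_borel"
proof (rule measurable_prob_algebraI)
  have Q: "Q_total z u \<in> space (prob_algebra split_borel)" if "z \<in> split_space" for z u
    using split_kernel_in_prob_algebra[of u z] that measurable_space[OF measurable_return_prob_space, of z split_borel]
    by (auto simp: Q_total_def graph_def space_split_borel)
  then show prob: "prob_space (case zu of (z, u) \<Rightarrow> Q_total z u)" if "zu \<in> space (split_borel \<Otimes>\<^sub>M borel)" for zu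
    using that by (auto simp: space_pair_measure space_split_borel space_prob_algebra)
  show "(\<lambda>(z, u). Q_total z u) \<in> split_borel \<Otimes>\<^sub>M borel \<rightarrow>\<^sub>M subprob_algebra split_borel"
  proof (rule measurable_subprob_algebra)
    show "subprob_space (case zu of (z, u) \<Rightarrow> Q_total z u)" if "zu \<in> space (split_borel \<Otimes>\<^sub>M borel)" for zu
      by (rule prob_space_imp_subprob_space[OF prob[OF that]])
    show "sets (case zu of (z, u) \<Rightarrow> Q_total z u) = sets split_borel" if "zu \<in> space (split_borel \<Otimes>\<^sub>M borel)" for zu
      using that Q by (auto simp: space_pair_measure space_split_borel space_prob_algebra)
    fix S assume S[measurable]: "S \<in> sets split_borel"
    define e where "e zu = emeasure (split_measure (P_total (fst (fst zu), snd zu))) S" for zu :: "('x \<times> nat) \<times> 'u"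
    have [measurable]: "e \<in> borel_measurable (split_borel \<Otimes>\<^sub>M borel)"
    proof -
      have "(\<lambda>zu. split_measure (P_total (fst (fst zu), snd zu))) \<in> split_borel \<Otimes>\<^sub>M borel \<rightarrow>\<^sub>M prob_algebra split_borel"
        by measurable
      from measurable_compose[OF measurable_prob_algebraD[OF this] measurable_emeasure_subprob_algebra[OF S]]
      show ?thesis by (simp add: e_def[abs_def])
    qed
    have "(\<lambda>zu. emeasure (case zu of (z, u) \<Rightarrow> Q_total z u) S) \<in> borel_measurable (split_borel \<Otimes>\<^sub>M borel) \<longleftrightarrow>
      (\<lambda>zu. if (fst (fst zu), snd zu) \<in> graph then if snd (fst zu) = 0
          then if fst (fst zu) \<in> \<B> then (e zu - ennreal \<delta> * emeasure (split_measure \<nu>) S) / ennreal \<sigma> else e zu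
          else emeasure (split_measure \<nu>) S else indicator S (fst zu)) \<in> borel_measurable (split_borel \<Otimes>\<^sub>M borel)"
    proof (intro measurable_cong)
      fix zu :: "('x \<times> nat) \<times> 'u"
      assume "zu \<in> space (split_borel \<Otimes>\<^sub>M borel)"
      obtain x i u where zu: "zu = ((x, i), u)" by (metis surj_pair)
      show "emeasure (case zu of (z, u) \<Rightarrow> Q_total z u) S = (if (fst (fst zu), snd zu) \<in> graph then if snd (fst zu) = 0
          then if fst (fst zu) \<in> \<B> then (e zu - ennreal \<delta> * emeasure (split_measure \<nu>) S) / ennreal \<sigma> else e zu
          else emeasure (split_measure \<nu>) S else indicator S (fst zu))"
        by (cases i) (auto simp: zu Q_total_def graph_def split_kernel_residual emeasure_residual_kernel e_def S
            split_kernel_simps)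
    qed
    also have \<dots> by measurable
    finally show "(\<lambda>zu. emeasure (case zu of (z, u) \<Rightarrow> Q_total z u) S) \<in> borel_measurable (split_borel \<Otimes>\<^sub>M borel)" .
  qed
qed

definition stage_under :: "('x \<Rightarrow> 'u measure) \<Rightarrow> ('x \<Rightarrow> ennreal) \<Rightarrow> 'x \<Rightarrow> ennreal" where
  "stage_under v f x = (\<integral>\<^sup>+u. c_total (x, u) + (\<integral>\<^sup>+y. f y \<partial>P_total (x, u)) \<partial>v x)"

text \<open>The share of mass that splitting leaves on level 0, and hence the factor between
  \<open>V_split\<close> and \<open>V_star\<close>.\<close>

definition weight :: "'x \<Rightarrow> ennreal" where
  "weight x = (if x \<in> \<B> then ennreal \<sigma> else 1)"

definition level_0 :: "('x \<times> nat) set" where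
  "level_0 = {z \<in> split_space. snd z = 0}"

text \<open>Dividing by the share left on level 0 compensates the splitting: the level-0 part of a
  split measure integrates \<open>lift f\<close> exactly as the original measure integrates
  \<open>f\<close>.\<close>

definition lift :: "('x \<Rightarrow> ennreal) \<Rightarrow> 'x \<times> nat \<Rightarrow> ennreal" where
  "lift f z = f (fst z) / weight (fst z)"

text \<open>The amount by which \<open>stage_under\<close> exceeds its analogue for the split chain killed at
  regeneration.\<close>

definition offset :: "('x \<Rightarrow> ennreal) \<Rightarrow> 'x \<Rightarrow> ennreal" where
  "offset f x = (if x \<in> \<B> then ennreal \<delta> * (\<integral>\<^sup>+y. f y \<partial>\<nu>) else \<beta>)"

lemma weight_measurable[measurable]: "weight \<in> borel_measurable borel"
  unfolding weight_def[abs_def] by measurable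

lemma weight_cancel: "weight x * (a / weight x) = a"
  using \<sigma> by (simp add: weight_def ennreal_times_divide mult.commute[of "ennreal \<sigma>"] ennreal_mult_divide_eq ennreal_divide_1)

lemma weight_pos: "weight x \<noteq> 0" and weight_le_1: "weight x \<le> 1"
  using \<sigma> by (auto simp: weight_def)

lemma level_0_measurable[measurable]: "level_0 \<in> sets split_borel"
proof -
  have "{z \<in> space split_borel. snd z = 0} \<in> sets split_borel" by measurable
  then show ?thesis by (simp add: level_0_def space_split_borel)
qed

lemma level_0_iff: "z \<in> split_space \<Longrightarrow> z \<in> level_0 \<longleftrightarrow> z \<notin> \<B> \<times> {1}"
  by (auto simp: level_0_def split_space_def)

lemma in_level_0: "(x, 0) \<in> level_0" "(x, Suc n) \<notin> level_0"
  by (auto simp: level_0_def split_space_def)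

lemma lift_measurable[measurable (raw)]: "f \<in> borel_measurable borel \<Longrightarrow> lift f \<in> borel_measurable split_borel"
  unfolding lift_def[abs_def]
  by (intro borel_measurable_divide_ennreal measurable_compose[OF measurable_fst_split]) simp_all

lemma nn_integral_lift_split_measure:
  assumes \<mu>: "\<mu> \<in> space (prob_algebra borel)" and f[measurable]: "f \<in> borel_measurable borel"
  shows "(\<integral>\<^sup>+z. lift f z * indicator level_0 z \<partial>split_measure \<mu>) = (\<integral>\<^sup>+x. f x \<partial>\<mu>)"
proof -
  have "ennreal \<sigma> * (f x / weight x) = f x" if "x \<in> \<B>" for x
    using weight_cancel[of x "f x"] that by (simp add: weight_def)
  moreover have "f x / weight x = f x" if "x \<notin> \<B>" for x
    using that by (simp add: weight_def ennreal_divide_1)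
  ultimately show ?thesis
    by (subst nn_integral_split_measure[OF \<mu>]) (auto simp: in_level_0 lift_def intro!: nn_integral_cong)
qed

lemma stationary_in_prob_algebra:
  "v \<in> stationary \<Longrightarrow> v x \<in> space (prob_algebra borel)"
  using measurable_space[of v borel "prob_algebra borel" x] by (simp add: stationary_def)

context
  fixes v assumes v: "v \<in> stationary"
begin

lemma v_measurable[measurable]: "v \<in> borel \<rightarrow>\<^sub>M prob_algebra borel"
  using v by (simp add: stationary_def)

lemma sets_v: "sets (v x) = sets borel" and prob_space_v: "prob_space (v x)"
  using stationary_in_prob_algebra[OF v, of x] by (simp_all add: space_prob_algebra)

lemma AE_v: "AE u in v x. u \<in> \<U> x"
  using prob_space.AE_prob_1[OF prob_space_v, of x "\<U> x"] v by (simp add: stationary_def measure_def)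

lemma nn_integral_v_U: "(\<integral>\<^sup>+u\<in>\<U> x. g u \<partial>v x) = (\<integral>\<^sup>+u. g u \<partial>v x)"
  using AE_v[of x] by (intro nn_integral_cong_AE) (auto simp: indicator_def)

lemma emeasure_v_space[simp]: "emeasure (v x) (space (v x)) = 1"
  by (rule prob_space.emeasure_space_1[OF prob_space_v])

lemma nn_integral_v_mono: "(\<And>u. u \<in> \<U> x \<Longrightarrow> f u \<le> g u) \<Longrightarrow> (\<integral>\<^sup>+u. f u \<partial>v x) \<le> (\<integral>\<^sup>+u. g u \<partial>v x)"
  using AE_v[of x] by (intro nn_integral_mono_AE) auto

lemma nn_integral_v_cong: "(\<And>u. u \<in> \<U> x \<Longrightarrow> f u = g u) \<Longrightarrow> (\<integral>\<^sup>+u. f u \<partial>v x) = (\<integral>\<^sup>+u. g u \<partial>v x)"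
  using AE_v[of x] by (intro nn_integral_cong_AE) auto

lemma bellman_le_stage_under: "bellman f x \<le> stage_under v f x"
proof -
  have "bellman f x = (\<integral>\<^sup>+u. bellman f x \<partial>v x)" by simp
  also have "\<dots> \<le> stage_under v f x"
    unfolding stage_under_def by (rule nn_integral_v_mono) (use bellman_le[of _ x f] in \<open>simp add: stage_def\<close>)
  finally show ?thesis .
qed

lemma Q_total_section:
  assumes z: "z \<in> split_space"
  shows "Q_total z \<in> borel \<rightarrow>\<^sub>M prob_algebra split_borel"
  using measurable_compose[OF measurable_Pair1'[of z split_borel borel] Q_total_measurable] z
  by (simp add: space_split_borel)

lemma split_kernel_under_eq:
  assumes z: "z \<in> split_space"
  shows "split_kernel_under v z = v (fst z) \<bind> Q_total z"
proof -
  let ?R = "restrict_space (v (fst z)) (\<U> (fst z))"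
  have Q: "Q_total z \<in> v (fst z) \<rightarrow>\<^sub>M subprob_algebra split_borel"
    using Q_total_section[OF z] by (auto cong: measurable_cong_sets simp: sets_v intro: measurable_prob_algebraD)
  have space_R: "space ?R = \<U> (fst z)"
    by (simp add: space_restrict_space sets_eq_imp_space_eq[OF sets_v])
  have "split_kernel z \<in> ?R \<rightarrow>\<^sub>M subprob_algebra split_borel \<longleftrightarrow> Q_total z \<in> ?R \<rightarrow>\<^sub>M subprob_algebra split_borel"
    by (rule measurable_cong) (simp add: space_R)
  with Q have K: "split_kernel z \<in> ?R \<rightarrow>\<^sub>M subprob_algebra split_borel"
    by (simp add: measurable_restrict_space1)
  have R_ne: "space ?R \<noteq> {}" using U_nonempty by (simp add: space_R)
  have v_ne: "space (v (fst z)) \<noteq> {}" using prob_space.not_empty[OF prob_space_v] .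
  show ?thesis
    unfolding split_kernel_under_def
  proof (rule measure_eqI)
    show sets: "sets (?R \<bind> split_kernel z) = sets (v (fst z) \<bind> Q_total z)"
      by (simp add: sets_bind[OF subprob_measurableD(2)[OF K] R_ne] sets_bind[OF subprob_measurableD(2)[OF Q] v_ne])
    fix S assume "S \<in> sets (?R \<bind> split_kernel z)"
    then have S: "S \<in> sets split_borel"
      by (simp add: sets_bind[OF subprob_measurableD(2)[OF K] R_ne])
    have "emeasure (?R \<bind> split_kernel z) S = (\<integral>\<^sup>+u. emeasure (split_kernel z u) S \<partial>?R)"
      by (rule emeasure_bind[OF R_ne K S])
    also have "\<dots> = (\<integral>\<^sup>+u\<in>\<U> (fst z). emeasure (split_kernel z u) S \<partial>v (fst z))"
      by (rule nn_integral_restrict_space) (simp add: sets_v sets_eq_imp_space_eq[OF sets_v])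
    also have "\<dots> = (\<integral>\<^sup>+u. emeasure (Q_total z u) S \<partial>v (fst z))"
      unfolding nn_integral_v_U by (rule nn_integral_v_cong) simp
    also have "\<dots> = emeasure (v (fst z) \<bind> Q_total z) S"
      by (rule emeasure_bind[OF v_ne Q S, symmetric])
    finally show "emeasure (?R \<bind> split_kernel z) S = emeasure (v (fst z) \<bind> Q_total z) S" .
  qed
qed

lemma split_kernel_under_measurable[measurable]:
  "split_kernel_under v \<in> split_borel \<rightarrow>\<^sub>M prob_algebra split_borel"
proof (subst measurable_cong)
  show "split_kernel_under v z = v (fst z) \<bind> Q_total z" if "z \<in> space split_borel" for z
    using that by (simp add: split_kernel_under_eq space_split_borel)
  show "(\<lambda>z. v (fst z) \<bind> Q_total z) \<in> split_borel \<rightarrow>\<^sub>M prob_algebra split_borel"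
    by measurable
qed

lemma nn_integral_split_kernel_under:
  assumes z: "z \<in> split_space" and F: "F \<in> borel_measurable split_borel"
  shows "(\<integral>\<^sup>+y. F y \<partial>split_kernel_under v z) = (\<integral>\<^sup>+u. \<integral>\<^sup>+y. F y \<partial>split_kernel z u \<partial>v (fst z))"
proof -
  have Q: "Q_total z \<in> v (fst z) \<rightarrow>\<^sub>M subprob_algebra split_borel"
    using Q_total_section[OF z] by (auto cong: measurable_cong_sets simp: sets_v intro: measurable_prob_algebraD)
  show ?thesis
    unfolding split_kernel_under_eq[OF z] nn_integral_bind[OF F Q] by (rule nn_integral_v_cong) simp
qed

abbreviation "killed \<equiv> killed_operator (split_kernel_under v) level_0"

lemma inner_integral_measurable[measurable]:
  assumes [measurable]: "f \<in> borel_measurable borel"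
  shows "(\<lambda>z. \<integral>\<^sup>+y. f y \<partial>P_total z) \<in> borel_measurable (borel \<Otimes>\<^sub>M borel)"
  by (rule nn_integral_measurable_subprob_algebra2[OF _ measurable_prob_algebraD[OF P_total_measurable]]) measurable

text \<open>On \<open>\<B>\<close>, the residual kernel with weight \<open>\<sigma>\<close> and the
  regeneration measure with weight \<open>\<delta>\<close> add up to the split transition law, whose
  level-0 part integrates \<open>lift f\<close> like the original kernel. Killing at regeneration
  thus loses exactly the \<open>\<nu>\<close>-term on \<open>\<B>\<close> and nothing
  elsewhere.\<close>

lemma killed_lift:
  assumes f[measurable]: "f \<in> borel_measurable borel"
  shows "weight x * killed (lift f) (x, 0) + (if x \<in> \<B> then ennreal \<delta> * (\<integral>\<^sup>+y. f y \<partial>\<nu>) else 0) =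
    (\<integral>\<^sup>+u. \<integral>\<^sup>+y. f y \<partial>P_total (x, u) \<partial>v x)"
proof -
  let ?F = "\<lambda>z. lift f z * indicator level_0 z"
  have z: "(x, 0) \<in> split_space" by (simp add: split_space_def)
  have F: "?F \<in> borel_measurable split_borel" by measurable
  have k: "killed (lift f) (x, 0) = (\<integral>\<^sup>+u. \<integral>\<^sup>+y. ?F y \<partial>split_kernel (x, 0) u \<partial>v x)"
    using nn_integral_split_kernel_under[OF z F] by (simp add: killed_operator_def)
  show ?thesis
  proof (cases "x \<in> \<B>")
    case False
    then show ?thesis
      unfolding k by (simp add: weight_def)
        (intro nn_integral_v_cong, simp add: split_kernel_def nn_integral_lift_split_measure P_in_prob_algebra)
  next
    case True
    have meas: "(\<lambda>u. \<integral>\<^sup>+y. ?F y \<partial>Q_total (x, 0) u) \<in> borel_measurable (v x)"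
      using measurable_compose[OF measurable_prob_algebraD[OF Q_total_section[OF z]] nn_integral_measurable_subprob_algebra[OF F]]
      by (simp cong: measurable_cong_sets add: sets_v)
    have "weight x * killed (lift f) (x, 0) + ennreal \<delta> * (\<integral>\<^sup>+y. f y \<partial>\<nu>) =
      (\<integral>\<^sup>+u. ennreal \<sigma> * (\<integral>\<^sup>+y. ?F y \<partial>Q_total (x, 0) u) + ennreal \<delta> * (\<integral>\<^sup>+y. f y \<partial>\<nu>) \<partial>v x)"
    proof -
      have "killed (lift f) (x, 0) = (\<integral>\<^sup>+u. \<integral>\<^sup>+y. ?F y \<partial>Q_total (x, 0) u \<partial>v x)"
        unfolding k by (rule nn_integral_v_cong) simp
      then show ?thesis
        using meas True by (simp add: nn_integral_add nn_integral_cmult weight_def)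
    qed
    also have "\<dots> = (\<integral>\<^sup>+u. \<integral>\<^sup>+y. f y \<partial>P_total (x, u) \<partial>v x)"
    proof (rule nn_integral_v_cong)
      fix u assume u: "u \<in> \<U> x"
      show "ennreal \<sigma> * (\<integral>\<^sup>+y. ?F y \<partial>Q_total (x, 0) u) + ennreal \<delta> * (\<integral>\<^sup>+y. f y \<partial>\<nu>) = (\<integral>\<^sup>+y. f y \<partial>P_total (x, u))"
        using nn_integral_residual_kernel[OF True u F] u
        by (simp add: split_kernel_residual[OF True u] nn_integral_lift_split_measure P_in_prob_algebra \<nu>_in_prob_algebra)
    qed
    finally show ?thesis using True by simp
  qed
qed

definition total_cost_under :: "'x \<Rightarrow> ennreal" where
  "total_cost_under x = (\<integral>\<^sup>+u. c_total (x, u) \<partial>v x)"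

lemma split_cost_under_eq:
  "split_cost_under v (x, 0) = total_cost_under x / weight x"
  "split_cost_under v (x, Suc n) = 0"
proof -
  have [measurable]: "(\<lambda>u. c_total (x, u)) \<in> borel_measurable (v x)"
    by (simp cong: measurable_cong_sets add: sets_v)
  have "split_cost_under v (x, 0) = (\<integral>\<^sup>+u. split_cost (x, 0) u \<partial>v x)"
    using nn_integral_v_U by (simp add: split_cost_under_def)
  also have "\<dots> = (\<integral>\<^sup>+u. c_total (x, u) / weight x \<partial>v x)"
    by (rule nn_integral_v_cong) (simp add: split_cost_def weight_def \<sigma>_def ennreal_divide_1)
  also have "\<dots> = total_cost_under x / weight x"
    unfolding total_cost_under_def by (rule nn_integral_divide) measurable
  finally show "split_cost_under v (x, 0) = total_cost_under x / weight x" .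
qed (simp add: split_cost_under_def split_cost_def)

lemma total_cost_under_measurable[measurable]: "total_cost_under \<in> borel_measurable borel"
  unfolding total_cost_under_def[abs_def]
  by (rule nn_integral_measurable_subprob_algebra2[OF _ measurable_prob_algebraD[OF v_measurable]]) measurable

lemma split_cost_under_measurable[measurable]: "split_cost_under v \<in> borel_measurable split_borel"
proof -
  have "split_cost_under v = (\<lambda>z. if snd z = 0 then total_cost_under (fst z) / weight (fst z) else 0)"
  proof
    fix z :: "'x \<times> nat"
    obtain x i where "z = (x, i)" by force
    then show "split_cost_under v z = (if snd z = 0 then total_cost_under (fst z) / weight (fst z) else 0)"
      by (cases i) (simp_all add: split_cost_under_eq)
  qed
  also have "\<dots> \<in> borel_measurable split_borel" by measurable
  finally show ?thesis .
qed

lemma \<beta>_le_total_cost: "x \<notin> \<B> \<Longrightarrow> \<beta> \<le> total_cost_under x"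
  using nn_integral_v_mono[of x "\<lambda>_. \<beta>" "\<lambda>u. c_total (x, u)"] cost_ge_\<beta>[of x]
  by (simp add: total_cost_under_def)

text \<open>Subtracting \<open>\<beta>\<close> only outside \<open>\<B>\<close> keeps the cost nonnegative.\<close>

definition excess_cost :: "'x \<times> nat \<Rightarrow> ennreal" where
  "excess_cost z = split_cost_under v z - (if fst z \<in> \<B> then 0 else \<beta>)"

lemma excess_cost_measurable[measurable]: "excess_cost \<in> borel_measurable split_borel"
  unfolding excess_cost_def[abs_def] by measurable

text \<open>The dictionary between the killed split chain and the original process. The weight
  cancels the rescaling of cost and value, \<open>killed_lift\<close> treats the transition, and
  \<open>offset\<close> restores the \<open>\<nu>\<close>-term on \<open>\<B>\<close> and the
  subtracted \<open>\<beta>\<close> elsewhere.\<close>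

lemma split_bellman_identity:
  assumes f[measurable]: "f \<in> borel_measurable borel"
  shows "weight x * (excess_cost (x, 0) + killed (lift f) (x, 0)) + offset f x = stage_under v f x"
proof -
  have [measurable]: "(\<lambda>u. c_total (x, u)) \<in> borel_measurable (v x)"
    "(\<lambda>u. \<integral>\<^sup>+y. f y \<partial>P_total (x, u)) \<in> borel_measurable (v x)"
    by (simp_all cong: measurable_cong_sets add: sets_v)
  have stage: "stage_under v f x = total_cost_under x + (\<integral>\<^sup>+u. \<integral>\<^sup>+y. f y \<partial>P_total (x, u) \<partial>v x)"
    unfolding stage_under_def total_cost_under_def by (rule nn_integral_add) measurable
  show ?thesis
  proof (cases "x \<in> \<B>")
    case True
    then have "excess_cost (x, 0) = total_cost_under x / weight x"
      by (simp add: excess_cost_def split_cost_under_eq)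
    then show ?thesis
      unfolding stage killed_lift[OF f, symmetric]
      using True by (simp add: distrib_left weight_cancel offset_def add.assoc)
  next
    case False
    then have "excess_cost (x, 0) + \<beta> = total_cost_under x"
      using \<beta>_le_total_cost[OF False] by (simp add: excess_cost_def split_cost_under_eq weight_def ennreal_divide_1 diff_add_cancel_ennreal)
    then show ?thesis
      unfolding stage killed_lift[OF f, symmetric]
      using False by (simp add: weight_def offset_def ac_simps)
  qed
qed

end

end

section \<open>Total cost until regeneration\<close>

text \<open>Finiteness of the second series excludes a difference of two infinities, both in the
  partial sums and in the limit. The signed path functional in \<open>V_split\<close> becomes a
  difference of nonnegative series this way.\<close>

lemma suminf_enn2ereal_diff:
  fixes e m :: "nat \<Rightarrow> ennreal"
  assumes fin: "(\<Sum>k. m k) < top"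
  shows "(\<Sum>k. enn2ereal (e k) - enn2ereal (m k)) = enn2ereal (\<Sum>k. e k) - enn2ereal (\<Sum>k. m k)"
proof -
  have m_fin: "(\<Sum>k<n. m k) < top" for n
    by (rule le_less_trans[OF sum_le_suminf fin]) auto
  have m_fin1: "m n < top" for n
    using m_fin[of "Suc n"] by (simp add: less_top)
  have nt: "\<bar>enn2ereal a\<bar> \<noteq> \<infinity>" if "a < top" for a
    using that by (cases a rule: ennreal_cases) auto
  have part: "(\<Sum>k<n. enn2ereal (e k) - enn2ereal (m k)) = enn2ereal (\<Sum>k<n. e k) - enn2ereal (\<Sum>k<n. m k)" for n
  proof (induction n)
    case (Suc n)
    obtain a b where a: "(\<Sum>k<n. m k) = ennreal a" "0 \<le> a" and b: "m n = ennreal b" "0 \<le> b"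
      using m_fin[of n] m_fin1[of n] by (metis ennreal_cases less_irrefl)
    have "enn2ereal X - ereal a + (enn2ereal Y - ereal b) = enn2ereal (X + Y) - ereal (a + b)" for X Y
      using a b by (cases X rule: ennreal_cases; cases Y rule: ennreal_cases)
        (simp_all add: plus_ennreal.rep_eq)
    from this[of "\<Sum>k<n. e k" "e n"] show ?case
      using a b by (simp add: Suc plus_ennreal.rep_eq)
  qed (simp add: zero_ennreal.rep_eq)
  have lim: "(\<lambda>n. enn2ereal (\<Sum>k<n. f k)) \<longlonglongrightarrow> enn2ereal (\<Sum>k. f k)" for f :: "nat \<Rightarrow> ennreal"
    using summable_LIMSEQ[of f] by (intro tendsto_enn2erealI) simp
  have "(\<lambda>n. enn2ereal (\<Sum>k<n. e k) - enn2ereal (\<Sum>k<n. m k)) \<longlonglongrightarrow>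
    enn2ereal (\<Sum>k. e k) - enn2ereal (\<Sum>k. m k)"
    using nt[OF fin] by (intro tendsto_diff_ereal_general lim) auto
  then have "(\<lambda>k. enn2ereal (e k) - enn2ereal (m k)) sums (enn2ereal (\<Sum>k. e k) - enn2ereal (\<Sum>k. m k))"
    unfolding sums_def part .
  then show ?thesis by (rule sums_unique[symmetric])
qed

text \<open>The truncated differences \<open>p - q\<close> and \<open>q - p\<close> are the positive
  and negative parts of \<open>f\<close>. Estimating them separately loses the integral of
  \<open>q\<close> once for each, hence the factor 2; only boundedness of the error matters
  later.\<close>

lemma ext_integral_diff:
  assumes AE: "AE \<omega> in M. f \<omega> = enn2ereal (p \<omega>) - enn2ereal (q \<omega>)"
    and [measurable]: "p \<in> borel_measurable M" "q \<in> borel_measurable M"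
    and q: "(\<integral>\<^sup>+\<omega>. q \<omega> \<partial>M) < top"
  shows "ext_integral M f \<le> enn2ereal (\<integral>\<^sup>+\<omega>. p \<omega> \<partial>M)"
    and "enn2ereal (\<integral>\<^sup>+\<omega>. p \<omega> \<partial>M) - 2 * enn2ereal (\<integral>\<^sup>+\<omega>. q \<omega> \<partial>M) \<le> ext_integral M f"
proof -
  have AE_q: "AE \<omega> in M. q \<omega> \<noteq> \<infinity>"
    using q by (intro nn_integral_noteq_infinite) (auto simp: less_top)
  have pos: "e2ennreal (enn2ereal a - enn2ereal b) = a - b" for a b
    by transfer (simp add: sup_max)
  have neg: "e2ennreal (- (enn2ereal a - enn2ereal b)) = b - a" if "b \<noteq> \<infinity>" for a b
    using that pos[of b a]
    by (cases a rule: ennreal_cases; cases b rule: ennreal_cases) (auto simp: e2ennreal_neg)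
  have f_pos: "(\<integral>\<^sup>+\<omega>. e2ennreal (f \<omega>) \<partial>M) = (\<integral>\<^sup>+\<omega>. p \<omega> - q \<omega> \<partial>M)"
    using AE by (intro nn_integral_cong_AE) (auto simp: pos)
  have f_neg: "(\<integral>\<^sup>+\<omega>. e2ennreal (- f \<omega>) \<partial>M) = (\<integral>\<^sup>+\<omega>. q \<omega> - p \<omega> \<partial>M)"
    using AE AE_q by (intro nn_integral_cong_AE) (auto simp: neg)
  have ext: "ext_integral M f = enn2ereal (\<integral>\<^sup>+\<omega>. p \<omega> - q \<omega> \<partial>M) - enn2ereal (\<integral>\<^sup>+\<omega>. q \<omega> - p \<omega> \<partial>M)"
    unfolding ext_integral_def f_pos f_neg ..
  have 1: "(\<integral>\<^sup>+\<omega>. p \<omega> - q \<omega> \<partial>M) \<le> (\<integral>\<^sup>+\<omega>. p \<omega> \<partial>M)"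
    and 2: "(\<integral>\<^sup>+\<omega>. q \<omega> - p \<omega> \<partial>M) \<le> (\<integral>\<^sup>+\<omega>. q \<omega> \<partial>M)"
    by (intro nn_integral_mono diff_le_self_ennreal)+
  have "(\<integral>\<^sup>+\<omega>. p \<omega> \<partial>M) \<le> (\<integral>\<^sup>+\<omega>. (p \<omega> - q \<omega>) + q \<omega> \<partial>M)"
  proof (rule nn_integral_mono)
    show "p \<omega> \<le> p \<omega> - q \<omega> + q \<omega>" for \<omega>
      using add_diff_self_ennreal[of "q \<omega>" "p \<omega>"] by (auto simp: add.commute split: if_splits)
  qed
  then have 3: "(\<integral>\<^sup>+\<omega>. p \<omega> \<partial>M) \<le> (\<integral>\<^sup>+\<omega>. p \<omega> - q \<omega> \<partial>M) + (\<integral>\<^sup>+\<omega>. q \<omega> \<partial>M)"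
    by (simp add: nn_integral_add)
  obtain b where b: "(\<integral>\<^sup>+\<omega>. q \<omega> \<partial>M) = ennreal b" "0 \<le> b"
    using q by (metis ennreal_cases less_irrefl)
  obtain d where d: "(\<integral>\<^sup>+\<omega>. q \<omega> - p \<omega> \<partial>M) = ennreal d" "0 \<le> d" "d \<le> b"
    using 2 b by (cases "\<integral>\<^sup>+\<omega>. q \<omega> - p \<omega> \<partial>M" rule: ennreal_cases) (auto simp: top_unique)
  show "ext_integral M f \<le> enn2ereal (\<integral>\<^sup>+\<omega>. p \<omega> \<partial>M)"
    unfolding ext d(1) using 1 d(2)
    by (cases "\<integral>\<^sup>+\<omega>. p \<omega> - q \<omega> \<partial>M" rule: ennreal_cases; cases "\<integral>\<^sup>+\<omega>. p \<omega> \<partial>M" rule: ennreal_cases)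
      (auto simp: top_unique)
  show "enn2ereal (\<integral>\<^sup>+\<omega>. p \<omega> \<partial>M) - 2 * enn2ereal (\<integral>\<^sup>+\<omega>. q \<omega> \<partial>M) \<le> ext_integral M f"
    unfolding ext d(1) b(1) using 3 d(2,3) b
    by (cases "\<integral>\<^sup>+\<omega>. p \<omega> - q \<omega> \<partial>M" rule: ennreal_cases; cases "\<integral>\<^sup>+\<omega>. p \<omega> \<partial>M" rule: ennreal_cases)
      (auto simp: top_unique numeral_eq_ereal simp flip: ennreal_plus)
qed

context inf_compact_split_mdp
begin

text \<open>Inside the split space, level 0 is the complement of \<open>\<B> \<times> {1}\<close>.
  Time 0 is unconstrained because regeneration is counted from time 1 on.\<close>

lemma less_regeneration_time_iff:
  assumes "\<And>j. \<omega> j \<in> split_space"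
  shows "enat k < regeneration_time \<omega> \<longleftrightarrow> (\<forall>j\<in>{1..k}. \<omega> j \<in> level_0)"
proof -
  have "enat k < regeneration_time \<omega> \<longleftrightarrow> (\<forall>n. n \<ge> 1 \<and> \<omega> n \<in> \<B> \<times> {1} \<longrightarrow> k < n)"
    by (simp add: regeneration_time_def Suc_ile_eq[symmetric] le_INF_iff Suc_le_eq)
  also have "\<dots> \<longleftrightarrow> (\<forall>j\<in>{1..k}. \<omega> j \<in> level_0)"
    unfolding level_0_iff[OF assms] by (metis atLeastAtMost_iff not_less)
  finally show ?thesis .
qed

lemma le_weight_mult_iff: "lift f (y, 0) \<le> b \<longleftrightarrow> f y \<le> weight y * b"
proof -
  have "weight y * lift f (y, 0) = f y" by (simp add: lift_def weight_cancel)
  moreover have "weight y * lift f (y, 0) \<le> weight y * b \<longleftrightarrow> lift f (y, 0) \<le> b"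
    using weight_pos[of y] weight_le_1[of y]
    by (intro ennreal_mult_le_mult_iff) (auto simp: top_unique)
  ultimately show ?thesis by simp
qed

lemma weight_mult_le_iff: "b \<le> lift f (y, 0) \<longleftrightarrow> weight y * b \<le> f y"
proof -
  have "weight y * lift f (y, 0) = f y" by (simp add: lift_def weight_cancel)
  moreover have "weight y * b \<le> weight y * lift f (y, 0) \<longleftrightarrow> b \<le> lift f (y, 0)"
    using weight_pos[of y] weight_le_1[of y]
    by (intro ennreal_mult_le_mult_iff) (auto simp: top_unique)
  ultimately show ?thesis by simp
qed

context
  fixes v assumes v: "v \<in> stationary"
begin

lemma split_law_eq: "split_law v z = path_law split_borel (markov_kernels (return split_borel z) (split_kernel_under v))"
  unfolding split_law_def by (rule arg_cong[where f="path_law split_borel"]) (auto simp: fun_eq_iff markov_kernels_def)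

lemma markov_law_split: "z \<in> split_space \<Longrightarrow> markov_law split_borel (return split_borel z) (split_kernel_under v)"
  using split_kernel_under_measurable[OF v] measurable_space[OF measurable_return_prob_space, of z split_borel]
  by (simp add: markov_law_def space_split_borel)

text \<open>The expected cost of the first \<open>n\<close> steps before regeneration. Recursion on
  the first step makes it comparable with value iteration by induction, and
  \<open>partial_cost_eq_sum\<close> turns it into a sum over times.\<close>

primrec partial_cost :: "('x \<times> nat \<Rightarrow> ennreal) \<Rightarrow> nat \<Rightarrow> 'x \<times> nat \<Rightarrow> ennreal" where
  "partial_cost a 0 = (\<lambda>z. 0)"
| "partial_cost a (Suc n) = (\<lambda>z. a z + killed v (partial_cost a n) z)"

lemma killed_measurable[measurable (raw)]:
  "a \<in> borel_measurable split_borel \<Longrightarrow> killed v a \<in> borel_measurable split_borel"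
  using markov_law.killed_operator_measurable[OF markov_law_split, of "(undefined, 0)" a level_0]
  by (simp add: split_space_def)

lemma killed_power_measurable:
  "a \<in> borel_measurable split_borel \<Longrightarrow> (killed v ^^ k) a \<in> borel_measurable split_borel"
  by (induction k) (simp_all add: killed_measurable)

lemma killed_mono: "(\<And>y. f (y, 0) \<le> g (y, 0)) \<Longrightarrow> killed v f z \<le> killed v g z"
  unfolding killed_operator_def
  by (intro nn_integral_mono) (auto simp: level_0_def indicator_def)

lemma sets_split_kernel_under: "z \<in> split_space \<Longrightarrow> sets (split_kernel_under v z) = sets split_borel"
  using measurable_space[OF split_kernel_under_measurable[OF v], of z]
  by (simp add: space_split_borel space_prob_algebra)

lemma partial_cost_eq_sum:
  assumes a: "a \<in> borel_measurable split_borel"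
  shows "z \<in> split_space \<Longrightarrow> partial_cost a n z = (\<Sum>k<n. (killed v ^^ k) a z)"
proof (induction n arbitrary: z)
  case (Suc n)
  have meas: "(\<lambda>y. (killed v ^^ k) a y * indicator level_0 y) \<in> borel_measurable (split_kernel_under v z)" for k
    using killed_power_measurable[OF a, of k]
    by (simp cong: measurable_cong_sets add: sets_split_kernel_under[OF Suc.prems])
  have "killed v (partial_cost a n) z = (\<integral>\<^sup>+y. partial_cost a n y * indicator level_0 y \<partial>split_kernel_under v z)"
    by (simp only: killed_operator_def)
  also have "\<dots> = (\<integral>\<^sup>+y. (\<Sum>k<n. (killed v ^^ k) a y * indicator level_0 y) \<partial>split_kernel_under v z)"
  proof (rule nn_integral_cong)
    fix y
    have "y \<in> split_space" if "y \<in> level_0" using that by (simp add: level_0_def)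
    then show "partial_cost a n y * indicator level_0 y = (\<Sum>k<n. (killed v ^^ k) a y * indicator level_0 y)"
      by (cases "y \<in> level_0") (simp_all add: Suc.IH)
  qed
  also have "\<dots> = (\<Sum>k<n. \<integral>\<^sup>+y. (killed v ^^ k) a y * indicator level_0 y \<partial>split_kernel_under v z)"
    by (rule nn_integral_sum) (rule meas)
  also have "\<dots> = (\<Sum>k<n. (killed v ^^ Suc k) a z)"
    by (simp add: killed_operator_def)
  finally show ?case
    by (simp add: sum.lessThan_Suc_shift del: sum.lessThan_Suc)
qed simp

text \<open>Nonnegativity allows sum and integral to be exchanged; the term at time \<open>k\<close>
  lives on the event that times 1 to \<open>k\<close> stay on level 0, so its expectation is the
  \<open>k\<close>-th power of the killed operator.\<close>

lemma nn_integral_until_regeneration: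
  assumes a: "a \<in> borel_measurable split_borel" and z: "z \<in> split_space"
  shows "(\<lambda>\<omega>. \<Sum>k. if enat k < regeneration_time \<omega> then a (\<omega> k) else 0) \<in> borel_measurable (split_law v z)"
    and "(\<integral>\<^sup>+\<omega>. (\<Sum>k. if enat k < regeneration_time \<omega> then a (\<omega> k) else 0) \<partial>split_law v z) =
      (SUP n. partial_cost a n z)"
proof -
  interpret markov_law split_borel "return split_borel z" "split_kernel_under v"
    by (rule markov_law_split[OF z])
  have law: "split_law v z = mlaw" by (rule split_law_eq)
  have space: "\<omega> j \<in> split_space" if "\<omega> \<in> space mlaw" for \<omega> j
    using that by (auto simp: space_law space_PiM space_split_borel)
  have comp: "(\<lambda>\<omega>. \<omega> j) \<in> mlaw \<rightarrow>\<^sub>M split_borel" for j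
    by (subst measurable_cong_sets[OF sets_law refl]) simp
  let ?g = "\<lambda>k \<omega>. indicator {\<omega>. \<forall>j\<in>{1..k}. \<omega> j \<in> level_0} \<omega> * a (\<omega> k)"
  have g_eq: "(if enat k < regeneration_time \<omega> then a (\<omega> k) else 0) = ?g k \<omega>" if "\<omega> \<in> space mlaw" for k \<omega>
    using less_regeneration_time_iff[of \<omega> k] space[OF that] by (auto simp: indicator_def)
  have g_meas: "?g k \<in> borel_measurable mlaw" for k
  proof -
    have "?g k = (\<lambda>\<omega>. (\<Prod>j\<in>{1..k}. indicator level_0 (\<omega> j)) * a (\<omega> k))"
      by (auto simp: fun_eq_iff indicator_def prod_zero_iff)
    also have "\<dots> \<in> borel_measurable mlaw"
      by (intro borel_measurable_times_ennreal borel_measurable_prod_ennreal measurable_compose[OF comp])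
        (simp_all add: a)
    finally show ?thesis .
  qed
  have cong: "(\<lambda>\<omega>. \<Sum>k. if enat k < regeneration_time \<omega> then a (\<omega> k) else 0) \<in> borel_measurable mlaw \<longleftrightarrow>
    (\<lambda>\<omega>. \<Sum>k. ?g k \<omega>) \<in> borel_measurable mlaw"
    by (intro measurable_cong suminf_cong) (simp add: g_eq)
  show "(\<lambda>\<omega>. \<Sum>k. if enat k < regeneration_time \<omega> then a (\<omega> k) else 0) \<in> borel_measurable (split_law v z)"
    unfolding law cong by (intro borel_measurable_suminf_order g_meas)
  have "(\<integral>\<^sup>+\<omega>. (\<Sum>k. if enat k < regeneration_time \<omega> then a (\<omega> k) else 0) \<partial>mlaw) = (\<integral>\<^sup>+\<omega>. (\<Sum>k. ?g k \<omega>) \<partial>mlaw)"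
    by (intro nn_integral_cong suminf_cong) (simp add: g_eq)
  also have "\<dots> = (\<Sum>k. \<integral>\<^sup>+\<omega>. ?g k \<omega> \<partial>mlaw)"
    by (rule nn_integral_suminf) (rule g_meas)
  also have "\<dots> = (\<Sum>k. (killed v ^^ k) a z)"
    unfolding nn_integral_law_killed[OF a level_0_measurable]
    using z by (simp add: nn_integral_return space_split_borel killed_power_measurable[OF a])
  also have "\<dots> = (SUP n. partial_cost a n z)"
    by (simp add: suminf_eq_SUP partial_cost_eq_sum[OF a z])
  finally show "(\<integral>\<^sup>+\<omega>. (\<Sum>k. if enat k < regeneration_time \<omega> then a (\<omega> k) else 0) \<partial>split_law v z) =
      (SUP n. partial_cost a n z)"
    unfolding law .
qed

lemma partial_cost_mono: "(\<And>z. a z \<le> b z) \<Longrightarrow> partial_cost a n z \<le> partial_cost b n z"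
  by (induction n arbitrary: z) (auto intro!: add_mono killed_mono)

text \<open>Each visit to \<open>\<B>\<close> is followed by a regeneration with probability \<open>\<delta>\<close>, so that the expected
  number of visits is at most that of a geometric distribution.\<close>

lemma visits_bound:
  "weight x * partial_cost (\<lambda>z. indicator \<B> (fst z)) n (x, 0) \<le> ennreal (\<sigma> / \<delta>)"
proof (induction n arbitrary: x)
  case (Suc n)
  let ?a = "\<lambda>z. indicator \<B> (fst z)" and ?K = "ennreal (\<sigma> / \<delta>)"
  \<comment> \<open>This equation determines \<open>?K\<close>: a visit contributes
    \<open>\<sigma>\<close> after weighting, which must equal the term \<open>\<delta> * ?K\<close>
    lost by killing, so that \<open>killed_lift\<close> reproduces the constant
    \<open>?K\<close>.\<close>
  have \<delta>K: "ennreal \<delta> * ?K = ennreal \<sigma>"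
    using \<delta>_pos \<sigma> by (simp add: ennreal_mult[symmetric])
  have "killed v (partial_cost ?a n) (x, 0) \<le> killed v (lift (\<lambda>_. ?K)) (x, 0)"
    by (intro killed_mono) (simp add: weight_mult_le_iff Suc.IH)
  then have "weight x * partial_cost ?a (Suc n) (x, 0) \<le>
    weight x * indicator \<B> x + weight x * killed v (lift (\<lambda>_. ?K)) (x, 0)"
    by (simp add: distrib_left add_left_mono mult_left_mono)
  also have "\<dots> = weight x * killed v (lift (\<lambda>_. ?K)) (x, 0) + (if x \<in> \<B> then ennreal \<delta> * (\<integral>\<^sup>+y. ?K \<partial>\<nu>) else 0)"
    using prob_space.emeasure_space_1[OF prob_space_\<nu>] by (simp add: weight_def \<delta>K add.commute)
  also have "\<dots> = (\<integral>\<^sup>+u. \<integral>\<^sup>+y. ?K \<partial>P_total (x, u) \<partial>v x)"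
    by (rule killed_lift[OF v]) simp
  also have "\<dots> = (\<integral>\<^sup>+u. ?K \<partial>v x)"
    using prob_space.emeasure_space_1[OF prob_space_P] by (intro nn_integral_v_cong[OF v]) simp
  also have "\<dots> = ?K" using emeasure_v_space[OF v] by simp
  finally show ?case .
qed simp

lemma visits_total_bound: "(SUP n. partial_cost (\<lambda>z. indicator \<B> (fst z)) n (x, 0)) \<le> ennreal (1 / \<delta>)"
proof (rule SUP_least)
  fix n
  have "partial_cost (\<lambda>z. indicator \<B> (fst z)) n (x, 0) \<le> lift (\<lambda>_. ennreal (\<sigma> / \<delta>)) (x, 0)"
    by (simp add: weight_mult_le_iff visits_bound)
  also have "\<dots> \<le> ennreal (\<sigma> / \<delta>) / ennreal \<sigma>"
    using \<sigma> \<delta>_pos by (auto simp: lift_def weight_def divide_ennreal ennreal_divide_1 field_simps intro!: ennreal_leI)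
  also have "\<dots> = ennreal (1 / \<delta>)" using \<sigma> \<delta>_pos by (simp add: divide_ennreal)
  finally show "partial_cost (\<lambda>z. indicator \<B> (fst z)) n (x, 0) \<le> ennreal (1 / \<delta>)" .
qed

definition relative_cost :: "'x \<Rightarrow> ereal" where
  "relative_cost x = ext_integral (split_law v (x, 0)) (\<lambda>\<omega>.
     \<Sum>k. if enat k < regeneration_time \<omega>
          then enn2ereal (split_cost_under v (\<omega> k)) - enn2ereal \<beta> else 0)"

lemma split_cost_minus_\<beta>:
  assumes "z \<in> split_space"
  shows "enn2ereal (split_cost_under v z) - enn2ereal \<beta> =
    enn2ereal (excess_cost v z) - enn2ereal (\<beta> * indicator \<B> (fst z))"
proof (cases "fst z \<in> \<B>")
  case False
  then obtain x where x: "z = (x, 0)" "x \<notin> \<B>"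
    using assms by (auto simp: split_space_def)
  have "excess_cost v z + \<beta> = split_cost_under v z"
    using \<beta>_le_total_cost[OF v x(2)] x
    by (simp add: excess_cost_def[OF v] split_cost_under_eq[OF v] weight_def ennreal_divide_1 diff_add_cancel_ennreal)
  then have "enn2ereal (split_cost_under v z) = enn2ereal (excess_cost v z) + enn2ereal \<beta>"
    by (metis plus_ennreal.rep_eq)
  moreover have "\<bar>enn2ereal \<beta>\<bar> \<noteq> \<infinity>" using \<beta>_finite by (cases \<beta> rule: ennreal_cases) auto
  ultimately show ?thesis using False
    by (cases "enn2ereal \<beta>"; cases "enn2ereal (excess_cost v z)") (auto simp: zero_ennreal.rep_eq)
qed (simp add: excess_cost_def[OF v])

text \<open>Along almost every path the functional is the excess cost minus \<open>\<beta>\<close>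
  times the number of visits to \<open>\<B>\<close> before regeneration. The expected number of
  visits is at most \<open>1 / \<delta>\<close>, which bounds the error uniformly in the control and
  in \<open>x\<close>.\<close>

lemma relative_cost_bounds:
  shows "relative_cost x \<le> enn2ereal (SUP n. partial_cost (excess_cost v) n (x, 0))"
    and "enn2ereal (SUP n. partial_cost (excess_cost v) n (x, 0)) - 2 * enn2ereal (\<beta> * ennreal (1 / \<delta>)) \<le> relative_cost x"
proof -
  have z: "(x, 0) \<in> split_space" by (simp add: split_space_def)
  let ?N = "\<lambda>\<omega>. \<Sum>k. if enat k < regeneration_time \<omega> then indicator \<B> (fst (\<omega> k)) else 0 :: ennreal"
  let ?S = "\<lambda>\<omega>. \<Sum>k. if enat k < regeneration_time \<omega> then excess_cost v (\<omega> k) else 0"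
  let ?f = "\<lambda>\<omega>. \<Sum>k. if enat k < regeneration_time \<omega> then enn2ereal (split_cost_under v (\<omega> k)) - enn2ereal \<beta> else 0"
  have indB: "(\<lambda>z. indicator \<B> (fst z) :: ennreal) \<in> borel_measurable split_borel" by measurable
  note N = nn_integral_until_regeneration[OF indB z]
  note S = nn_integral_until_regeneration[OF excess_cost_measurable[OF v] z]
  have intN: "(\<integral>\<^sup>+\<omega>. \<beta> * ?N \<omega> \<partial>split_law v (x, 0)) \<le> \<beta> * ennreal (1 / \<delta>)"
    using visits_total_bound[of x] by (simp add: nn_integral_cmult[OF N(1)] N(2) mult_left_mono)
  also have fin: "\<dots> < top" using \<beta>_finite by (simp add: ennreal_mult_less_top)
  finally have finN: "(\<integral>\<^sup>+\<omega>. \<beta> * ?N \<omega> \<partial>split_law v (x, 0)) < top" .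
  have AE_N: "AE \<omega> in split_law v (x, 0). \<beta> * ?N \<omega> \<noteq> \<infinity>"
    using finN N(1) by (intro nn_integral_noteq_infinite) (auto simp: less_top)
  have AE: "AE \<omega> in split_law v (x, 0). ?f \<omega> = enn2ereal (?S \<omega>) - enn2ereal (\<beta> * ?N \<omega>)"
    using AE_N
  proof (rule AE_mp, intro AE_I2 impI)
    fix \<omega> assume \<omega>: "\<omega> \<in> space (split_law v (x, 0))" and fin: "\<beta> * ?N \<omega> \<noteq> \<infinity>"
    interpret markov_law split_borel "return split_borel (x, 0)" "split_kernel_under v"
      by (rule markov_law_split[OF z])
    have sp: "\<omega> j \<in> split_space" for j
      using \<omega> by (auto simp: split_law_eq space_law space_PiM space_split_borel)
    have N_eq: "\<beta> * ?N \<omega> = (\<Sum>k. if enat k < regeneration_time \<omega> then \<beta> * indicator \<B> (fst (\<omega> k)) else 0)"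
      by (simp add: ennreal_suminf_cmult[symmetric] if_distrib cong: if_cong)
    have "?f \<omega> = (\<Sum>k. enn2ereal (if enat k < regeneration_time \<omega> then excess_cost v (\<omega> k) else 0) -
      enn2ereal (if enat k < regeneration_time \<omega> then \<beta> * indicator \<B> (fst (\<omega> k)) else 0))"
      by (rule suminf_cong) (simp add: split_cost_minus_\<beta>[OF sp] zero_ennreal.rep_eq)
    also have "\<dots> = enn2ereal (?S \<omega>) - enn2ereal (\<beta> * ?N \<omega>)"
      unfolding N_eq by (rule suminf_enn2ereal_diff) (use fin N_eq in \<open>simp add: less_top\<close>)
    finally show "?f \<omega> = enn2ereal (?S \<omega>) - enn2ereal (\<beta> * ?N \<omega>)" .
  qed
  note bounds = ext_integral_diff[OF AE S(1) borel_measurable_times_ennreal[OF borel_measurable_const N(1)] finN]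
  show "relative_cost x \<le> enn2ereal (SUP n. partial_cost (excess_cost v) n (x, 0))"
    using bounds(1) unfolding relative_cost_def S(2) .
  have "2 * enn2ereal (\<integral>\<^sup>+\<omega>. \<beta> * ?N \<omega> \<partial>split_law v (x, 0)) \<le> 2 * enn2ereal (\<beta> * ennreal (1 / \<delta>))"
    using intN by (intro ereal_mult_left_mono) (simp_all add: less_eq_ennreal.rep_eq)
  then have "enn2ereal (SUP n. partial_cost (excess_cost v) n (x, 0)) - 2 * enn2ereal (\<beta> * ennreal (1 / \<delta>)) \<le>
    enn2ereal (SUP n. partial_cost (excess_cost v) n (x, 0)) - 2 * enn2ereal (\<integral>\<^sup>+\<omega>. \<beta> * ?N \<omega> \<partial>split_law v (x, 0))"
    by (intro ereal_minus_mono) simp_all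
  also have "\<dots> \<le> relative_cost x"
    using bounds(2) unfolding relative_cost_def S(2) .
  finally show "enn2ereal (SUP n. partial_cost (excess_cost v) n (x, 0)) - 2 * enn2ereal (\<beta> * ennreal (1 / \<delta>)) \<le> relative_cost x" .
qed

end

end

section \<open>The value function of the split chain\<close>

lemma ennreal_minus_leI: "c < top \<Longrightarrow> a \<le> b + c \<Longrightarrow> a - c \<le> (b :: ennreal)"
  by (auto simp: ennreal_minus_le_iff add.commute)

locale stable_split_mdp = inf_compact_split_mdp \<U> P c \<B> \<nu> \<delta>
  for \<U> :: "'x::polish_space \<Rightarrow> 'u::polish_space set" and P c \<B> \<nu> \<delta> +
  assumes stable: "\<exists>v\<in>stationary. c_stable v"
begin

text \<open>Value iteration for the excess cost of the killed split chain, transported to the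
  original space by \<open>weight\<close>. Subtraction in \<open>ennreal\<close> is truncated, but
  \<open>offset_le_stage\<close> shows that nothing is cut off here.\<close>

primrec Psi :: "nat \<Rightarrow> 'x \<Rightarrow> ennreal" where
  "Psi 0 = (\<lambda>x. 0)"
| "Psi (Suc n) = (\<lambda>x. bellman (Psi n) x - offset (Psi n) x)"

definition Psi_sup :: "'x \<Rightarrow> ennreal" where
  "Psi_sup x = (SUP n. Psi n x)"

lemma offset_measurable[measurable]: "offset f \<in> borel_measurable borel"
  unfolding offset_def[abs_def] by measurable

lemma Psi_measurable[measurable]: "Psi n \<in> borel_measurable borel"
proof (induction n)
  case (Suc n)
  then have [measurable]: "bellman (Psi n) \<in> borel_measurable borel" by (rule bellman_on_measurable) simp
  show ?case by simp measurable
qed simp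

lemma Psi_sup_measurable[measurable]: "Psi_sup \<in> borel_measurable borel"
  unfolding Psi_sup_def[abs_def] by measurable

text \<open>Using the given control instead of minimizing can only increase the value, and a finite
  offset can be cancelled. Finiteness is a hypothesis because at first it is obtained only along the
  induction for a \<open>c\<close>-stable control.\<close>

lemma Psi_Suc_le_partial_cost:
  assumes v: "v \<in> stationary" and fin: "offset (Psi n) x < top"
    and le: "\<And>y. Psi n y \<le> weight y * partial_cost v (excess_cost v) n (y, 0)"
  shows "Psi (Suc n) x \<le> weight x * partial_cost v (excess_cost v) (Suc n) (x, 0)"
proof -
  have "bellman (Psi n) x \<le> stage_under v (Psi n) x"
    by (rule bellman_le_stage_under[OF v])
  also have "\<dots> = weight x * (excess_cost v (x, 0) + killed v (lift (Psi n)) (x, 0)) + offset (Psi n) x"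
    by (rule split_bellman_identity[OF v Psi_measurable, symmetric])
  finally have "Psi (Suc n) x \<le> weight x * (excess_cost v (x, 0) + killed v (lift (Psi n)) (x, 0))"
    using fin by (simp add: ennreal_minus_leI)
  also have "\<dots> \<le> weight x * partial_cost v (excess_cost v) (Suc n) (x, 0)"
    unfolding partial_cost.simps[OF v]
    by (intro mult_left_mono add_left_mono killed_mono[OF v]) (simp_all add: le_weight_mult_iff le)
  finally show ?thesis .
qed

lemma offset_finite:
  assumes "\<And>y. y \<in> \<B> \<Longrightarrow> f y \<le> ennreal C"
  shows "offset f x < top"
proof -
  have "(\<integral>\<^sup>+y. f y \<partial>\<nu>) \<le> (\<integral>\<^sup>+y. ennreal C \<partial>\<nu>)"
    using AE_\<nu>_B assms by (intro nn_integral_mono_AE) auto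
  also have "\<dots> = ennreal C" using prob_space.emeasure_space_1[OF prob_space_\<nu>] by simp
  also have "\<dots> < top" by simp
  finally show ?thesis using \<beta>_finite by (simp add: offset_def ennreal_mult_less_top)
qed

lemma bounded_B: "bounded \<B>"
  using A0 by (simp add: assumption_A0_def)

text \<open>A \<open>c\<close>-stable control has cost before regeneration bounded on bounded sets,
  and its cost dominates every iterate, since dropping \<open>\<beta>\<close> and the weight only
  increases it.\<close>

lemma Psi_bounded_on:
  assumes "bounded S"
  obtains C where "\<And>n x. x \<in> S \<Longrightarrow> Psi n x \<le> ennreal C"
proof -
  obtain v where v: "v \<in> stationary" "c_stable v" using stable by blast
  let ?T = "\<lambda>x. \<integral>\<^sup>+\<omega>. (\<Sum>k. if enat k < regeneration_time \<omega> then split_cost_under v (\<omega> k) else 0) \<partial>split_law v (x, 0)"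
  have le: "weight x * partial_cost v (excess_cost v) n (x, 0) \<le> ?T x" for n x
  proof -
    have "weight x * partial_cost v (excess_cost v) n (x, 0) \<le> 1 * partial_cost v (split_cost_under v) n (x, 0)"
      by (intro mult_mono weight_le_1 partial_cost_mono[OF v(1)]) (simp_all add: excess_cost_def[OF v(1)])
    also have "\<dots> \<le> (SUP n. partial_cost v (split_cost_under v) n (x, 0))"
      by (auto intro: SUP_upper)
    also have "\<dots> = ?T x"
      by (rule nn_integral_until_regeneration(2)[OF v(1) split_cost_under_measurable[OF v(1)], symmetric])
        (simp add: split_space_def)
    finally show ?thesis .
  qed
  have ex: "\<exists>C. \<forall>x\<in>S. ?T x \<le> ennreal C" if "bounded S" for S
    using v(2) that by (auto simp: c_stable_def)
  obtain C\<^sub>B where C\<^sub>B: "\<And>x. x \<in> \<B> \<Longrightarrow> ?T x \<le> ennreal C\<^sub>B" using ex[OF bounded_B] by blast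
  \<comment> \<open>The bound on \<open>\<B>\<close> must be available at each step, since it makes
    the offset finite and the next comparison possible.\<close>
  have Psi_le: "Psi n x \<le> weight x * partial_cost v (excess_cost v) n (x, 0)" for n x
  proof (induction n arbitrary: x)
    case (Suc n)
    have "Psi n y \<le> ennreal C\<^sub>B" if "y \<in> \<B>" for y
      using order_trans[OF Suc.IH order_trans[OF le C\<^sub>B[OF that]]] .
    then show ?case by (intro Psi_Suc_le_partial_cost[OF v(1)] offset_finite Suc.IH)
  qed simp
  obtain C where "\<And>x. x \<in> S \<Longrightarrow> ?T x \<le> ennreal C" using ex[OF assms] by blast
  then have "Psi n x \<le> ennreal C" if "x \<in> S" for n x
    using order_trans[OF Psi_le order_trans[OF le]] that by blast
  then show ?thesis by (rule that)
qed

lemma Psi_sup_finite: "Psi_sup x < top"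
proof -
  obtain C where "\<And>n. Psi n x \<le> ennreal C" using Psi_bounded_on[of "{x}"] by auto
  then have "Psi_sup x \<le> ennreal C" unfolding Psi_sup_def by (intro SUP_least)
  then show ?thesis by (rule le_less_trans) simp
qed

lemma Psi_sup_offset_finite: "offset Psi_sup x < top"
proof -
  obtain C where "\<And>n x. x \<in> \<B> \<Longrightarrow> Psi n x \<le> ennreal C"
    by (rule Psi_bounded_on[OF bounded_B]) blast
  then show ?thesis by (intro offset_finite[of _ C]) (simp add: Psi_sup_def SUP_least)
qed

lemma Psi_le_sup: "Psi n x \<le> Psi_sup x"
  unfolding Psi_sup_def by (rule SUP_upper) simp

lemma offset_mono: "(\<And>y. f y \<le> g y) \<Longrightarrow> offset f x \<le> offset g x"
  by (auto simp: offset_def intro!: mult_left_mono nn_integral_mono)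

lemma Psi_offset_finite: "offset (Psi n) x < top"
  by (rule le_less_trans[OF offset_mono[OF Psi_le_sup] Psi_sup_offset_finite])

lemma Psi_le_partial_cost:
  assumes v: "v \<in> stationary"
  shows "Psi n x \<le> weight x * partial_cost v (excess_cost v) n (x, 0)"
  by (induction n arbitrary: x)
    (simp_all add: Psi_Suc_le_partial_cost[OF v Psi_offset_finite] del: Psi.simps(2) partial_cost.simps(2))

lemma nn_integral_minorization:
  assumes x: "x \<in> \<B>" "u \<in> \<U> x" and f: "f \<in> borel_measurable borel"
  shows "ennreal \<delta> * (\<integral>\<^sup>+y. f y \<partial>\<nu>) \<le> (\<integral>\<^sup>+y. f y \<partial>P x u)"
proof -
  have "scale_measure (ennreal \<delta>) \<nu> \<le> P x u"
    using minorization[OF x] by (subst le_measure) (simp_all add: sets_\<nu> sets_P[OF x(2)])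
  then have "(\<integral>\<^sup>+y. f y \<partial>scale_measure (ennreal \<delta>) \<nu>) \<le> (\<integral>\<^sup>+y. f y \<partial>P x u)"
    by (intro nn_integral_mono_measure) (simp_all add: sets_\<nu> sets_P[OF x(2)])
  then show ?thesis
    using f by (simp add: nn_integral_scale_measure cong: measurable_cong_sets add: sets_\<nu>)
qed

text \<open>On \<open>\<B>\<close> this is the minorization, outside \<open>\<B>\<close> the lower
  bound \<open>\<beta>\<close> of the cost.\<close>

lemma offset_le_stage:
  assumes f: "f \<in> borel_measurable borel" and u: "u \<in> \<U> x"
  shows "offset f x \<le> stage f x u"
  using nn_integral_minorization[OF _ u f] cost_ge_\<beta>[OF _ u]
  by (auto simp: offset_def stage_def intro: add_increasing add_increasing2)

lemma Psi_Suc_offset: "Psi (Suc n) x + offset (Psi n) x = bellman (Psi n) x"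
proof -
  have "offset (Psi n) x \<le> bellman (Psi n) x"
    unfolding bellman_on_def by (intro INF_greatest offset_le_stage) auto
  then show ?thesis by (simp add: diff_add_cancel_ennreal)
qed

text \<open>The minorization applied to the increment \<open>g - f\<close> shows that the offset
  grows no faster than the stage cost. The additive form states monotonicity of their difference
  without subtracting possibly infinite values.\<close>

lemma stage_offset_mono:
  assumes [measurable]: "f \<in> borel_measurable borel" "g \<in> borel_measurable borel"
    and le: "\<And>y. f y \<le> g y" and u: "u \<in> \<U> x"
  shows "stage f x u + offset g x \<le> stage g x u + offset f x"
proof (cases "x \<in> \<B>")
  case True
  define d where "d y = g y - f y" for y
  have [measurable]: "d \<in> borel_measurable borel" unfolding d_def[abs_def] by measurable
  have g: "g y = f y + d y" for y using le by (simp add: d_def add_diff_inverse_ennreal)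
  have split: "(\<integral>\<^sup>+y. g y \<partial>M) = (\<integral>\<^sup>+y. f y \<partial>M) + (\<integral>\<^sup>+y. d y \<partial>M)" if "sets M = sets borel" for M
    unfolding g by (rule nn_integral_add) (simp_all cong: measurable_cong_sets add: that)
  have "stage f x u + offset g x = stage f x u + offset f x + ennreal \<delta> * (\<integral>\<^sup>+y. d y \<partial>\<nu>)"
    using True by (simp add: offset_def split[OF sets_\<nu>] distrib_left add.assoc)
  also have "\<dots> \<le> stage f x u + offset f x + (\<integral>\<^sup>+y. d y \<partial>P x u)"
    by (intro add_left_mono nn_integral_minorization[OF True u]) simp
  also have "\<dots> = stage g x u + offset f x"
    by (simp add: stage_def split[OF sets_P[OF u]] ac_simps)
  finally show ?thesis .
next
  case False
  with stage_mono[OF le, where x=x and u=u] show ?thesis by (simp add: offset_def add_right_mono)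
qed

lemma bellman_offset_mono:
  assumes f: "f \<in> borel_measurable borel" and g: "g \<in> borel_measurable borel"
    and le: "\<And>y. f y \<le> g y" and fin: "bellman g x < top" "offset f x < top"
  shows "bellman f x + offset g x \<le> bellman g x + offset f x"
proof -
  have "bellman f x + offset g x - offset f x \<le> bellman g x"
    unfolding bellman_on_def[of UNIV g]
  proof (rule INF_greatest)
    fix u assume "u \<in> \<U> x \<inter> UNIV"
    then have u: "u \<in> \<U> x" by simp
    have "bellman f x + offset g x \<le> stage f x u + offset g x"
      by (intro add_right_mono bellman_le[OF u])
    also have "\<dots> \<le> stage g x u + offset f x"
      by (rule stage_offset_mono[OF f g le u])
    finally show "bellman f x + offset g x - offset f x \<le> stage g x u"
      by (rule ennreal_minus_leI[OF fin(2)])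
  qed
  then show ?thesis using fin by (auto simp: ennreal_minus_le_iff add.commute)
qed

lemma bellman_Psi_finite: "bellman (Psi n) x < top"
  using Psi_Suc_offset[of n x] Psi_offset_finite[of n x] le_less_trans[OF Psi_le_sup Psi_sup_finite, of "Suc n" x]
  by (metis ennreal_add_less_top)

lemma Psi_incseq: "incseq Psi"
proof (rule incseq_SucI, rule le_funI)
  show "Psi n x \<le> Psi (Suc n) x" for n x
  proof (induction n arbitrary: x)
    case (Suc n)
    let ?o = "offset (Psi n) x" and ?o' = "offset (Psi (Suc n)) x"
    have "bellman (Psi n) x + ?o' \<le> bellman (Psi (Suc n)) x + ?o"
      by (rule bellman_offset_mono[OF Psi_measurable Psi_measurable Suc.IH bellman_Psi_finite Psi_offset_finite])
    then have "(?o + ?o') + Psi (Suc n) x \<le> (?o + ?o') + Psi (Suc (Suc n)) x"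
      unfolding Psi_Suc_offset[symmetric] by (simp only: ac_simps)
    then show ?case
      using Psi_offset_finite[of n x] Psi_offset_finite[of "Suc n" x]
      by (simp add: ennreal_add_left_cancel_le less_top[symmetric] del: Psi.simps)
  qed simp
qed

text \<open>Each term of \<open>Psi_Suc_offset\<close> passes to its increasing limit: the offset by
  monotone convergence, the minimum by \<open>bellman_SUP\<close>.\<close>

lemma Psi_sup_eq: "Psi_sup x + offset Psi_sup x = bellman Psi_sup x"
proof -
  have inc: "incseq (\<lambda>n. Psi n x)" for x
    using Psi_incseq by (simp add: incseq_def le_fun_def)
  have inc_off: "incseq (\<lambda>n. offset (Psi n) x)"
    using Psi_incseq by (intro incseq_SucI offset_mono) (simp add: incseq_Suc_iff le_fun_def)
  have off: "(SUP n. offset (Psi n) x) = offset Psi_sup x"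
  proof (cases "x \<in> \<B>")
    case True
    have "(\<integral>\<^sup>+y. Psi_sup y \<partial>\<nu>) = (SUP n. \<integral>\<^sup>+y. Psi n y \<partial>\<nu>)"
      unfolding Psi_sup_def using Psi_incseq
      by (intro nn_integral_monotone_convergence_SUP) (simp_all cong: measurable_cong_sets add: sets_\<nu>)
    with True show ?thesis by (simp add: offset_def SUP_mult_left_ennreal)
  qed (simp add: offset_def)
  have "bellman Psi_sup x = (SUP n. bellman (Psi n) x)"
    using bellman_SUP[OF Psi_measurable Psi_incseq, of x] by (simp add: Psi_sup_def[abs_def])
  also have "\<dots> = (SUP n. Psi (Suc n) x + offset (Psi n) x)"
    by (simp only: Psi_Suc_offset)
  also have "\<dots> = (SUP n. Psi (Suc n) x) + (SUP n. offset (Psi n) x)"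
  proof (rule ennreal_SUP_add[OF _ inc_off])
    show "incseq (\<lambda>n. Psi (Suc n) x)" using inc[of x] by (simp add: incseq_Suc_iff del: Psi.simps)
  qed
  also have "(SUP n. Psi (Suc n) x) = Psi_sup x"
    unfolding Psi_sup_def
  proof (rule antisym)
    show "(SUP n. Psi n x) \<le> (SUP n. Psi (Suc n) x)"
      using inc[of x] by (intro SUP_mono) (auto simp only: incseq_Suc_iff)
  qed (rule SUP_mono, blast)
  finally show ?thesis unfolding off ..
qed

lemma bellman_Psi_sup_finite: "bellman Psi_sup x < top"
  unfolding Psi_sup_eq[symmetric] using Psi_sup_finite Psi_sup_offset_finite by simp

lemma of_selector_stationary:
  assumes f: "f \<in> borel \<rightarrow>\<^sub>M borel" "\<And>x. f x \<in> \<U> x"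
  shows "of_selector f \<in> stationary"
  unfolding stationary_def of_selector_def
  using f measurable_compose[OF f(1) measurable_return_prob_space] by simp

lemma stage_under_of_selector:
  assumes f: "f \<in> borel \<rightarrow>\<^sub>M borel" "\<And>x. f x \<in> \<U> x" and [measurable]: "g \<in> borel_measurable borel"
  shows "stage_under (of_selector f) g x = stage g x (f x)"
proof -
  note [measurable] = inner_integral_measurable[OF of_selector_stationary[OF f]]
  show ?thesis
    unfolding stage_under_def of_selector_def
    by (subst nn_integral_return) (simp_all add: stage_def f(2))
qed

text \<open>A measurable selector of the minimizers in \<open>Psi_sup_eq\<close> does it. As costs
  and \<open>Psi_sup\<close> are nonnegative, dropping the terminal value only helps, so induction
  on the horizon works without a transversality condition.\<close>

lemma Psi_sup_upper:
  obtains v where "v \<in> stationary" "\<And>n x. weight x * partial_cost v (excess_cost v) n (x, 0) \<le> Psi_sup x"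
proof -
  obtain f where f: "f \<in> borel \<rightarrow>\<^sub>M borel" "\<And>x. f x \<in> \<U> x" "\<And>x. stage Psi_sup x (f x) = bellman Psi_sup x"
    using bellman_selector[OF Psi_sup_measurable bellman_Psi_sup_finite] by blast
  let ?v = "of_selector f"
  have v: "?v \<in> stationary" using f by (intro of_selector_stationary)
  have "weight x * partial_cost ?v (excess_cost ?v) n (x, 0) \<le> Psi_sup x" for n x
  proof (induction n arbitrary: x)
    case (Suc n)
    have "weight x * partial_cost ?v (excess_cost ?v) (Suc n) (x, 0) \<le>
      weight x * (excess_cost ?v (x, 0) + killed ?v (lift Psi_sup) (x, 0))"
      unfolding partial_cost.simps[OF v]
      by (intro mult_left_mono add_left_mono killed_mono[OF v]) (simp_all add: weight_mult_le_iff Suc.IH)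
    then have "weight x * partial_cost ?v (excess_cost ?v) (Suc n) (x, 0) + offset Psi_sup x \<le> stage_under ?v Psi_sup x"
      unfolding split_bellman_identity[OF v Psi_sup_measurable, symmetric] by (rule add_right_mono)
    also have "\<dots> = Psi_sup x + offset Psi_sup x"
      using f by (simp add: stage_under_of_selector Psi_sup_eq)
    finally show ?case
      using Psi_sup_offset_finite[of x] by (simp add: add.commute[of _ "offset Psi_sup x"] ennreal_add_left_cancel_le less_top[symmetric])
  qed (simp add: v)
  with v show ?thesis by (rule that)
qed

lemma V_split_eq: "V_split x = (INF v\<in>stationary. relative_cost v x)"
  unfolding V_split_def by (rule INF_cong) (simp_all add: relative_cost_def)

lemma V_split_le: "V_split x \<le> enn2ereal (lift Psi_sup (x, 0))"
proof -
  obtain v where v: "v \<in> stationary" "\<And>n x. weight x * partial_cost v (excess_cost v) n (x, 0) \<le> Psi_sup x"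
    using Psi_sup_upper by blast
  have "V_split x \<le> relative_cost v x" unfolding V_split_eq by (rule INF_lower[OF v(1)])
  also have "\<dots> \<le> enn2ereal (SUP n. partial_cost v (excess_cost v) n (x, 0))"
    by (rule relative_cost_bounds(1)[OF v(1)])
  also have "\<dots> \<le> enn2ereal (lift Psi_sup (x, 0))"
    unfolding less_eq_ennreal.rep_eq[symmetric]
    by (intro SUP_least) (simp add: weight_mult_le_iff v(2))
  finally show ?thesis .
qed

text \<open>Every iterate \<open>Psi n\<close> stays below the cost of any control up to horizon
  \<open>n\<close>; the error term is the one of \<open>relative_cost_bounds\<close>.\<close>

lemma V_split_ge: "enn2ereal (lift Psi_sup (x, 0)) - 2 * enn2ereal (\<beta> * ennreal (1 / \<delta>)) \<le> V_split x"
  unfolding V_split_eq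
proof (rule INF_greatest)
  fix v assume v: "v \<in> stationary"
  have "lift Psi_sup (x, 0) \<le> (SUP n. partial_cost v (excess_cost v) n (x, 0))"
    unfolding le_weight_mult_iff unfolding Psi_sup_def
    by (intro SUP_least order_trans[OF Psi_le_partial_cost[OF v]] mult_left_mono SUP_upper) simp_all
  then have "enn2ereal (lift Psi_sup (x, 0)) - 2 * enn2ereal (\<beta> * ennreal (1 / \<delta>)) \<le>
    enn2ereal (SUP n. partial_cost v (excess_cost v) n (x, 0)) - 2 * enn2ereal (\<beta> * ennreal (1 / \<delta>))"
    by (intro ereal_minus_mono) (simp_all add: less_eq_ennreal.rep_eq)
  also have "\<dots> \<le> relative_cost v x" by (rule relative_cost_bounds(2)[OF v])
  finally show "enn2ereal (lift Psi_sup (x, 0)) - 2 * enn2ereal (\<beta> * ennreal (1 / \<delta>)) \<le> relative_cost v x" .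
qed

section \<open>The real function \<open>\<psi>\<close>, its distance from \<open>V_star\<close> and
  its approximate optimality equation\<close>

definition \<psi> :: "'x \<Rightarrow> real" where
  "\<psi> x = enn2real (Psi_sup x)"

lemma \<psi>_measurable[measurable]: "\<psi> \<in> borel_measurable borel"
  unfolding \<psi>_def[abs_def] by measurable

lemma \<psi>_nonneg: "0 \<le> \<psi> x"
  by (simp add: \<psi>_def)

lemma ennreal_\<psi>: "ennreal (\<psi> x) = Psi_sup x"
  unfolding \<psi>_def using Psi_sup_finite by simp

text \<open>\<open>V_split\<close> lies between two real numbers, so its conversion to a real is
  faithful. Multiplying by the weight undoes \<open>lift\<close> and, the weight being at most 1,
  does not enlarge the error.\<close>

lemma V_star_bounds:
  "V_star x \<le> \<psi> x" "\<psi> x - 2 * enn2real \<beta> / \<delta> \<le> V_star x"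
proof -
  define w where "w = (if x \<in> \<B> then \<sigma> else 1)"
  have w: "0 < w" "w \<le> 1" using \<sigma> by (auto simp: w_def)
  have "lift Psi_sup (x, 0) = ennreal (\<psi> x / w)"
    using \<sigma> \<psi>_nonneg by (simp add: lift_def weight_def w_def ennreal_\<psi>[symmetric] divide_ennreal ennreal_divide_1)
  moreover have "2 * enn2ereal (\<beta> * ennreal (1 / \<delta>)) = ereal (2 * enn2real \<beta> / \<delta>)"
  proof -
    obtain b where b: "\<beta> = ennreal b" "0 \<le> b" using \<beta>_finite by (metis ennreal_cases less_irrefl)
    then show ?thesis using \<delta>_pos by (simp add: ennreal_mult[symmetric] numeral_eq_ereal)
  qed
  ultimately have "V_split x \<le> ereal (\<psi> x / w)" "ereal (\<psi> x / w - 2 * enn2real \<beta> / \<delta>) \<le> V_split x"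
    using V_split_le[of x] V_split_ge[of x] \<psi>_nonneg[of x] w by simp_all
  then obtain r where r: "V_split x = ereal r" "r \<le> \<psi> x / w" "\<psi> x / w - 2 * enn2real \<beta> / \<delta> \<le> r"
    by (cases "V_split x") auto
  have V: "V_star x = w * r" by (simp add: V_star_def r w_def \<sigma>_def)
  show "V_star x \<le> \<psi> x" unfolding V using r(2) w by (simp add: field_simps)
  have "w * (\<psi> x / w - 2 * enn2real \<beta> / \<delta>) \<le> w * r" using r(3) w by (intro mult_left_mono) auto
  moreover have "w * (2 * enn2real \<beta> / \<delta>) \<le> 2 * enn2real \<beta> / \<delta>"
    using w \<delta>_pos by (intro mult_left_le_one_le) auto
  ultimately show "\<psi> x - 2 * enn2real \<beta> / \<delta> \<le> V_star x"
    unfolding V using w by (simp add: right_diff_distrib)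
qed

lemma \<psi>_le_stage:
  assumes u: "u \<in> \<U> x"
  shows "ennreal (\<psi> x) \<le> c x u + (\<integral>\<^sup>+y. ennreal (\<psi> y) \<partial>P x u)"
proof -
  have "ennreal (\<psi> x) \<le> Psi_sup x + offset Psi_sup x" by (simp add: ennreal_\<psi>)
  also have "\<dots> \<le> stage Psi_sup x u" unfolding Psi_sup_eq by (rule bellman_le[OF u])
  finally show ?thesis by (simp add: stage_def ennreal_\<psi>)
qed

text \<open>The defect in the equation for \<open>Psi_sup\<close> is its offset, which takes only
  the value \<open>\<beta>\<close> or the finite \<open>\<nu>\<close>-term; \<open>D\<close> is
  their sum.\<close>

lemma \<psi>_almost_attained:
  obtains D where "0 \<le> D"
    "\<And>x. \<exists>u\<in>\<U> x. c x u + (\<integral>\<^sup>+y. ennreal (\<psi> y) \<partial>P x u) \<le> ennreal (\<psi> x + D)"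
proof -
  obtain f where "f \<in> borel \<rightarrow>\<^sub>M borel" and f: "\<And>x. f x \<in> \<U> x" "\<And>x. stage Psi_sup x (f x) = bellman Psi_sup x"
    using bellman_selector[OF Psi_sup_measurable bellman_Psi_sup_finite] by blast
  define D where "D = enn2real (\<beta> + ennreal \<delta> * (\<integral>\<^sup>+y. Psi_sup y \<partial>\<nu>))"
  have D: "0 \<le> D" by (simp add: D_def)
  have "\<B> \<noteq> {}" using \<nu>_B by auto
  then have "ennreal \<delta> * (\<integral>\<^sup>+y. Psi_sup y \<partial>\<nu>) < top"
    using Psi_sup_offset_finite by (metis offset_def ex_in_conv)
  then have "ennreal D = \<beta> + ennreal \<delta> * (\<integral>\<^sup>+y. Psi_sup y \<partial>\<nu>)"
    unfolding D_def using \<beta>_finite by (intro ennreal_enn2real) simp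
  then have "offset Psi_sup x \<le> ennreal D" for x by (simp add: offset_def)
  then have "c x (f x) + (\<integral>\<^sup>+y. ennreal (\<psi> y) \<partial>P x (f x)) \<le> ennreal (\<psi> x + D)" for x
    using f(2)[of x] Psi_sup_eq[of x, symmetric] \<psi>_nonneg[of x]
    by (simp add: stage_def ennreal_\<psi> add_left_mono D)
  with f(1) D show ?thesis by (intro that[of D]) auto
qed

end

section \<open>A drift condition for stability\<close>

lemma (in markov_law) nn_integral_law_step:
  assumes "a \<in> borel_measurable S"
  shows "(\<integral>\<^sup>+\<omega>. a (\<omega> (Suc n)) \<partial>mlaw) = (\<integral>\<^sup>+\<omega>. (\<integral>\<^sup>+y. a y \<partial>K (\<omega> n)) \<partial>mlaw)"
  using nn_integral_law_Suc[of "\<lambda>_. 1" n a] assms by simp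

context inf_compact_mdp
begin

context
  fixes f assumes f[measurable]: "f \<in> borel \<rightarrow>\<^sub>M borel" and f_U: "\<And>x. f x \<in> \<U> x"
begin

lemma space_graph_borel: "space graph_borel = graph"
  by (simp add: graph_borel_def space_restrict_space)

lemma graph_map_measurable[measurable]: "(\<lambda>x. (x, f x)) \<in> borel \<rightarrow>\<^sub>M graph_borel"
  unfolding graph_borel_eq by (rule measurable_restrict_space2) (use f_U in \<open>auto simp: graph_def\<close>)

text \<open>A deterministic action makes the pair a function of the state. The image lies in the
  graph, so restricting to the graph loses no mass.\<close>

lemma state_action_of_selector:
  assumes \<mu>: "\<mu> \<in> space (prob_algebra borel)"
  shows "state_action \<mu> (of_selector f) = distr \<mu> graph_borel (\<lambda>x. (x, f x))"
proof -
  have \<mu>_sets[measurable_cong]: "sets \<mu> = sets borel" and \<mu>_prob: "prob_space \<mu>"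
    using \<mu> by (simp_all add: space_prob_algebra)
  have map: "(\<lambda>x. (x, f x)) \<in> \<mu> \<rightarrow>\<^sub>M borel" unfolding borel_prod[symmetric] by measurable
  have "distr (return borel (f x)) borel (Pair x) = return borel (x, f x)" for x
    by (rule distr_return) (simp_all add: borel_prod[symmetric])
  then have "\<mu> \<bind> (\<lambda>x. distr (of_selector f x) borel (\<lambda>u. (x, u))) = \<mu> \<bind> (\<lambda>x. return borel (x, f x))"
    by (simp add: of_selector_def)
  also have "\<dots> = distr \<mu> borel (\<lambda>x. (x, f x))"
    by (rule bind_return_distr'[OF prob_space.not_empty[OF \<mu>_prob] map])
  finally have eq: "state_action \<mu> (of_selector f) = restrict_space (distr \<mu> borel (\<lambda>x. (x, f x))) graph"
    by (simp add: state_action_def)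
  show ?thesis
    unfolding eq
  proof (rule measure_eqI)
    show "sets (restrict_space (distr \<mu> borel (\<lambda>x. (x, f x))) graph) = sets (distr \<mu> graph_borel (\<lambda>x. (x, f x)))"
      by (simp add: graph_borel_def sets_restrict_space)
    fix S assume "S \<in> sets (restrict_space (distr \<mu> borel (\<lambda>x. (x, f x))) graph)"
    then have S: "S \<in> sets graph_borel" by (simp add: graph_borel_def sets_restrict_space)
    then have S': "S \<in> sets borel" "S \<subseteq> graph"
      using borel_closed[OF closed_graph] by (auto simp: graph_borel_def sets_restrict_space)
    have "emeasure (restrict_space (distr \<mu> borel (\<lambda>x. (x, f x))) graph) S = emeasure (distr \<mu> borel (\<lambda>x. (x, f x))) S"
      using S' borel_closed[OF closed_graph] by (intro emeasure_restrict_space) auto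
    also have "\<dots> = emeasure (distr \<mu> graph_borel (\<lambda>x. (x, f x))) S"
      by (simp add: emeasure_distr[OF map S'(1)] emeasure_distr[OF _ S])
    finally show "emeasure (restrict_space (distr \<mu> borel (\<lambda>x. (x, f x))) graph) S =
      emeasure (distr \<mu> graph_borel (\<lambda>x. (x, f x))) S" .
  qed
qed

lemma nn_integral_state_action:
  assumes \<mu>: "\<mu> \<in> space (prob_algebra borel)" and h: "h \<in> borel_measurable graph_borel"
  shows "(\<integral>\<^sup>+z. h z \<partial>state_action \<mu> (of_selector f)) = (\<integral>\<^sup>+x. h (x, f x) \<partial>\<mu>)"
proof -
  have [measurable_cong]: "sets \<mu> = sets borel" using \<mu> by (simp add: space_prob_algebra)
  show ?thesis
    unfolding state_action_of_selector[OF \<mu>]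
  proof (rule nn_integral_distr)
    show "(\<lambda>x. (x, f x)) \<in> \<mu> \<rightarrow>\<^sub>M graph_borel" by measurable
  qed (simp add: h)
qed

definition state_action_kernel :: "'x \<times> 'u \<Rightarrow> ('x \<times> 'u) measure" where
  "state_action_kernel z = state_action (P (fst z) (snd z)) (of_selector f)"

lemma graph_borel_le[measurable]: "(\<lambda>z. z) \<in> graph_borel \<rightarrow>\<^sub>M borel \<Otimes>\<^sub>M borel"
  unfolding graph_borel_eq by (rule measurable_restrict_space1) simp

lemma law_of_selector:
  "law (of_stationary (of_selector f)) (return borel x) =
    path_law graph_borel (markov_kernels (state_action (return borel x) (of_selector f)) state_action_kernel)"
  unfolding law_def
  by (rule arg_cong[where f="path_law graph_borel"])
    (auto simp: fun_eq_iff markov_kernels_def of_stationary_def state_action_kernel_def split: nat.split)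

lemma return_in_prob_algebra: "return borel x \<in> space (prob_algebra borel)"
  using measurable_space[OF measurable_return_prob_space, of x borel] by simp

lemma markov_law_of_selector:
  "markov_law graph_borel (state_action (return borel x) (of_selector f)) state_action_kernel"
proof
  have distr: "(\<lambda>\<mu>. distr \<mu> graph_borel (\<lambda>x. (x, f x))) \<in> prob_algebra borel \<rightarrow>\<^sub>M prob_algebra graph_borel"
    by (rule measurable_distr_prob_space) measurable
  show "state_action (return borel x) (of_selector f) \<in> space (prob_algebra graph_borel)"
    unfolding state_action_of_selector[OF return_in_prob_algebra]
    by (rule measurable_space[OF distr return_in_prob_algebra])
  have "state_action_kernel z = distr (P_total z) graph_borel (\<lambda>x. (x, f x))" if "z \<in> space graph_borel" for z
    using that by (auto simp: space_graph_borel graph_def state_action_kernel_def state_action_of_selector P_in_prob_algebra)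
  moreover have "(\<lambda>z. distr (P_total z) graph_borel (\<lambda>x. (x, f x))) \<in> graph_borel \<rightarrow>\<^sub>M prob_algebra graph_borel"
    by (rule measurable_compose[OF measurable_compose[OF graph_borel_le P_total_measurable] distr])
  ultimately show "state_action_kernel \<in> graph_borel \<rightarrow>\<^sub>M prob_algebra graph_borel"
    by (simp cong: measurable_cong)
qed

lemma cost_under_of_selector: "cost_under (of_selector f) x = c x (f x)"
proof -
  have "cost_under (of_selector f) x = (\<integral>\<^sup>+u\<in>\<U> x. c_total (x, u) \<partial>return borel (f x))"
    unfolding cost_under_def of_selector_def by (intro nn_integral_cong) (simp add: indicator_def)
  also have "\<dots> = c x (f x)"
    by (subst nn_integral_return) (simp_all add: f_U)
  finally show ?thesis .
qed

text \<open>A Foster-Lyapunov argument: along the chain the drift inequality telescopes in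
  \<open>\<Lambda>\<close>, so the total cost up to time \<open>N\<close> is at most twice the
  initial value plus \<open>N * C\<close>.\<close>

lemma stabilizing_of_drift:
  assumes \<Lambda>[measurable]: "\<Lambda> \<in> borel_measurable borel" and fin: "\<And>x. \<Lambda> x < top" and C: "0 \<le> C"
    and drift: "\<And>x. (\<integral>\<^sup>+y. \<Lambda> y \<partial>P x (f x)) + c x (f x) / 2 \<le> \<Lambda> x + ennreal C"
  shows "stabilizing (of_selector f)"
  unfolding stabilizing_def
proof
  fix x
  interpret markov_law graph_borel "state_action (return borel x) (of_selector f)" state_action_kernel
    by (rule markov_law_of_selector)
  let ?L = "law (of_stationary (of_selector f)) (return borel x)"
  have law: "?L = mlaw" by (rule law_of_selector)
  note sets_law[measurable_cong]
  have fst_m[measurable]: "fst \<in> graph_borel \<rightarrow>\<^sub>M borel"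
    using measurable_compose[OF graph_borel_le measurable_fst] by simp
  have comp: "(\<lambda>\<omega>. \<omega> k) \<in> mlaw \<rightarrow>\<^sub>M graph_borel" for k
    by (subst measurable_cong_sets[OF sets_law refl]) simp
  have X: "(\<lambda>\<omega>. fst (\<omega> k)) \<in> mlaw \<rightarrow>\<^sub>M borel" for k
    by (rule measurable_compose[OF comp fst_m])
  have in_graph: "\<omega> k \<in> graph" if "\<omega> \<in> space mlaw" for \<omega> k
    using that by (auto simp: space_law space_PiM space_graph_borel)
  have cf[measurable]: "(\<lambda>y. c y (f y)) \<in> borel_measurable borel"
  proof -
    have "(\<lambda>y. c_total (y, f y)) \<in> borel_measurable borel" by measurable
    then show ?thesis by (simp add: f_U)
  qed
  \<comment> \<open>At every time, time 0 included, the action coordinate may be replaced by the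
    selector's value at the state coordinate.\<close>
  have action: "(\<integral>\<^sup>+\<omega>. h (\<omega> k) \<partial>mlaw) = (\<integral>\<^sup>+\<omega>. h (fst (\<omega> k), f (fst (\<omega> k))) \<partial>mlaw)"
    if h[measurable]: "h \<in> borel_measurable graph_borel" for h k
  proof -
    let ?h = "\<lambda>z. h (fst z, f (fst z))"
    have h': "?h \<in> borel_measurable graph_borel"
      by (rule measurable_compose[OF measurable_compose[OF fst_m graph_map_measurable] h])
    show ?thesis
    proof (cases k)
      case 0
      then show ?thesis
        using nn_integral_law_0[OF h] nn_integral_law_0[OF h']
        by (simp add: nn_integral_state_action[OF return_in_prob_algebra] h h')
    next
      case (Suc n)
      have "(\<integral>\<^sup>+\<omega>. (\<integral>\<^sup>+y. h y \<partial>state_action_kernel (\<omega> n)) \<partial>mlaw) =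
        (\<integral>\<^sup>+\<omega>. (\<integral>\<^sup>+y. ?h y \<partial>state_action_kernel (\<omega> n)) \<partial>mlaw)"
      proof (rule nn_integral_cong)
        fix \<omega> assume "\<omega> \<in> space mlaw"
        from in_graph[OF this, of n] have "P (fst (\<omega> n)) (snd (\<omega> n)) \<in> space (prob_algebra borel)"
          by (intro P_in_prob_algebra) (auto simp: graph_def)
        then show "(\<integral>\<^sup>+y. h y \<partial>state_action_kernel (\<omega> n)) = (\<integral>\<^sup>+y. ?h y \<partial>state_action_kernel (\<omega> n))"
          by (simp add: state_action_kernel_def nn_integral_state_action h h')
      qed
      then show ?thesis
        unfolding Suc nn_integral_law_step[OF h] nn_integral_law_step[OF h'] .
    qed
  qed
  define E where "E h k = (\<integral>\<^sup>+\<omega>. h (fst (\<omega> k)) \<partial>mlaw)" for h :: "'x \<Rightarrow> ennreal" and k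
  let ?c = "\<lambda>y. c y (f y)"
  have step: "E \<Lambda> (Suc k) + E ?c k / 2 \<le> E \<Lambda> k + ennreal C" for k
  proof -
    let ?h = "\<lambda>z. \<integral>\<^sup>+y. \<Lambda> y \<partial>P_total z"
    have h: "?h \<in> borel_measurable graph_borel"
      by (rule measurable_compose[OF graph_borel_le
        nn_integral_measurable_subprob_algebra2[OF _ measurable_prob_algebraD[OF P_total_measurable]]]) measurable
    have hf[measurable]: "(\<lambda>y. ?h (y, f y)) \<in> borel_measurable borel"
      by (rule measurable_compose[OF graph_map_measurable h])
    have "E \<Lambda> (Suc k) = (\<integral>\<^sup>+\<omega>. (\<integral>\<^sup>+z. \<Lambda> (fst z) \<partial>state_action_kernel (\<omega> k)) \<partial>mlaw)"
      unfolding E_def by (rule nn_integral_law_step[of "\<lambda>z. \<Lambda> (fst z)"]) measurable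
    also have "\<dots> = (\<integral>\<^sup>+\<omega>. ?h (\<omega> k) \<partial>mlaw)"
    proof (rule nn_integral_cong)
      fix \<omega> assume "\<omega> \<in> space mlaw"
      from in_graph[OF this, of k] have u: "snd (\<omega> k) \<in> \<U> (fst (\<omega> k))" by (auto simp: graph_def)
      have "P_total (\<omega> k) = P (fst (\<omega> k)) (snd (\<omega> k))"
        using P_total_eq[OF u] by simp
      then show "(\<integral>\<^sup>+z. \<Lambda> (fst z) \<partial>state_action_kernel (\<omega> k)) = ?h (\<omega> k)"
        using nn_integral_state_action[OF P_in_prob_algebra[OF u], of "\<lambda>z. \<Lambda> (fst z)"]
        by (simp add: state_action_kernel_def)
    qed
    also have "\<dots> = E (\<lambda>y. ?h (y, f y)) k" unfolding E_def by (rule action[OF h])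
    finally have "E \<Lambda> (Suc k) + E ?c k / 2 = E (\<lambda>y. ?h (y, f y) + ?c y / 2) k"
      unfolding E_def using X[of k]
      by (simp add: nn_integral_add nn_integral_divide)
    also have "\<dots> \<le> E (\<lambda>y. \<Lambda> y + ennreal C) k"
      unfolding E_def using drift by (intro nn_integral_mono) (simp add: f_U)
    also have "\<dots> = E \<Lambda> k + ennreal C"
      unfolding E_def using X[of k] prob_space.emeasure_space_1[OF prob_space_law] by (simp add: nn_integral_add)
    finally show ?thesis .
  qed
  have E0: "E \<Lambda> 0 = \<Lambda> x"
    unfolding E_def using nn_integral_law_0[of "\<lambda>z. \<Lambda> (fst z)"]
    by (simp add: nn_integral_state_action[OF return_in_prob_algebra] nn_integral_return)
  \<comment> \<open>The \<open>\<Lambda>\<close>-term stays on the left through the induction, since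
    telescoping by cancellation would require its expectation to be finite.\<close>
  have total: "E \<Lambda> N + (\<Sum>k<N. E ?c k) / 2 \<le> \<Lambda> x + of_nat N * ennreal C" for N
  proof (induction N)
    case (Suc N)
    have "E \<Lambda> (Suc N) + (\<Sum>k<Suc N. E ?c k) / 2 = (E \<Lambda> (Suc N) + E ?c N / 2) + (\<Sum>k<N. E ?c k) / 2"
      by (simp add: add_divide_distrib_ennreal ac_simps)
    also have "\<dots> \<le> (E \<Lambda> N + ennreal C) + (\<Sum>k<N. E ?c k) / 2"
      by (intro add_right_mono step)
    also have "\<dots> = (E \<Lambda> N + (\<Sum>k<N. E ?c k) / 2) + ennreal C"
      by (simp add: ac_simps)
    also have "\<dots> \<le> (\<Lambda> x + of_nat N * ennreal C) + ennreal C"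
      by (intro add_right_mono Suc.IH)
    also have "\<dots> = \<Lambda> x + of_nat (Suc N) * ennreal C"
      by (simp add: distrib_right add.assoc add.commute[of "ennreal C"])
    finally show ?case .
  qed (simp add: E0)
  obtain l where l: "\<Lambda> x = ennreal l" "0 \<le> l" using fin[of x] by (metis ennreal_cases less_irrefl)
  have avg: "(\<integral>\<^sup>+\<omega>. (\<Sum>k<N. cost_under (of_selector f) (fst (\<omega> k))) \<partial>?L) / of_nat N \<le> ennreal (2 * (l + C))"
    if N: "1 \<le> N" for N
  proof -
    have "(\<integral>\<^sup>+\<omega>. (\<Sum>k<N. cost_under (of_selector f) (fst (\<omega> k))) \<partial>?L) = (\<Sum>k<N. E ?c k)"
      unfolding law E_def cost_under_of_selector using X by (intro nn_integral_sum) measurable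
    also have "\<dots> = 2 * ((\<Sum>k<N. E ?c k) / 2)"
      by (simp add: ennreal_times_divide mult.commute[of 2] ennreal_mult_divide_eq)
    also have "\<dots> \<le> 2 * (\<Lambda> x + of_nat N * ennreal C)"
      using total[of N] by (intro mult_left_mono order_trans[OF _ total[of N]]) simp_all
    also have "\<dots> = ennreal (2 * (l + real N * C))"
      using l C by (simp add: ennreal_mult ennreal_of_nat_eq_real_of_nat)
    \<comment> \<open>Here \<open>N \<ge> 1\<close> absorbs the initial value into the linear term;
      the quotient at \<open>N = 0\<close> does not affect the limit superior.\<close>
    also have "\<dots> \<le> ennreal (2 * (l + C) * real N)"
    proof (rule ennreal_leI)
      have "l * 1 \<le> l * real N" using l(2) N by (intro mult_left_mono) auto
      then show "2 * (l + real N * C) \<le> 2 * (l + C) * real N" by (simp add: algebra_simps)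
    qed
    finally have "(\<integral>\<^sup>+\<omega>. (\<Sum>k<N. cost_under (of_selector f) (fst (\<omega> k))) \<partial>?L) / of_nat N \<le>
      ennreal (2 * (l + C) * real N) / of_nat N"
      by (rule divide_right_mono_ennreal)
    also have "\<dots> = ennreal (2 * (l + C))"
      using N l C by (simp add: ennreal_of_nat_eq_real_of_nat divide_ennreal)
    finally show ?thesis .
  qed
  have "limsup (\<lambda>N. (\<integral>\<^sup>+\<omega>. (\<Sum>k<N. cost_under (of_selector f) (fst (\<omega> k))) \<partial>?L) / of_nat N) \<le> ennreal (2 * (l + C))"
    using avg by (intro Limsup_bounded eventually_sequentiallyI[of 1])
  also have "\<dots> < \<infinity>" by simp
  finally show "limsup (\<lambda>N. (\<integral>\<^sup>+\<omega>. (\<Sum>k<N. cost_under (of_selector f) (fst (\<omega> k))) \<partial>?L) / of_nat N) < \<infinity>" .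
qed

end

end

section \<open>Value iteration\<close>

text \<open>Pointwise, the positive part of \<open>g\<close> plus \<open>A\<close> equals
  \<open>g + A\<close> plus the negative part. The negative part has integral at most
  \<open>A\<close>, so it can be cancelled after integration.\<close>

lemma ext_integral_bounded_below:
  assumes M: "prob_space M" and g[measurable]: "g \<in> borel_measurable M"
    and A: "0 \<le> A" "\<And>y. - A \<le> (g y :: real)"
  shows "ext_integral M (\<lambda>y. ereal (g y)) = enn2ereal (\<integral>\<^sup>+y. ennreal (g y + A) \<partial>M) - ereal A"
proof -
  have f1: "e2ennreal (ereal r) = ennreal r" for r by (simp add: ennreal.abs_eq ennreal_def)
  have "ennreal (g y) + ennreal A = ennreal (g y + A) + ennreal (- g y)" for y
    using A(1) A(2)[of y] by (cases "0 \<le> g y") (simp_all add: ennreal_neg ennreal_plus[symmetric] del: ennreal_plus)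
  then have "(\<integral>\<^sup>+y. ennreal (g y) + ennreal A \<partial>M) = (\<integral>\<^sup>+y. ennreal (g y + A) + ennreal (- g y) \<partial>M)"
    by simp
  then have eq: "(\<integral>\<^sup>+y. ennreal (g y) \<partial>M) + ennreal A = (\<integral>\<^sup>+y. ennreal (g y + A) \<partial>M) + (\<integral>\<^sup>+y. ennreal (- g y) \<partial>M)"
    using prob_space.emeasure_space_1[OF M] by (simp add: nn_integral_add)
  have "(\<integral>\<^sup>+y. ennreal (- g y) \<partial>M) \<le> (\<integral>\<^sup>+y. ennreal A \<partial>M)"
  proof (rule nn_integral_mono)
    show "ennreal (- g y) \<le> ennreal A" for y using A(2)[of y] by (intro ennreal_leI) simp
  qed
  also have "\<dots> = ennreal A" using prob_space.emeasure_space_1[OF M] by simp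
  finally obtain d where d: "(\<integral>\<^sup>+y. ennreal (- g y) \<partial>M) = ennreal d" "0 \<le> d"
    by (cases "\<integral>\<^sup>+y. ennreal (- g y) \<partial>M" rule: ennreal_cases) (auto simp: top_unique)
  have "ext_integral M (\<lambda>y. ereal (g y)) = enn2ereal (\<integral>\<^sup>+y. ennreal (g y) \<partial>M) - ereal d"
    unfolding ext_integral_def using d by (simp add: f1)
  also have "\<dots> = enn2ereal (\<integral>\<^sup>+y. ennreal (g y + A) \<partial>M) - ereal A"
    using eq d A(1)
    by (cases "\<integral>\<^sup>+y. ennreal (g y) \<partial>M" rule: ennreal_cases; cases "\<integral>\<^sup>+y. ennreal (g y + A) \<partial>M" rule: ennreal_cases)
      (auto simp: ennreal_plus[symmetric] simp del: ennreal_plus)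
  finally show ?thesis .
qed

text \<open>\<open>\<psi>\<close> stands for the value function up to a bounded error; \<open>lower\<close> and \<open>upper\<close> say that it solves
  the optimality equation up to constants.\<close>

locale approximate_value_iteration = inf_compact_mdp \<U> P c
  for \<U> :: "'x::polish_space \<Rightarrow> 'u::polish_space set" and P c +
  fixes \<psi> :: "'x \<Rightarrow> real" and D E \<theta> K :: real and \<Phi>\<^sub>0 :: "'x \<Rightarrow> real" and v :: "nat \<Rightarrow> 'x \<Rightarrow> 'u"
  assumes \<beta>_finite: "\<beta> < top"
    and \<psi>_measurable[measurable]: "\<psi> \<in> borel_measurable borel" and \<psi>_nonneg: "\<And>x. 0 \<le> \<psi> x"
    and lower: "\<And>x u. u \<in> \<U> x \<Longrightarrow> ennreal (\<psi> x) \<le> c x u + (\<integral>\<^sup>+y. ennreal (\<psi> y) \<partial>P x u)"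
    and D: "0 \<le> D"
    and upper: "\<And>x. \<exists>u\<in>\<U> x. c x u + (\<integral>\<^sup>+y. ennreal (\<psi> y) \<partial>P x u) \<le> ennreal (\<psi> x + D)"
    and \<theta>: "0 < \<theta>" "\<theta> < 1" and E: "0 \<le> E"
    and cost_lower: "\<And>x u. u \<in> \<U> x \<Longrightarrow> ennreal (\<theta> * \<psi> x - E) \<le> c x u"
    and K: "0 \<le> K"
    and init_measurable: "\<Phi>\<^sub>0 \<in> borel_measurable borel"
    and init: "\<And>x. - K \<le> \<Phi>\<^sub>0 x" "\<And>x. \<Phi>\<^sub>0 x \<le> K * \<psi> x + K"
    and selector: "\<And>n. minimizing_selector \<Phi>\<^sub>0 n (v n)"
begin

definition q :: "nat \<Rightarrow> real" where
  "q n = (1 - \<theta>) ^ n"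

definition b :: real where
  "b = enn2real \<beta>"

lemma q: "0 < q n" "q n \<le> 1" "q (Suc n) = (1 - \<theta>) * q n"
  using \<theta> by (auto simp: q_def intro: power_le_one)

lemma b: "0 \<le> b" "\<beta> = ennreal b"
  using \<beta>_finite by (simp_all add: b_def)

text \<open>The multiplicative gap to \<open>\<psi>\<close> contracts by the factor \<open>1 - \<theta>\<close> in each iteration.\<close>

definition iterate_bounds :: "nat \<Rightarrow> ('x \<Rightarrow> real) \<Rightarrow> real \<Rightarrow> bool" where
  "iterate_bounds n \<phi> A \<longleftrightarrow> 0 \<le> A \<and> \<phi> \<in> borel_measurable borel \<and> value_iterate \<Phi>\<^sub>0 n = (\<lambda>x. ereal (\<phi> x)) \<and>
     (\<forall>x. (1 - q n) * \<psi> x - A \<le> \<phi> x \<and> \<phi> x \<le> (1 + K * q n) * \<psi> x + A)"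

text \<open>Since \<open>q 0 = 1\<close>, the lower bound contains no multiple of
  \<open>\<psi>\<close>, so boundedness below of the initial function suffices there.\<close>

lemma iterate_bounds_0: "iterate_bounds 0 \<Phi>\<^sub>0 K"
  using init \<psi>_nonneg K init_measurable
  by (auto simp: iterate_bounds_def q_def distrib_right intro: order_trans[OF init(2)])

text \<open>The shifts by \<open>A\<close> and \<open>b + A\<close> make all integrands and values
  nonnegative. Besides the new bounds, the step exports the exact equation at the selected action,
  because the drift inequality is read off from it.\<close>

lemma iterate_step:
  assumes inv: "iterate_bounds n \<phi> A"
  obtains \<phi>' A' where "iterate_bounds (Suc n) \<phi>' A'"
    "\<And>x. 0 \<le> \<phi>' x + (b + A)"
    "\<And>x. c x (v n x) + (\<integral>\<^sup>+y. ennreal (\<phi> y + A) \<partial>P x (v n x)) = ennreal (\<phi>' x + (b + A))"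
proof -
  from inv have A: "0 \<le> A" and \<phi>[measurable]: "\<phi> \<in> borel_measurable borel"
    and val: "value_iterate \<Phi>\<^sub>0 n = (\<lambda>x. ereal (\<phi> x))"
    and lo: "\<And>x. (1 - q n) * \<psi> x - A \<le> \<phi> x" and up: "\<And>x. \<phi> x \<le> (1 + K * q n) * \<psi> x + A"
    by (auto simp: iterate_bounds_def)
  define r where "r = 1 - q n"
  have r: "0 \<le> r" "r \<le> 1" using q[of n] by (auto simp: r_def)
  have \<phi>_ge: "- A \<le> \<phi> x" for x using lo[of x] mult_nonneg_nonneg[OF r(1) \<psi>_nonneg[of x]] by (simp add: r_def)
  define T where "T x u = c x u + (\<integral>\<^sup>+y. ennreal (\<phi> y + A) \<partial>P x u)" for x u
  have stage_eq: "stage_value (value_iterate \<Phi>\<^sub>0 n) x u = enn2ereal (T x u) - ereal (b + A)" if u: "u \<in> \<U> x" for x u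
  proof -
    have "\<phi> \<in> borel_measurable (P x u)" by (simp cong: measurable_cong_sets add: sets_P[OF u])
    from ext_integral_bounded_below[OF prob_space_P[OF u] this A \<phi>_ge]
    show ?thesis
      unfolding stage_value_def val T_def b(2) using b(1) A
      by (cases "c x u" rule: ennreal_cases; cases "\<integral>\<^sup>+y. ennreal (\<phi> y + A) \<partial>P x u" rule: ennreal_cases)
        (auto simp: plus_ennreal.rep_eq)
  qed
  \<comment> \<open>The summands are the defect \<open>D\<close> and the constant \<open>E\<close>
    from the lower cost bound, each multiplied by at most \<open>1 + K\<close>, and
    \<open>b + A\<close> for undoing the shift in the lower bound.\<close>
  define A' where "A' = (1 + K) * D + (1 + K) * E + b + A"
  have A': "0 \<le> A'" using A b(1) D E K by (simp add: A'_def)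
  \<comment> \<open>The cost is split into the shares \<open>r = 1 - q n\<close> and
    \<open>q n\<close>. The first share and the integral together dominate
    \<open>r * \<psi> x\<close> by \<open>lower\<close>; the second adds
    \<open>\<theta> * q n * \<psi> x\<close> up to a constant, which raises the coefficient to
    \<open>1 - q (Suc n)\<close>.\<close>
  have low: "ereal ((1 - q (Suc n)) * \<psi> x - A') \<le> enn2ereal (T x u) - ereal (b + A)" if u: "u \<in> \<U> x" for x u
  proof (cases "T x u" rule: ennreal_cases)
    case (real t)
    then obtain cr where cr: "c x u = ennreal cr" "0 \<le> cr"
      by (cases "c x u" rule: ennreal_cases) (auto simp: T_def)
    have "ennreal (r * \<psi> x) = ennreal r * ennreal (\<psi> x)"
      using r \<psi>_nonneg by (simp add: ennreal_mult)
    also have "\<dots> \<le> ennreal r * (c x u + (\<integral>\<^sup>+y. ennreal (\<psi> y) \<partial>P x u))"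
      by (intro mult_left_mono lower[OF u]) simp
    also have "\<dots> = ennreal (r * cr) + (\<integral>\<^sup>+y. ennreal (r * \<psi> y) \<partial>P x u)"
    proof -
      have "(\<lambda>y. ennreal (\<psi> y)) \<in> borel_measurable (P x u)" by (simp cong: measurable_cong_sets add: sets_P[OF u])
      then have "(\<integral>\<^sup>+y. ennreal (r * \<psi> y) \<partial>P x u) = ennreal r * (\<integral>\<^sup>+y. ennreal (\<psi> y) \<partial>P x u)"
        using r \<psi>_nonneg by (simp add: ennreal_mult nn_integral_cmult)
      then show ?thesis using r cr by (simp add: distrib_left ennreal_mult)
    qed
    also have "\<dots> \<le> ennreal (r * cr) + (\<integral>\<^sup>+y. ennreal (\<phi> y + A) \<partial>P x u)"
      using lo by (intro add_left_mono nn_integral_mono ennreal_leI) (simp add: r_def algebra_simps)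
    finally have "ennreal (r * \<psi> x) + ennreal (q n * cr) \<le>
      ennreal (r * cr) + (\<integral>\<^sup>+y. ennreal (\<phi> y + A) \<partial>P x u) + ennreal (q n * cr)"
      by (rule add_right_mono)
    also have "\<dots> = (ennreal (r * cr) + ennreal (q n * cr)) + (\<integral>\<^sup>+y. ennreal (\<phi> y + A) \<partial>P x u)"
      by (simp only: ac_simps)
    also have "ennreal (r * cr) + ennreal (q n * cr) = c x u"
    proof -
      have "ennreal (r * cr) + ennreal (q n * cr) = ennreal (r * cr + q n * cr)"
        using r q(1)[of n] cr by simp
      also have "r * cr + q n * cr = cr" by (simp add: r_def left_diff_distrib)
      finally show ?thesis using cr by simp
    qed
    also have "c x u + (\<integral>\<^sup>+y. ennreal (\<phi> y + A) \<partial>P x u) = ennreal t" using real by (simp add: T_def)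
    finally have "r * \<psi> x + q n * cr \<le> t"
      using r q[of n] cr \<psi>_nonneg[of x] real(1) by (simp add: ennreal_plus[symmetric] del: ennreal_plus)
    moreover have "q n * (\<theta> * \<psi> x - E) \<le> q n * cr"
      using cost_lower[OF u] cr q(1)[of n] by (intro mult_left_mono) (auto simp: ennreal_le_iff)
    moreover have "q n * E \<le> (1 + K) * E" using q(2)[of n] K E by (intro mult_right_mono) auto
    moreover have "0 \<le> (1 + K) * D" using K D by simp
    moreover have "r * \<psi> x + q n * (\<theta> * \<psi> x - E) = (1 - q (Suc n)) * \<psi> x - q n * E"
      unfolding q(3) r_def by (simp add: algebra_simps)
    ultimately show ?thesis using real by (simp add: A'_def)
  qed simp
  \<comment> \<open>At an action nearly optimal for \<open>\<psi>\<close> and with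
    \<open>a = 1 + K * q n\<close>, cost plus \<open>a\<close> times the integral is
    \<open>a\<close> times their sum minus \<open>K * q n\<close> times the cost. The subtracted
    cost removes the fraction \<open>\<theta>\<close> of the excess
    \<open>K * q n * \<psi> x\<close>.\<close>
  have high: "\<exists>u\<in>\<U> x. enn2ereal (T x u) - ereal (b + A) \<le> ereal ((1 + K * q (Suc n)) * \<psi> x + A')" for x
  proof -
    obtain u where u: "u \<in> \<U> x" and le: "c x u + (\<integral>\<^sup>+y. ennreal (\<psi> y) \<partial>P x u) \<le> ennreal (\<psi> x + D)"
      using upper by blast
    have "c x u + (\<integral>\<^sup>+y. ennreal (\<psi> y) \<partial>P x u) < top" using le by (rule le_less_trans) simp
    then obtain cr I where cr: "c x u = ennreal cr" "0 \<le> cr"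
      and I: "(\<integral>\<^sup>+y. ennreal (\<psi> y) \<partial>P x u) = ennreal I" "0 \<le> I"
      by (cases "c x u" rule: ennreal_cases; cases "\<integral>\<^sup>+y. ennreal (\<psi> y) \<partial>P x u" rule: ennreal_cases) auto
    have sum: "cr + I \<le> \<psi> x + D"
      using le cr I \<psi>_nonneg[of x] D by (simp add: ennreal_plus[symmetric] del: ennreal_plus)
    define a where "a = 1 + K * q n"
    have a: "1 \<le> a" "a \<le> 1 + K" using K q[of n] by (auto simp: a_def mult_left_le)
    have "(\<integral>\<^sup>+y. ennreal (\<phi> y + A) \<partial>P x u) \<le> (\<integral>\<^sup>+y. ennreal a * ennreal (\<psi> y) + ennreal (2 * A) \<partial>P x u)"
    proof (rule nn_integral_mono)
      fix y
      have "ennreal (\<phi> y + A) \<le> ennreal (a * \<psi> y + 2 * A)"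
        using up[of y] by (intro ennreal_leI) (simp add: a_def)
      also have "\<dots> = ennreal a * ennreal (\<psi> y) + ennreal (2 * A)"
        using a \<psi>_nonneg[of y] A by (simp add: ennreal_mult)
      finally show "ennreal (\<phi> y + A) \<le> ennreal a * ennreal (\<psi> y) + ennreal (2 * A)" .
    qed
    also have "\<dots> = ennreal a * ennreal I + ennreal (2 * A)"
    proof -
      have "(\<lambda>y. ennreal (\<psi> y)) \<in> borel_measurable (P x u)" by (simp cong: measurable_cong_sets add: sets_P[OF u])
      then show ?thesis
        using prob_space.emeasure_space_1[OF prob_space_P[OF u]] by (simp add: nn_integral_add nn_integral_cmult I(1))
    qed
    also have "\<dots> = ennreal (a * I + 2 * A)" using a I A by (simp add: ennreal_mult)
    finally have "T x u \<le> ennreal cr + ennreal (a * I + 2 * A)"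
      unfolding T_def cr(1) by (rule add_left_mono)
    also have "\<dots> = ennreal (cr + (a * I + 2 * A))" using cr a I A by simp
    finally have "T x u \<le> ennreal (cr + (a * I + 2 * A))" .
    moreover have "cr + (a * I + 2 * A) \<le> (1 + K * q (Suc n)) * \<psi> x + A' + (b + A)"
    proof -
      have "cr + a * I = a * (cr + I) - (K * q n) * cr" by (simp add: a_def algebra_simps)
      moreover have "a * (cr + I) \<le> a * (\<psi> x + D)" using sum a by (intro mult_left_mono) auto
      moreover have "(K * q n) * (\<theta> * \<psi> x - E) \<le> (K * q n) * cr"
        using cost_lower[OF u] cr q(1)[of n] K by (intro mult_left_mono) (auto simp: ennreal_le_iff)
      moreover have "a * (\<psi> x + D) - (K * q n) * (\<theta> * \<psi> x - E) = (1 + K * q (Suc n)) * \<psi> x + a * D + (K * q n) * E"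
        unfolding a_def q(3) by (simp add: algebra_simps)
      moreover have "a * D \<le> (1 + K) * D" using a D by (intro mult_right_mono)
      moreover have "(K * q n) * E \<le> (1 + K) * E"
        using a E by (intro mult_right_mono) (auto simp: a_def)
      ultimately show ?thesis using b(1) A by (simp add: A'_def)
    qed
    ultimately have "T x u \<le> ennreal ((1 + K * q (Suc n)) * \<psi> x + A' + (b + A))"
      by (meson ennreal_leI order_trans)
    then have "enn2ereal (T x u) - ereal (b + A) \<le> ereal ((1 + K * q (Suc n)) * \<psi> x + A')"
      using \<psi>_nonneg[of x] K q(1)[of "Suc n"] A' b(1) A
      by (cases "T x u" rule: ennreal_cases) (auto simp: top_unique ennreal_le_iff simp del: ennreal_plus)
    with u show ?thesis by blast
  qed
  have vn: "v n \<in> borel \<rightarrow>\<^sub>M borel" "\<And>x. v n x \<in> \<U> x"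
    using selector[of n] by (auto simp: minimizing_selector_def)
  have vn_min: "enn2ereal (T x (v n x)) - ereal (b + A) \<le> enn2ereal (T x u) - ereal (b + A)" if u: "u \<in> \<U> x" for x u
    using selector[of n] u
    unfolding minimizing_selector_def stage_eq[OF vn(2), symmetric] stage_eq[OF u, symmetric] by blast
  have iter: "value_iterate \<Phi>\<^sub>0 (Suc n) x = enn2ereal (T x (v n x)) - ereal (b + A)" for x
  proof -
    have "value_iterate \<Phi>\<^sub>0 (Suc n) x = (INF u\<in>\<U> x. enn2ereal (T x u) - ereal (b + A))"
      by (simp add: stage_eq cong: INF_cong)
    also have "\<dots> = enn2ereal (T x (v n x)) - ereal (b + A)"
      by (rule antisym) (auto intro: INF_lower vn(2) INF_greatest vn_min)
    finally show ?thesis .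
  qed
  define \<phi>' where "\<phi>' x = enn2real (T x (v n x)) - (b + A)" for x
  have hi: "enn2ereal (T x (v n x)) - ereal (b + A) \<le> ereal ((1 + K * q (Suc n)) * \<psi> x + A')" for x
    using high[of x] vn_min[of _ x] by (blast intro: order_trans)
  \<comment> \<open>The upper bound excludes an infinite minimum, so the next iterate is
    real-valued.\<close>
  have T_real: "T x (v n x) = ennreal (\<phi>' x + (b + A))" "0 \<le> \<phi>' x + (b + A)" for x
    using hi[of x] by (cases "T x (v n x)" rule: ennreal_cases; simp add: \<phi>'_def)+
  have iter': "value_iterate \<Phi>\<^sub>0 (Suc n) x = ereal (\<phi>' x)" for x
    unfolding iter using T_real[of x] by simp
  have [measurable]: "v n \<in> borel \<rightarrow>\<^sub>M borel" by (rule vn)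
  have "\<phi>' \<in> borel_measurable borel"
  proof -
    have h: "(\<lambda>z. \<integral>\<^sup>+y. ennreal (\<phi> y + A) \<partial>P_total z) \<in> borel_measurable (borel \<Otimes>\<^sub>M borel)"
      by (rule nn_integral_measurable_subprob_algebra2[OF _ measurable_prob_algebraD[OF P_total_measurable]]) measurable
    have "(\<lambda>x. (x, v n x)) \<in> borel \<rightarrow>\<^sub>M borel \<Otimes>\<^sub>M borel" by measurable
    from measurable_compose[OF this h]
    have [measurable]: "(\<lambda>x. \<integral>\<^sup>+y. ennreal (\<phi> y + A) \<partial>P_total (x, v n x)) \<in> borel_measurable borel" by simp
    have "(\<lambda>x. enn2real (c_total (x, v n x) + (\<integral>\<^sup>+y. ennreal (\<phi> y + A) \<partial>P_total (x, v n x))) - (b + A)) \<in> borel_measurable borel"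
      by measurable
    then show ?thesis by (simp add: \<phi>'_def[abs_def] T_def vn(2))
  qed
  moreover have "(1 - q (Suc n)) * \<psi> x - A' \<le> \<phi>' x" for x
    using low[OF vn(2), of x] unfolding iter[symmetric] iter' by simp
  moreover have "\<phi>' x \<le> (1 + K * q (Suc n)) * \<psi> x + A'" for x
    using hi[of x] unfolding iter[symmetric] iter' by simp
  ultimately have "iterate_bounds (Suc n) \<phi>' A'"
    using A' iter' by (auto simp: iterate_bounds_def fun_eq_iff simp del: value_iterate.simps)
  with T_real show ?thesis by (intro that[of \<phi>' A']) (auto simp: T_def)
qed

lemma iterate_bounds_exist: "\<exists>\<phi> A. iterate_bounds n \<phi> A"
proof (induction n)
  case 0
  show ?case using iterate_bounds_0 by blast
next
  case (Suc n)
  then obtain \<phi> A where "iterate_bounds n \<phi> A" by blast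
  then show ?case by (rule iterate_step) blast
qed

text \<open>At the selected action, cost plus integral of the iterate is the next iterate up to
  constants. The two iterates differ by at most \<open>(K + 1) * q n * \<psi>\<close>, hence by half
  of \<open>\<theta> * \<psi>\<close>, plus constants, and half of the cost pays for this; the other
  half remains in the drift inequality.\<close>

lemma stabilizing_of_small_gap:
  assumes small: "(K + 1) * q n \<le> \<theta> / 2"
  shows "stabilizing (of_selector (v n))"
proof -
  obtain \<phi> A where inv: "iterate_bounds n \<phi> A" using iterate_bounds_exist by blast
  obtain \<phi>' A' where inv': "iterate_bounds (Suc n) \<phi>' A'" and T: "\<And>x. 0 \<le> \<phi>' x + (b + A)"
    "\<And>x. c x (v n x) + (\<integral>\<^sup>+y. ennreal (\<phi> y + A) \<partial>P x (v n x)) = ennreal (\<phi>' x + (b + A))"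
    by (rule iterate_step[OF inv]) blast
  have A: "0 \<le> A" and \<phi>[measurable]: "\<phi> \<in> borel_measurable borel"
    and lo: "\<And>x. (1 - q n) * \<psi> x - A \<le> \<phi> x"
    using inv by (auto simp: iterate_bounds_def)
  have A': "0 \<le> A'" and up: "\<And>x. \<phi>' x \<le> (1 + K * q (Suc n)) * \<psi> x + A'"
    using inv' by (auto simp: iterate_bounds_def)
  have vn: "v n \<in> borel \<rightarrow>\<^sub>M borel" "\<And>x. v n x \<in> \<U> x"
    using selector[of n] by (auto simp: minimizing_selector_def)
  \<comment> \<open>\<open>E / 2\<close> comes from bounding \<open>\<theta> / 2 * \<psi>\<close> by
    half the cost, \<open>A\<close> and \<open>A'\<close> from the bounds on the two iterates,
    \<open>b\<close> from the subtracted \<open>\<beta>\<close>.\<close>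
  define C where "C = E / 2 + A + A' + b"
  show ?thesis
  proof (rule stabilizing_of_drift[OF vn])
    show "(\<lambda>x. ennreal (\<phi> x + A)) \<in> borel_measurable borel" by measurable
    show "ennreal (\<phi> x + A) < top" for x by simp
    show "0 \<le> C" using E A A' b(1) by (simp add: C_def)
    fix x
    obtain cr I where cr: "c x (v n x) = ennreal cr" "0 \<le> cr"
      and I: "(\<integral>\<^sup>+y. ennreal (\<phi> y + A) \<partial>P x (v n x)) = ennreal I" "0 \<le> I"
      using T(2)[of x]
      by (cases "c x (v n x)" rule: ennreal_cases; cases "\<integral>\<^sup>+y. ennreal (\<phi> y + A) \<partial>P x (v n x)" rule: ennreal_cases) auto
    have sum: "cr + I = \<phi>' x + (b + A)"
      using T[of x] cr I by (simp add: ennreal_plus[symmetric] del: ennreal_plus)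
    have "0 \<le> (1 - q n) * \<psi> x" using q[of n] \<psi>_nonneg[of x] by simp
    then have pos: "0 \<le> \<phi> x + A" using lo[of x] by simp
    have "\<theta> * \<psi> x \<le> cr + E"
      using cost_lower[OF vn(2), of x] cr by (simp add: ennreal_le_iff)
    then have \<psi>_le: "(\<theta> / 2) * \<psi> x \<le> (cr + E) / 2" by simp
    have "(K + 1) * q n * \<psi> x \<le> (\<theta> / 2) * \<psi> x"
      using small \<psi>_nonneg[of x] by (intro mult_right_mono)
    then have gap: "K * q n * \<psi> x + q n * \<psi> x \<le> (cr + E) / 2"
      using \<psi>_le by (simp add: distrib_right)
    have decr: "K * q (Suc n) * \<psi> x \<le> K * q n * \<psi> x"
      using K q[of n] \<theta> \<psi>_nonneg[of x] unfolding q(3)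
      by (intro mult_right_mono mult_left_mono) (auto simp: mult_left_le_one_le)
    have "\<phi>' x \<le> \<psi> x + K * q (Suc n) * \<psi> x + A'"
      using up[of x] by (simp add: distrib_right)
    moreover have "\<psi> x - q n * \<psi> x - A \<le> \<phi> x"
      using lo[of x] by (simp add: left_diff_distrib)
    ultimately have "I + cr / 2 \<le> \<phi> x + A + (E / 2 + A + A' + b)"
    proof -
      have arith: "i + r / 2 \<le> f + A + (E / 2 + A + A' + b)"
        if "r + i = f' + (b + A)" "p\<^sub>2 + p\<^sub>3 \<le> (r + E) / 2" "p\<^sub>1 \<le> p\<^sub>2"
          "f' \<le> y + p\<^sub>1 + A'" "y - p\<^sub>3 - A \<le> f" for i r f f' p\<^sub>1 p\<^sub>2 p\<^sub>3 y :: real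
        using that by (simp add: field_simps)
      assume "\<phi>' x \<le> \<psi> x + K * q (Suc n) * \<psi> x + A'" "\<psi> x - q n * \<psi> x - A \<le> \<phi> x"
      then show ?thesis by (rule arith[OF sum gap decr])
    qed
    then have "I + cr / 2 \<le> \<phi> x + A + C" by (simp add: C_def)
    then have "ennreal (I + cr / 2) \<le> ennreal (\<phi> x + A + C)" by (rule ennreal_leI)
    moreover have "ennreal cr / 2 = ennreal (cr / 2)"
      using divide_ennreal[OF cr(2), of 2] by simp
    ultimately show "(\<integral>\<^sup>+y. ennreal (\<phi> y + A) \<partial>P x (v n x)) + c x (v n x) / 2 \<le> ennreal (\<phi> x + A) + ennreal C"
      using I cr pos \<open>0 \<le> C\<close> by simp
  qed
qed

theorem eventually_stabilizing: "\<exists>N\<^sub>0. \<forall>n\<ge>N\<^sub>0. stabilizing (of_selector (v n))"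
proof -
  have "(\<lambda>n. (K + 1) * q n) \<longlonglongrightarrow> (K + 1) * 0"
    unfolding q_def using \<theta> by (intro tendsto_mult_left LIMSEQ_realpow_zero) auto
  then have "eventually (\<lambda>n. (K + 1) * q n < \<theta> / 2) sequentially"
    using \<theta> by (intro order_tendstoD) auto
  then show ?thesis
    unfolding eventually_sequentially by (blast intro: stabilizing_of_small_gap less_imp_le)
qed

end

section \<open>From the standing assumptions and (H2) to the hypotheses on
  \<open>\<psi>\<close>\<close>

context split_mdp
begin

text \<open>Under the first alternative of (A1), a compact sublevel set of the cost is intersected
  with the closed set \<open>L \<times> UNIV\<close>; the second alternative contains the required
  compactness directly.\<close>

lemma standing_imp_stable_split_mdp:
  assumes "standing_assumptions TYPE('xs::polish_space) TYPE('us::polish_space)"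
  shows "stable_split_mdp \<U> P c \<B> \<nu> \<delta>"
proof -
  have st: is_mdp basic_assumptions assumption_A0 "assumption_A1 TYPE('xs) TYPE('us)" "\<exists>v\<in>stationary. c_stable v"
    using assms by (auto simp: standing_assumptions_def)
  have compact: "compact {(x, u) \<in> graph. x \<in> L \<and> c x u \<le> ennreal \<kappa>}" if L: "compact L" for L \<kappa>
    using st(4) unfolding assumption_A1_def
  proof (elim disjE conjE)
    assume *: "\<forall>\<kappa>::real. compact {(x, u) \<in> graph. c x u \<le> ennreal \<kappa>}"
    have "compact ({(x, u) \<in> graph. c x u \<le> ennreal \<kappa>} \<inter> L \<times> UNIV)"
      using * closed_Times[OF compact_imp_closed[OF L] closed_UNIV] by (intro compact_Int_closed) blast+
    also have "{(x, u) \<in> graph. c x u \<le> ennreal \<kappa>} \<inter> L \<times> UNIV = {(x, u) \<in> graph. x \<in> L \<and> c x u \<le> ennreal \<kappa>}"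
      by auto
    finally show ?thesis .
  qed (use L in blast)
  show ?thesis
    by unfold_locales (use st compact in auto)
qed

end

theorem theorem6p2:
  fixes \<U> :: "'x::polish_space \<Rightarrow> 'u::polish_space set"
    and P :: "'x \<Rightarrow> 'u \<Rightarrow> 'x measure"
    and c :: "'x \<Rightarrow> 'u \<Rightarrow> ennreal"
    and \<B> :: "'x set" and \<nu> :: "'x measure" and \<delta> \<theta>\<^sub>1 \<theta>\<^sub>2 :: real
    and \<Phi>\<^sub>0 :: "'x \<Rightarrow> real" and v :: "nat \<Rightarrow> 'x \<Rightarrow> 'u"
  assumes standing: "split_mdp.standing_assumptions \<U> P c \<B> \<nu> \<delta> TYPE('xs::polish_space) TYPE('us::polish_space)"
    and H2: "split_mdp.assumption_H2 \<U> P c \<B> \<nu> \<delta> \<theta>\<^sub>1 \<theta>\<^sub>2"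
    and init: "\<Phi>\<^sub>0 \<in> lsc_bounded_below \<inter> weighted_class (split_mdp.V_star \<U> P c \<B> \<nu> \<delta>)"
    and selector: "\<And>n. mdp.minimizing_selector \<U> P c \<Phi>\<^sub>0 n (v n)"
  shows "\<exists>N\<^sub>0. \<forall>n\<ge>N\<^sub>0. mdp.stabilizing \<U> P c (mdp.of_selector (v n))"
proof -
  interpret stable_split_mdp \<U> P c \<B> \<nu> \<delta>
    by (rule split_mdp.standing_imp_stable_split_mdp[OF standing])
  define C where "C = 2 * enn2real \<beta> / \<delta>"
  have C: "0 \<le> C" using \<delta>_pos by (simp add: C_def)
  have V: "V_star x \<le> \<psi> x" "\<psi> x - C \<le> V_star x" "\<bar>V_star x\<bar> \<le> \<psi> x + C" for x
    using V_star_bounds[of x] \<psi>_nonneg[of x] C by (auto simp: C_def)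
  obtain D where D: "0 \<le> D" "\<And>x. \<exists>u\<in>\<U> x. c x u + (\<integral>\<^sup>+y. ennreal (\<psi> y) \<partial>P x u) \<le> ennreal (\<psi> x + D)"
    by (rule \<psi>_almost_attained) blast
  have \<theta>: "0 < \<theta>\<^sub>1" "\<theta>\<^sub>1 < 1"
    and cost: "\<And>x. ereal (\<theta>\<^sub>1 * V_star x - \<theta>\<^sub>2) \<le> (INF u\<in>\<U> x. enn2ereal (c x u))"
    using H2 by (auto simp: assumption_H2_def)
  \<comment> \<open>Replacing \<open>V_star\<close> by \<open>\<psi>\<close> in (H2) costs
    \<open>\<theta>\<^sub>1 * C\<close>; the absolute value makes the constant nonnegative.\<close>
  define E where "E = \<bar>\<theta>\<^sub>1 * C + \<theta>\<^sub>2\<bar>"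
  have cost_lower: "ennreal (\<theta>\<^sub>1 * \<psi> x - E) \<le> c x u" if u: "u \<in> \<U> x" for x u
  proof -
    have "\<theta>\<^sub>1 * (\<psi> x - C) \<le> \<theta>\<^sub>1 * V_star x" using V(2)[of x] \<theta> by (intro mult_left_mono) auto
    then have "ereal (\<theta>\<^sub>1 * \<psi> x - E) \<le> ereal (\<theta>\<^sub>1 * V_star x - \<theta>\<^sub>2)"
      by (simp add: E_def algebra_simps)
    also have "\<dots> \<le> enn2ereal (c x u)" using cost[of x] INF_lower[OF u, of "\<lambda>u. enn2ereal (c x u)"] by (rule order_trans)
    finally show ?thesis
      by (cases "c x u" rule: ennreal_cases) (auto intro: ennreal_leI)
  qed
  obtain a where a: "\<And>x. a \<le> \<Phi>\<^sub>0 x" using init by (auto simp: lsc_bounded_below_def bdd_below_def)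
  have \<Phi>\<^sub>0_meas: "\<Phi>\<^sub>0 \<in> borel_measurable borel" and norm: "weighted_norm V_star \<Phi>\<^sub>0 < \<infinity>"
    using init by (auto simp: weighted_class_def)
  obtain k where k: "0 \<le> k" "\<And>x. \<bar>\<Phi>\<^sub>0 x\<bar> \<le> k * (1 + \<bar>V_star x\<bar>)"
  proof -
    have "ereal (\<bar>\<Phi>\<^sub>0 x\<bar> / (1 + \<bar>V_star x\<bar>)) \<le> weighted_norm V_star \<Phi>\<^sub>0" for x
      unfolding weighted_norm_def by (rule SUP_upper) simp
    moreover from this[of undefined] norm obtain k where "weighted_norm V_star \<Phi>\<^sub>0 = ereal k"
      by (cases "weighted_norm V_star \<Phi>\<^sub>0") auto
    ultimately have k: "\<bar>\<Phi>\<^sub>0 x\<bar> / (1 + \<bar>V_star x\<bar>) \<le> k" for x by simp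
    then have "\<bar>\<Phi>\<^sub>0 x\<bar> \<le> k * (1 + \<bar>V_star x\<bar>)" for x by (simp add: divide_le_eq)
    moreover have "0 \<le> k" using k[of undefined] by (rule order_trans[rotated]) simp
    ultimately show ?thesis using that by blast
  qed
  \<comment> \<open>The summand \<open>\<bar>a\<bar>\<close> covers the lower bound of the initial
    function; \<open>k * (1 + C)\<close> covers its growth of order \<open>V_star\<close>, both as
    coefficient of \<open>\<psi>\<close> and as additive constant.\<close>
  define K where "K = \<bar>a\<bar> + k * (1 + C)"
  have "0 \<le> K" using k(1) C by (simp add: K_def)
  have K_lower: "- K \<le> \<Phi>\<^sub>0 x" for x
  proof -
    have "0 \<le> k * (1 + C)" using k(1) C by simp
    then show ?thesis using a[of x] by (simp add: K_def)
  qed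
  have K_upper: "\<Phi>\<^sub>0 x \<le> K * \<psi> x + K" for x
  proof -
    have "\<Phi>\<^sub>0 x \<le> k * (1 + \<bar>V_star x\<bar>)" using k(2)[of x] by simp
    also have "\<dots> \<le> k * (1 + (\<psi> x + C))" using k(1) V(3)[of x] by (intro mult_left_mono) auto
    also have "\<dots> = k * \<psi> x + k * (1 + C)" by (simp add: algebra_simps)
    also have "\<dots> \<le> K * \<psi> x + K"
    proof (intro add_mono mult_right_mono \<psi>_nonneg)
      show "k \<le> K" using mult_nonneg_nonneg[OF k(1) C] by (simp add: K_def distrib_left)
      show "k * (1 + C) \<le> K" by (simp add: K_def)
    qed
    finally show ?thesis .
  qed
  interpret approximate_value_iteration \<U> P c \<psi> D E \<theta>\<^sub>1 K \<Phi>\<^sub>0 v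
    by unfold_locales
      (use \<beta>_finite \<psi>_measurable \<psi>_nonneg \<psi>_le_stage D \<theta> cost_lower \<open>0 \<le> K\<close> \<Phi>\<^sub>0_meas K_lower K_upper selector
        in \<open>auto simp: E_def\<close>)
  show ?thesis by (rule eventually_stabilizing)
qed

end
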